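(* Let $n\ge 2$, and let $f,g\in\mathbb{C}[z_1,\ldots,z_n]$ be weighted homogeneous polynomials with weights $w_f$ and $w_g$, respectively, such that $w_g=s\,w_f$, where $s$ is a positive rational number. For every sufficiently small $\varepsilon>0$ the following holds. Let $p\in S_\varepsilon\setminus K_{fg}$ be a singular point of the Milnor fibration product map $\Phi:S_\varepsilon\setminus K_{fg}\to T^2$ associated with $f$ and $g$. Let $r_1,\ldots,r_{2n-2}\in\mathbb{C}^n$ (row vectors) constitute a real basis of the real $(2n-2)$-dimensional vector space $$\{v\in\mathbb{C}^n \mid \mathrm{Re}\langle v,p\rangle=\mathrm{Re}\langle v,i\,\mathrm{grad}\log f(p)\rangle=0\},$$ and let $V=(r_1^T,r_2^T,\ldots,r_{2n-2}^T)$ be the $n\times(2n-2)$ complex matrix with columns $r_j^T$. Then $p$ is a fold point of $\Phi$ if and only if $$\det \mathrm{Re}\bigl(V^T\,\mathrm{Hess}_p(-i(\log g-s\log f))\,V\bigr)\neq 0 .$$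
   Context: Weighted homogeneous: $f\in\mathbb{C}[z_1,\ldots,z_n]$ is weighted homogeneous with weights $w_f=(w_1,\ldots,w_n)$, a sequence of positive rational numbers, if $\sum_{j=1}^n \frac{z_j}{w_j}\frac{\partial f}{\partial z_j}=f$. The equation $w_g=s w_f$ means each weight of $g$ is $s$ times the corresponding weight of $f$. $S_\varepsilon=\{z\in\mathbb{C}^n\mid \|z\|=\varepsilon\}$ and $K_{fg}=\{z\in S_\varepsilon\mid f(z)g(z)=0\}$. The Milnor fibration product map associated with $f,g$ is the $C^\infty$ map $\Phi:S_\varepsilon\setminus K_{fg}\to S^1\times S^1=T^2$, $\Phi(z)=\left(\frac{f(z)}{|f(z)|},\frac{g(z)}{|g(z)|}\right)$. A point $p$ is a singular point of $\Phi$ if $\mathrm{rank}\,d\Phi_p<2$. "For every sufficiently small $\varepsilon>0$" means: there is $\varepsilon_0>0$ (depending on $f,g$) such that the assertion holds for all $0<\varepsilon\le\varepsilon_0$. $\langle u,v\rangle=\sum_j u_j\overline{v_j}$ is the Hermitian inner product. For holomorphic $h$, $\mathrm{grad}\,h=\left(\overline{\partial h/\partial z_1},\ldots,\overline{\partial h/\partial z_n}\right)$; thus $\mathrm{grad}\log f(p)$ has $j$-th entry $\overline{\frac{1}{f(p)}\frac{\partial f}{\partial z_j}(p)}$. $\mathrm{Hess}_p(h)=\left(\frac{\partial^2 h}{\partial z_j\partial z_k}(p)\right)_{j,k}$ is the $n\times n$ complex Hessian matrix (for $\log f,\log g$ use any local branches near $p$; the Hessian does not depend on the choice). $V^T$ is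 the transpose (no conjugation), and $\mathrm{Re}$ of a matrix is taken entrywise. Fold point: a singular point $p$ of a $C^\infty$ map from a $(2n-1)$-manifold to a $2$-manifold is a fold point if there are local coordinates $(x_1,\ldots,x_{2n-1})$ centered at $p$ and $(y_1,y_2)$ centered at $\Phi(p)$ in which $y_1\circ\Phi=x_{2n-1}$ and $y_2\circ\Phi=-x_1^2-\cdots-x_\lambda^2+x_{\lambda+1}^2+\cdots+x_{2n-2}^2$ for some $0\le\lambda\le 2n-2$. *)

theory Defs
  imports "HOL-Analysis.Analysis" "HOL-Library.Poly_Mapping"
begin

section \<open>Weighted homogeneous polynomials\<close>

text \<open>Polynomials in variables indexed by \<^typ>\<open>'n\<close>: finitely supported families of
  coefficients, indexed by exponent vectors.\<close>

type_synonym 'n cpoly = "('n \<Rightarrow>\<^sub>0 nat) \<Rightarrow>\<^sub>0 complex"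

definition cpoly_eval :: "'n::finite cpoly \<Rightarrow> complex^'n \<Rightarrow> complex" where
  "cpoly_eval P z =
     (\<Sum>m\<in>Poly_Mapping.keys P. Poly_Mapping.lookup P m * (\<Prod>j\<in>UNIV. z $ j ^ Poly_Mapping.lookup m j))"

definition partial_deriv :: "'n::finite \<Rightarrow> (complex^'n \<Rightarrow> complex) \<Rightarrow> complex^'n \<Rightarrow> complex" where
  "partial_deriv j h z = deriv (\<lambda>t. h (z + axis j t)) 0"

definition weighted_homogeneous :: "'n::finite cpoly \<Rightarrow> ('n \<Rightarrow> rat) \<Rightarrow> bool" where
  "weighted_homogeneous P w \<longleftrightarrow>
     (\<forall>j. 0 < w j) \<and>
     (\<forall>z. (\<Sum>j\<in>UNIV. z $ j / of_rat (w j) * partial_deriv j (cpoly_eval P) z) = cpoly_eval P z)"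


section \<open>Hermitian product, gradient, Hessian and branches of the logarithm\<close>

definition hermitian :: "complex^'n::finite \<Rightarrow> complex^'n \<Rightarrow> complex" where
  "hermitian u v = (\<Sum>j\<in>UNIV. u $ j * cnj (v $ j))"

definition grad :: "(complex^'n::finite \<Rightarrow> complex) \<Rightarrow> complex^'n \<Rightarrow> complex^'n" where
  "grad h p = (\<chi> j. cnj (partial_deriv j h p))"

definition hessian :: "(complex^'n::finite \<Rightarrow> complex) \<Rightarrow> complex^'n \<Rightarrow> complex^'n^'n" where
  "hessian h p = (\<chi> j k. partial_deriv j (partial_deriv k h) p)"

definition local_log :: "('a::topological_space \<Rightarrow> complex) \<Rightarrow> 'a \<Rightarrow> ('a \<Rightarrow> complex) \<Rightarrow> bool" where
  "local_log F p L \<longleftrightarrow>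
     (\<exists>W. open W \<and> p \<in> W \<and> continuous_on W L \<and> (\<forall>z\<in>W. exp (L z) = F z))"

lemma ex_local_log:
  fixes F :: "'a::topological_space \<Rightarrow> complex"
  assumes "continuous_on UNIV F" and "F p \<noteq> 0"
  shows "\<exists>L. local_log F p L"
proof -
  define W where "W = (\<lambda>z. F z / F p) -` (- \<real>\<^sub>\<le>\<^sub>0)"
  have "continuous_on UNIV (\<lambda>z. F z / F p)"
    using assms by (intro continuous_intros) auto
  then have "open W"
    unfolding W_def by (intro open_vimage) auto
  moreover have "p \<in> W"
    using assms by (simp add: W_def)
  moreover have "continuous_on W (\<lambda>z. Ln (F z / F p) + Ln (F p))"
    using assms by (intro continuous_intros continuous_on_subset[OF assms(1)]) (auto simp: W_def)
  moreover have "\<forall>z\<in>W. exp (Ln (F z / F p) + Ln (F p)) = F z"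
  proof
    fix z assume "z \<in> W"
    then have "F z / F p \<noteq> 0"
      unfolding W_def by (metis ComplD complex_nonpos_Reals_iff order.refl vimageD zero_complex.sel)
    then show "exp (Ln (F z / F p) + Ln (F p)) = F z"
      using assms by (simp add: exp_add exp_Ln)
  qed
  ultimately show ?thesis
    unfolding local_log_def by blast
qed


section \<open>Smooth maps between subsets of Euclidean spaces\<close>

primrec Ck_on :: "nat \<Rightarrow> ('a::euclidean_space \<Rightarrow> 'b::euclidean_space) \<Rightarrow> 'a set \<Rightarrow> bool" where
  "Ck_on 0 F W \<longleftrightarrow> continuous_on W F"
| "Ck_on (Suc k) F W \<longleftrightarrow>
     (\<forall>q\<in>W. F differentiable (at q)) \<and>
     (\<forall>v. Ck_on k (\<lambda>q. frechet_derivative F (at q) v) W)"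

text \<open>A map on an arbitrary subset is smooth if near every point it extends to a \<open>C\<^sup>\<infinity>\<close> map on an
  open subset of the ambient space; on a submanifold this is the intrinsic notion.\<close>

definition smooth_map_on :: "'a::euclidean_space set \<Rightarrow> ('a \<Rightarrow> 'b::euclidean_space) \<Rightarrow> bool" where
  "smooth_map_on S F \<longleftrightarrow>
     (\<forall>p\<in>S. \<exists>W G. open W \<and> p \<in> W \<and> (\<forall>k. Ck_on k G W) \<and> (\<forall>q\<in>S \<inter> W. G q = F q))"

text \<open>Local coordinates on \<open>M\<close>, centered at \<open>p\<close>, with domain \<open>U\<close> and values in the model
  space \<^typ>\<open>'b\<close>.\<close>

definition local_coordinates ::
    "'a::euclidean_space set \<Rightarrow> 'a \<Rightarrow> 'a set \<Rightarrow> ('a \<Rightarrow> 'b::euclidean_space) \<Rightarrow> bool" where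
  "local_coordinates M p U x \<longleftrightarrow>
     openin (top_of_set M) U \<and> p \<in> U \<and> x p = 0 \<and> open (x ` U) \<and>
     (\<exists>x'. homeomorphism U (x ` U) x x' \<and> smooth_map_on U x \<and> smooth_map_on (x ` U) x')"

text \<open>The image of the differential \<open>dF\<^sub>p\<close>, where \<open>dF\<^sub>p (\<gamma>' 0) = (F \<circ> \<gamma>)' 0\<close> for smooth
  curves \<open>\<gamma>\<close> in \<open>M\<close> through \<open>p\<close>.\<close>

definition differential_image ::
    "'a::euclidean_space set \<Rightarrow> ('a \<Rightarrow> 'b::euclidean_space) \<Rightarrow> 'a \<Rightarrow> 'b set" where
  "differential_image M F p =
     {w. \<exists>\<gamma> \<delta>. 0 < \<delta> \<and> smooth_map_on {-\<delta><..<\<delta>} \<gamma> \<and> \<gamma> ` {-\<delta><..<\<delta>} \<subseteq> M \<and> \<gamma> 0 = p \<and>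
          ((F \<circ> \<gamma>) has_vector_derivative w) (at (0::real))}"

definition singular_point ::
    "'a::euclidean_space set \<Rightarrow> ('a \<Rightarrow> 'b::euclidean_space) \<Rightarrow> 'a \<Rightarrow> bool" where
  "singular_point M F p \<longleftrightarrow> p \<in> M \<and> dim (differential_image M F p) < 2"

text \<open>Fold points of a map from a manifold \<open>M\<close> of dimension \<open>CARD('k) + 1\<close> to a surface \<open>N\<close>.
  The source coordinates take values in \<open>\<real>\<^sup>k \<times> \<real>\<close>: \<open>snd (x q)\<close> is the last
  coordinate and \<open>fst (x q) $ j\<close> are the others. As the index type \<^typ>\<open>'k\<close> carries
  no order, the coordinates entering with a negative sign are given by a set \<open>\<Lambda>\<close> of indices;
  numbering \<open>\<Lambda>\<close> first yields the usual normal form with \<open>\<lambda> = card \<Lambda>\<close>.\<close>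

definition fold_point ::
    "'k::finite itself \<Rightarrow> 'a::euclidean_space set \<Rightarrow> 'b::euclidean_space set \<Rightarrow> ('a \<Rightarrow> 'b) \<Rightarrow> 'a \<Rightarrow> bool"
  where
  "fold_point K M N F p \<longleftrightarrow>
     singular_point M F p \<and>
     (\<exists>U (x :: 'a \<Rightarrow> (real^'k) \<times> real) W (y :: 'b \<Rightarrow> real^2) (\<Lambda> :: 'k set).
        local_coordinates M p U x \<and> local_coordinates N (F p) W y \<and> F ` U \<subseteq> W \<and>
        (\<forall>q\<in>U. y (F q) $ 1 = snd (x q) \<and>
                y (F q) $ 2 = - (\<Sum>j\<in>\<Lambda>. (fst (x q) $ j)\<^sup>2) + (\<Sum>j\<in>-\<Lambda>. (fst (x q) $ j)\<^sup>2)))"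


section \<open>The Milnor fibration product map\<close>

definition link :: "real \<Rightarrow> 'n::finite cpoly \<Rightarrow> 'n cpoly \<Rightarrow> (complex^'n) set" where
  "link \<epsilon> f g = {z \<in> sphere 0 \<epsilon>. cpoly_eval f z * cpoly_eval g z = 0}"

definition torus :: "(complex \<times> complex) set" where
  "torus = sphere 0 1 \<times> sphere 0 1"

definition milnor_product_map ::
    "'n::finite cpoly \<Rightarrow> 'n cpoly \<Rightarrow> complex^'n \<Rightarrow> complex \<times> complex" where
  "milnor_product_map f g z =
     (cpoly_eval f z / of_real (cmod (cpoly_eval f z)),
      cpoly_eval g z / of_real (cmod (cpoly_eval g z)))"

end

theory Submission
  imports Defs "HOL-Complex_Analysis.Complex_Analysis"
begin

text \<open>Let \<open>h = -i (log g - s log f)\<close> and \<open>T = Re h\<close>. The Euler vector field \<open>E = (z\<^sub>j / w\<^sub>j)\<close> satisfies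
  \<open>E f = f\<close> and \<open>E g = s g\<close>, so \<open>h\<close> is invariant under its complex flow. In the angles
  \<open>(\<theta>, T) = (arg f, arg g - s arg f)\<close> on the torus the first component of \<open>\<Phi>\<close> is a submersion on every
  sphere, because \<open>i E\<close> is tangent to it and \<open>d\<theta>(i E) = 1\<close>; as \<open>E\<close> is transverse to the sphere, \<open>p\<close> is
  singular exactly if \<open>dh = 0\<close> at \<open>p\<close>. The affine slice through \<open>p\<close> spanned by the \<open>r\<^sub>j\<close> is
  transverse to the flow, and the matrix in question is the Hessian of \<open>T\<close> along it. If it is
  regular, Morse coordinates on the slice, extended constantly along the flow, form together with
  \<open>\<theta>\<close> a chart in which \<open>\<Phi>\<close> has the fold normal form. Conversely, since \<open>p\<close> is a critical point of
  \<open>T\<close>, its Hessian on \<open>ker d\<theta>\<close> can be read off in any fold chart, where it is a nonzero multiple of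
  the nondegenerate normal form.\<close>

section \<open>Smooth maps\<close>

text \<open>Why an affine slice, which does not lie in the sphere, detects the folds of a map on the
  sphere: singularity makes dT vanish on the tangent space of the sphere, and since h is also
  constant along E, T is critical at p in all of C^n. At such a point the second derivative is a
  quadratic form that survives every change of coordinates, and the curvature of the sphere does not
  enter. The slice directions are exactly the tangent directions with d\<theta> = 0, a real
  complement of the complex line spanned by E. The main cost lies in the notion of a fold point: it
  asks for smooth charts with smooth inverses, so the inverse function theorem and the Morse lemma
  are needed with derivatives of all orders. Smoothness is given by iterated directional
  derivatives; the typical regularity proof therefore writes a derivative, by expansion in a basis,
  as a sum of products of functions of the same kind and proceeds by induction on the order.\<close>

abbreviation FD :: "('a::euclidean_space \<Rightarrow> 'b::euclidean_space) \<Rightarrow> 'a \<Rightarrow> 'a \<Rightarrow> 'b" where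
  "FD F q \<equiv> frechet_derivative F (at q)"

abbreviation smooth_on :: "('a::euclidean_space \<Rightarrow> 'b::euclidean_space) \<Rightarrow> 'a set \<Rightarrow> bool" where
  "smooth_on F W \<equiv> \<forall>k. Ck_on k F W"

lemma FD_eqI: "(F has_derivative F') (at q) \<Longrightarrow> FD F q = F'"
  by (rule frechet_derivative_at[symmetric])

lemma has_derivative_FD: "F differentiable (at q) \<Longrightarrow> (F has_derivative FD F q) (at q)"
  by (simp add: frechet_derivative_works)

lemma linear_FD: "F differentiable (at q) \<Longrightarrow> linear (FD F q)"
  by (rule linear_frechet_derivative)

text \<open>\<open>frechet_derivative\<close> is a choice from the set of derivatives. On an open
  set F and G have the same ones, so the chosen maps agree even at points of
  non-differentiability.\<close>

lemma FD_cong: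
  assumes "open W" "q \<in> W" "\<And>z. z \<in> W \<Longrightarrow> F z = G z"
  shows "FD F q = FD G q"
  unfolding frechet_derivative_def
  using has_derivative_transform_within_open[OF _ assms(1,2)] assms(3) by metis

lemma differentiable_cong_open:
  assumes "open W" "q \<in> W" "\<And>z. z \<in> W \<Longrightarrow> F z = G z" "F differentiable (at q)"
  shows "G differentiable (at q)"
  using assms unfolding differentiable_def
  by (metis has_derivative_transform_within_open)

lemma Ck_on_subset: "Ck_on k F W \<Longrightarrow> V \<subseteq> W \<Longrightarrow> Ck_on k F V"
  by (induction k arbitrary: F) (auto intro: continuous_on_subset)

lemma Ck_on_cong:
  assumes "open W" "\<And>q. q \<in> W \<Longrightarrow> F q = G q" "Ck_on k F W"
  shows "Ck_on k G W"
  using assms(2,3)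
proof (induction k arbitrary: F G)
  case 0
  then show ?case by (simp cong: continuous_on_cong)
next
  case (Suc k)
  then have "Ck_on k (\<lambda>q. FD G q v) W" for v
    using FD_cong[OF assms(1), of _ F G] by (metis (no_types, lifting) Ck_on.simps(2))
  then show ?case
    using Suc.prems differentiable_cong_open[OF assms(1), of _ F G] by auto
qed

lemma Ck_on_SucD: "Ck_on (Suc k) F W \<Longrightarrow> Ck_on k F W"
proof (induction k arbitrary: F)
  case 0
  then show ?case
    using differentiable_at_imp_differentiable_on[of W F]
    by (auto intro: differentiable_imp_continuous_on)
next
  case (Suc k)
  then show ?case by (metis Ck_on.simps(2))
qed

lemma smooth_on_continuous_on: "smooth_on F W \<Longrightarrow> continuous_on W F"
  by (metis Ck_on.simps(1))

lemma smooth_on_differentiable: "smooth_on F W \<Longrightarrow> q \<in> W \<Longrightarrow> F differentiable (at q)"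
  by (metis Ck_on.simps(2))

lemma smooth_on_has_derivative: "smooth_on F W \<Longrightarrow> q \<in> W \<Longrightarrow> (F has_derivative FD F q) (at q)"
  using has_derivative_FD smooth_on_differentiable by blast

lemma smooth_on_FD: "smooth_on F W \<Longrightarrow> smooth_on (\<lambda>q. FD F q v) W"
  by (metis Ck_on.simps(2))

lemma Ck_on_const: "Ck_on k (\<lambda>q. c) W"
proof (induction k arbitrary: c)
  case (Suc k)
  have "FD (\<lambda>q::'a. c) q = (\<lambda>v. 0)" for q
    by (rule FD_eqI) simp
  then show ?case using Suc by simp
qed simp

lemma Ck_on_linear:
  assumes "linear L"
  shows "Ck_on k L W"
proof (cases k)
  case 0
  then show ?thesis using assms by (simp add: linear_continuous_on linear_linear)
next
  case (Suc j)
  have *: "(L has_derivative L) (at q)" for q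
    using assms by (simp add: bounded_linear_imp_has_derivative linear_linear)
  then have "FD L q = L" for q
    by (rule FD_eqI)
  then show ?thesis
    using Suc * by (auto simp: Ck_on_const differentiable_def)
qed

lemma Ck_on_add:
  assumes "open W" "Ck_on k F W" "Ck_on k G W"
  shows "Ck_on k (\<lambda>q. F q + G q) W"
  using assms(2,3)
proof (induction k arbitrary: F G)
  case 0
  then show ?case by (auto intro: continuous_intros)
next
  case (Suc k)
  show ?case
    unfolding Ck_on.simps
  proof (intro conjI ballI allI)
    show "(\<lambda>q. F q + G q) differentiable (at q)" if "q \<in> W" for q
      using Suc.prems that by (auto intro: differentiable_add)
    fix v
    have "FD F q v + FD G q v = FD (\<lambda>q. F q + G q) q v" if "q \<in> W" for q
      using Suc.prems that by (auto intro!: FD_eqI[THEN fun_cong, symmetric] has_derivative_add has_derivative_FD)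
    moreover have "Ck_on k (\<lambda>q. FD F q v + FD G q v) W"
      using Suc.prems by (intro Suc.IH) auto
    ultimately show "Ck_on k (\<lambda>q. FD (\<lambda>q. F q + G q) q v) W"
      by (rule Ck_on_cong[OF assms(1)])
  qed
qed

lemma Ck_on_sum:
  assumes "open W" "\<And>i. i \<in> I \<Longrightarrow> Ck_on k (F i) W"
  shows "Ck_on k (\<lambda>q. \<Sum>i\<in>I. F i q) W"
  using assms(2)
  by (induction I rule: infinite_finite_induct) (auto intro: Ck_on_add Ck_on_const assms(1))

text \<open>The product rule gives two terms of the same bilinear shape, each with one derivative,
  so the induction closes. Scalar, inner and matrix products are all instances.\<close>

lemma Ck_on_bilinear:
  assumes "open W" "bounded_bilinear B" "Ck_on k F W" "Ck_on k G W"
  shows "Ck_on k (\<lambda>q. B (F q) (G q)) W"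
  using assms(3,4)
proof (induction k arbitrary: F G)
  case 0
  then show ?case
    using bounded_bilinear.continuous_on[OF assms(2)] by simp
next
  case (Suc k)
  have der: "((\<lambda>q. B (F q) (G q)) has_derivative (\<lambda>v. B (F q) (FD G q v) + B (FD F q v) (G q))) (at q)"
    if "q \<in> W" for q
    using Suc.prems that
    by (intro bounded_bilinear.FDERIV[OF assms(2)] has_derivative_FD) auto
  have "B (F q) (FD G q v) + B (FD F q v) (G q) = FD (\<lambda>q. B (F q) (G q)) q v" if "q \<in> W" for q v
    using FD_eqI[OF der[OF that]] by simp
  moreover have "Ck_on k (\<lambda>q. B (F q) (FD G q v) + B (FD F q v) (G q)) W" for v
    using Suc.prems by (intro Ck_on_add[OF assms(1)] Suc.IH) (auto intro: Ck_on_SucD)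
  ultimately have "Ck_on k (\<lambda>q. FD (\<lambda>q. B (F q) (G q)) q v) W" for v
    by (rule Ck_on_cong[OF assms(1)])
  then show ?case
    using der by (auto simp: differentiable_def)
qed

lemmas Ck_on_scaleR = Ck_on_bilinear[OF _ bounded_bilinear_scaleR]
lemmas Ck_on_mult = Ck_on_bilinear[OF _ bounded_bilinear_mult]
lemmas Ck_on_inner = Ck_on_bilinear[OF _ bounded_bilinear_inner]

lemma linear_basis_expansion:
  fixes L :: "'a::euclidean_space \<Rightarrow> 'b::real_vector"
  assumes "linear L"
  shows "L v = (\<Sum>b\<in>Basis. (v \<bullet> b) *\<^sub>R L b)"
proof -
  have "L v = L (\<Sum>b\<in>Basis. (v \<bullet> b) *\<^sub>R b)"
    by (simp add: euclidean_representation)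
  also have "\<dots> = (\<Sum>b\<in>Basis. (v \<bullet> b) *\<^sub>R L b)"
    by (simp add: linear_sum[OF assms] linear_scale[OF assms])
  finally show ?thesis .
qed

text \<open>The chain rule applies \<open>FD F (G q)\<close> to the moving vector
  \<open>FD G q v\<close>. Expanding that vector in a basis separates the two dependences on q:
  derivatives of F in fixed directions fall under the induction hypothesis, and the coefficients
  come from G.\<close>

lemma Ck_on_compose:
  fixes G :: "'a::euclidean_space \<Rightarrow> 'b::euclidean_space" and F :: "'b \<Rightarrow> 'c::euclidean_space"
  assumes "open V" "Ck_on k F W" "Ck_on k G V" "G ` V \<subseteq> W"
  shows "Ck_on k (\<lambda>q. F (G q)) V"
  using assms(2,3)
proof (induction k arbitrary: F)
  case 0
  then show ?case
    using assms(4) by (auto intro: continuous_on_compose2)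
next
  case (Suc k)
  have der: "((\<lambda>q. F (G q)) has_derivative (\<lambda>v. FD F (G q) (FD G q v))) (at q)" if "q \<in> V" for q
    using Suc.prems that assms(4)
    by (intro has_derivative_compose[of G _ q UNIV F] has_derivative_FD) auto
  have "(\<Sum>b\<in>Basis. (FD G q v \<bullet> b) *\<^sub>R FD F (G q) b) = FD (\<lambda>q. F (G q)) q v" if "q \<in> V" for q v
  proof -
    have "linear (FD F (G q))"
      using Suc.prems that assms(4) by (intro linear_FD) auto
    then show ?thesis
      using FD_eqI[OF der[OF that]] linear_basis_expansion by metis
  qed
  moreover have "Ck_on k (\<lambda>q. (\<Sum>b\<in>Basis. (FD G q v \<bullet> b) *\<^sub>R FD F (G q) b)) V" for v
    using Suc.prems
    by (intro Ck_on_sum Ck_on_scaleR Ck_on_inner Ck_on_const Suc.IH \<open>open V\<close>)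
       (auto intro: Ck_on_SucD)
  ultimately have "Ck_on k (\<lambda>q. FD (\<lambda>q. F (G q)) q v) V" for v
    by (rule Ck_on_cong[OF assms(1)])
  then show ?case
    using der by (auto simp: differentiable_def)
qed

lemma Ck_on_linear_compose:
  assumes "open W" "linear L" "Ck_on k F W"
  shows "Ck_on k (\<lambda>q. L (F q)) W"
  using Ck_on_compose[OF assms(1) Ck_on_linear[OF assms(2), of _ UNIV] assms(3)] by simp

lemma Ck_on_diff:
  assumes "open W" "Ck_on k F W" "Ck_on k G W"
  shows "Ck_on k (\<lambda>q. F q - G q) W"
proof -
  have "Ck_on k (\<lambda>q. F q + (-1) *\<^sub>R G q) W"
    by (intro Ck_on_add Ck_on_scaleR Ck_on_const assms)
  then show ?thesis by simp
qed

lemma Ck_on_Pair: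
  assumes "open W" "Ck_on k F W" "Ck_on k G W"
  shows "Ck_on k (\<lambda>q. (F q, G q)) W"
proof -
  have L: "linear (\<lambda>x::'b. (x, 0::'c))" "linear (\<lambda>x::'c. (0::'b, x))"
    by (auto intro!: linearI)
  have "Ck_on k (\<lambda>q. (F q, 0) + (0, G q)) W"
    by (rule Ck_on_add[OF assms(1) Ck_on_linear_compose[OF assms(1) L(1) assms(2)]
          Ck_on_linear_compose[OF assms(1) L(2) assms(3)]])
  then show ?thesis by simp
qed

lemma Ck_on_fst: "open W \<Longrightarrow> Ck_on k F W \<Longrightarrow> Ck_on k (\<lambda>q. fst (F q)) W"
  by (rule Ck_on_linear_compose) (auto intro: linear_fst)

lemma Ck_on_snd: "open W \<Longrightarrow> Ck_on k F W \<Longrightarrow> Ck_on k (\<lambda>q. snd (F q)) W"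
  by (rule Ck_on_linear_compose) (auto intro: linear_snd)

lemma Ck_on_componentwise:
  assumes "open W" "\<And>b. b \<in> Basis \<Longrightarrow> Ck_on k (\<lambda>q. F q \<bullet> b) W"
  shows "Ck_on k F W"
proof -
  have "Ck_on k (\<lambda>q. \<Sum>b\<in>Basis. (F q \<bullet> b) *\<^sub>R b) W"
    by (intro Ck_on_sum Ck_on_scaleR Ck_on_const assms)
  then show ?thesis by (simp add: euclidean_representation)
qed

lemma Ck_on_vec_nth:
  fixes F :: "'a::euclidean_space \<Rightarrow> 'b::euclidean_space^'m"
  assumes "open W" "Ck_on k F W"
  shows "Ck_on k (\<lambda>q. F q $ i) W"
  by (rule Ck_on_linear_compose[OF assms(1) _ assms(2)]) (auto intro: linearI)

lemma Ck_on_vec_lambda: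
  fixes F :: "'a::euclidean_space \<Rightarrow> 'b::euclidean_space^'m"
  assumes "open W" "\<And>i. Ck_on k (\<lambda>q. F q $ i) W"
  shows "Ck_on k F W"
proof (rule Ck_on_componentwise[OF assms(1)])
  fix b :: "'b^'m" assume "b \<in> Basis"
  then obtain i c where "b = axis i c"
    by (auto simp: Basis_vec_def)
  then have "(\<lambda>q. F q \<bullet> b) = (\<lambda>q. F q $ i \<bullet> c)"
    by (simp add: inner_axis)
  then show "Ck_on k (\<lambda>q. F q \<bullet> b) W"
    using Ck_on_inner[OF assms(1) assms(2)[of i] Ck_on_const[of k c]] by simp
qed

text \<open>The directional derivative is \<open>deriv F q * v\<close>, and \<open>deriv F\<close>
  is again holomorphic, so the induction never leaves holomorphic functions.\<close>

lemma Ck_on_holomorphic: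
  assumes "open S" "F holomorphic_on S"
  shows "Ck_on k F S"
  using assms(2)
proof (induction k arbitrary: F)
  case 0
  then show ?case by (simp add: holomorphic_on_imp_continuous_on)
next
  case (Suc k)
  have der: "(F has_derivative (\<lambda>v. deriv F q * v)) (at q)" if "q \<in> S" for q
    using holomorphic_derivI[OF Suc.prems assms(1) that] by (simp add: has_field_derivative_def)
  have "deriv F q * v = FD F q v" if "q \<in> S" for q v
    using FD_eqI[OF der[OF that]] by simp
  moreover have "Ck_on k (\<lambda>q. deriv F q * v) S" for v
    by (intro Ck_on_mult assms Ck_on_const Suc.IH holomorphic_deriv Suc.prems)
  ultimately have "Ck_on k (\<lambda>q. FD F q v) S" for v
    by (rule Ck_on_cong[OF assms(1)])
  then show ?case
    using der by (auto simp: differentiable_def)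
qed

lemma Ck_on_exp:
  fixes F :: "'a::euclidean_space \<Rightarrow> complex"
  assumes "open W" "Ck_on k F W"
  shows "Ck_on k (\<lambda>q. exp (F q)) W"
  by (rule Ck_on_compose[OF assms(1) Ck_on_holomorphic[of UNIV exp] assms(2)])
     (auto intro: holomorphic_intros)

lemma Ck_on_Ln:
  fixes F :: "'a::euclidean_space \<Rightarrow> complex"
  assumes "open W" "Ck_on k F W" "\<And>q. q \<in> W \<Longrightarrow> F q \<notin> \<real>\<^sub>\<le>\<^sub>0"
  shows "Ck_on k (\<lambda>q. Ln (F q)) W"
  by (rule Ck_on_compose[OF assms(1) Ck_on_holomorphic[of "-\<real>\<^sub>\<le>\<^sub>0" Ln] assms(2)])
     (use assms(3) in \<open>auto intro: holomorphic_intros\<close>)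

lemma Ck_on_power:
  fixes F :: "'a::euclidean_space \<Rightarrow> 'b::{real_normed_algebra_1, euclidean_space}"
  assumes "open W" "Ck_on k F W"
  shows "Ck_on k (\<lambda>q. F q ^ m) W"
  by (induction m) (auto intro: Ck_on_const Ck_on_mult assms)

lemma Ck_on_prod:
  fixes F :: "'i \<Rightarrow> 'a::euclidean_space \<Rightarrow> 'b::{real_normed_algebra_1, comm_ring_1, euclidean_space}"
  assumes "open W" "\<And>i. i \<in> I \<Longrightarrow> Ck_on k (F i) W"
  shows "Ck_on k (\<lambda>q. \<Prod>i\<in>I. F i q) W"
  using assms(2)
  by (induction I rule: infinite_finite_induct) (auto intro: Ck_on_const Ck_on_mult assms(1))

section \<open>Smoothness on subsets and on open sets\<close>

lemma smooth_on_imp_smooth_map_on: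
  assumes "open W" "smooth_on G W" "S \<subseteq> W" "\<And>q. q \<in> S \<Longrightarrow> G q = F q"
  shows "smooth_map_on S F"
  unfolding smooth_map_on_def using assms by blast

text \<open>Near each point of an open set the smooth extension restricts to a neighbourhood on
  which it is F itself, and the conditions in \<open>Ck_on\<close> are local. This makes the inverse
  charts of \<open>local_coordinates\<close> differentiable in the ambient sense.\<close>

lemma smooth_map_on_open_imp_smooth_on:
  fixes F :: "'a::euclidean_space \<Rightarrow> 'b::euclidean_space"
  assumes "open S" "smooth_map_on S F"
  shows "smooth_on F S"
proof -
  have loc: "\<exists>W. open W \<and> p \<in> W \<and> W \<subseteq> S \<and> (\<forall>k. Ck_on k F W)" if "p \<in> S" for p
  proof -
    obtain W G where W: "open W" "p \<in> W" "\<forall>k. Ck_on k G W" "\<forall>q\<in>S \<inter> W. G q = F q"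
      using assms(2) \<open>p \<in> S\<close> unfolding smooth_map_on_def by metis
    have "Ck_on k G (S \<inter> W)" for k
      using W(3) by (metis Ck_on_subset inf_le2)
    then have "Ck_on k F (S \<inter> W)" for k
      by (rule Ck_on_cong[rotated 2]) (use W assms(1) in auto)
    then show ?thesis using W assms(1) \<open>p \<in> S\<close> by (intro exI[of _ "S \<inter> W"]) auto
  qed
  have glue: "Ck_on k F S" if "\<And>p. p \<in> S \<Longrightarrow> \<exists>W. open W \<and> p \<in> W \<and> W \<subseteq> S \<and> Ck_on k F W"
    for k and F :: "'a \<Rightarrow> 'b"
    using that
  proof (induction k arbitrary: F)
    case 0
    show ?case
      unfolding Ck_on.simps continuous_on_eq_continuous_at[OF assms(1)]
      using 0 by (metis Ck_on.simps(1) continuous_on_eq_continuous_at)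
  next
    case (Suc k)
    have "F differentiable (at q)" if "q \<in> S" for q
      using Suc.prems[OF that] by auto
    moreover have "Ck_on k (\<lambda>q. FD F q v) S" for v
      using Suc.prems by (intro Suc.IH) (metis Ck_on.simps(2))
    ultimately show ?case by simp
  qed
  show ?thesis using loc glue by meson
qed

section \<open>The smooth inverse function theorem\<close>

text \<open>A product rule for a factor G that is merely continuous: as F vanishes at q, the error
  splits into the remainder of F times \<open>G y\<close>, plus \<open>F' (y - q)\<close> times
  \<open>G y - G q\<close>, both of smaller order. It allows differentiation before G is known to be
  differentiable.\<close>

lemma has_derivative_scaleR_vanishing:
  fixes F :: "'a::real_normed_vector \<Rightarrow> real" and G :: "'a \<Rightarrow> 'b::real_normed_vector"
  assumes "(F has_derivative F') (at q)" "F q = 0" "isCont G q"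
  shows "((\<lambda>z. F z *\<^sub>R G z) has_derivative (\<lambda>v. F' v *\<^sub>R G q)) (at q)"
  unfolding has_derivative_at2
proof
  have bl: "bounded_linear F'"
    using assms(1) by (rule has_derivative_bounded_linear)
  then show "bounded_linear (\<lambda>v. F' v *\<^sub>R G q)"
    by (rule bounded_linear_scaleR_const)
  obtain K where K: "\<And>v. norm (F' v) \<le> norm v * K" "0 < K"
    using bounded_linear.pos_bounded[OF bl] by blast
  have lim: "((\<lambda>y. (1 / norm (y - q)) *\<^sub>R (F y - (F q + F' (y - q)))) \<longlongrightarrow> 0) (at q)"
    using assms(1) unfolding has_derivative_at2 by blast
  have G: "(G \<longlongrightarrow> G q) (at q)"
    using assms(3) isCont_def by blast
  have "((\<lambda>y. ((1 / norm (y - q)) *\<^sub>R (F y - (F q + F' (y - q)))) *\<^sub>R G y) \<longlongrightarrow> 0 *\<^sub>R G q) (at q)"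
    by (rule tendsto_scaleR[OF lim G])
  moreover have "((\<lambda>y. (F' (y - q) / norm (y - q)) *\<^sub>R (G y - G q)) \<longlongrightarrow> 0) (at q)"
  proof (rule Lim_null_comparison)
    show "\<forall>\<^sub>F y in at q. norm ((F' (y - q) / norm (y - q)) *\<^sub>R (G y - G q)) \<le> K * norm (G y - G q)"
      unfolding eventually_at_filter
    proof (intro always_eventually allI impI)
      fix y assume "y \<noteq> q"
      then have "\<bar>F' (y - q)\<bar> / norm (y - q) \<le> K"
        using K(1)[of "y - q"] by (simp add: field_simps)
      then show "norm ((F' (y - q) / norm (y - q)) *\<^sub>R (G y - G q)) \<le> K * norm (G y - G q)"
        using mult_right_mono[OF _ norm_ge_zero[of "G y - G q"], of "\<bar>F' (y - q)\<bar> / norm (y - q)" K] by simp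
    qed
    have "((\<lambda>y. K * norm (G y - G q)) \<longlongrightarrow> K * norm (G q - G q)) (at q)"
      by (intro tendsto_intros G)
    then show "((\<lambda>y. K * norm (G y - G q)) \<longlongrightarrow> 0) (at q)" by simp
  qed
  ultimately have "((\<lambda>y. ((1 / norm (y - q)) *\<^sub>R (F y - (F q + F' (y - q)))) *\<^sub>R G y +
      (F' (y - q) / norm (y - q)) *\<^sub>R (G y - G q)) \<longlongrightarrow> 0) (at q)"
    using tendsto_add by fastforce
  moreover have "((1 / norm (y - q)) *\<^sub>R (F y - (F q + F' (y - q)))) *\<^sub>R G y +
      (F' (y - q) / norm (y - q)) *\<^sub>R (G y - G q) =
      (1 / norm (y - q)) *\<^sub>R (F y *\<^sub>R G y - (F q *\<^sub>R G q + F' (y - q) *\<^sub>R G q))" for y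
    using assms(2) by (simp add: algebra_simps diff_divide_distrib)
  ultimately show "((\<lambda>y. (1 / norm (y - q)) *\<^sub>R
      (F y *\<^sub>R G y - (F q *\<^sub>R G q + F' (y - q) *\<^sub>R G q))) \<longlongrightarrow> 0) (at q)"
    by (simp only:)
qed

lemma linear_two_sided_inverse:
  assumes "linear A" "\<And>v. A (B v) = v" "\<And>v. B (A v) = v"
  shows "linear B"
proof (rule linearI)
  fix x y c
  have "A (B x + B y) = x + y" "A (c *\<^sub>R B x) = c *\<^sub>R x"
    by (simp_all add: linear_add[OF assms(1)] linear_scale[OF assms(1)] assms(2))
  from this[THEN arg_cong[where f = B]]
  show "B (x + y) = B x + B y" "B (c *\<^sub>R x) = c *\<^sub>R B x"
    by (simp_all add: assms(3))
qed

text \<open>Near \<open>q0\<close> the maps \<open>A q\<close> are bounded below with a uniform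
  constant, so the inverses cannot blow up. Applied to \<open>B q v - B q0 v\<close>, this bound
  reduces its size to that of \<open>A q - A q0\<close>.\<close>

lemma continuous_on_inverse_family:
  fixes A B :: "'a::euclidean_space \<Rightarrow> 'b::euclidean_space \<Rightarrow> 'b"
  assumes "open W" and linA: "\<And>q. q \<in> W \<Longrightarrow> linear (A q)"
    and AB: "\<And>q v. q \<in> W \<Longrightarrow> A q (B q v) = v"
    and BA: "\<And>q v. q \<in> W \<Longrightarrow> B q (A q v) = v"
    and contA: "\<And>v. continuous_on W (\<lambda>q. A q v)"
  shows "continuous_on W (\<lambda>q. B q v)"
proof -
  have linB: "linear (B q)" if "q \<in> W" for q
    using linear_two_sided_inverse[of "A q" "B q"] linA AB BA that by blast
  have "isCont (\<lambda>q. B q v) q0" if q0: "q0 \<in> W" for q0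
  proof -
    obtain K where K: "0 < K" "\<And>x. norm (B q0 x) \<le> K * norm x"
      using linear_bounded_pos[OF linB[OF q0]] by blast
    \<comment> \<open>The sum over the basis dominates the operator norm of
      \<open>A q - A q0\<close> and tends to 0 by the continuity of finitely many values.\<close>
    define \<delta> where "\<delta> q = (\<Sum>b\<in>Basis. norm (A q b - A q0 b))" for q
    have \<delta>0: "(\<delta> \<longlongrightarrow> 0) (at q0)"
    proof -
      have "((\<lambda>q. A q b) \<longlongrightarrow> A q0 b) (at q0)" for b
        using contA[of b] q0 assms(1) by (simp add: continuous_on_eq_continuous_at isCont_def)
      then have "(\<delta> \<longlongrightarrow> (\<Sum>b\<in>Basis. norm (A q0 b - A q0 b))) (at q0)"
        unfolding \<delta>_def by (intro tendsto_intros)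
      then show ?thesis by simp
    qed
    have dif: "norm (A q x - A q0 x) \<le> \<delta> q * norm x" if "q \<in> W" for q x
    proof -
      have "linear (\<lambda>x. A q x - A q0 x)"
        using linA that q0 by (intro linear_compose_sub) auto
      then have "A q x - A q0 x = (\<Sum>b\<in>Basis. (x \<bullet> b) *\<^sub>R (A q b - A q0 b))"
        by (rule linear_basis_expansion)
      also have "norm \<dots> \<le> (\<Sum>b\<in>Basis. norm x * norm (A q b - A q0 b))"
        by (intro sum_norm_le) (auto intro!: mult_right_mono Basis_le_norm)
      finally show ?thesis by (simp add: \<delta>_def sum_distrib_left mult.commute)
    qed
    \<comment> \<open>Half of \<open>norm x\<close> is absorbed on the left as soon as
      \<open>K * \<delta> q \<le> 1/2\<close>; this is the origin of the factor 2.\<close>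
    have lower: "norm x \<le> 2 * K * norm (A q x)" if "q \<in> W" "K * \<delta> q \<le> 1/2" for q x
    proof -
      have "norm x = norm (B q0 (A q0 x))" using q0 BA by simp
      also have "\<dots> \<le> K * norm (A q0 x)" by (rule K(2))
      also have "\<dots> \<le> K * (norm (A q x) + norm (A q x - A q0 x))"
        using K(1) norm_triangle_sub[of "A q0 x" "A q x"] by (simp add: norm_minus_commute)
      also have "\<dots> \<le> K * (norm (A q x) + \<delta> q * norm x)"
        using dif[OF that(1)] K(1) by simp
      also have "\<dots> \<le> K * norm (A q x) + 1/2 * norm x"
        using mult_right_mono[OF that(2), of "norm x"] by (simp add: algebra_simps)
      finally show ?thesis by simp
    qed
    have "((\<lambda>q. B q v - B q0 v) \<longlongrightarrow> 0) (at q0)"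
    proof (rule Lim_null_comparison)
      have ev1: "\<forall>\<^sub>F q in at q0. q \<in> W"
        using assms(1) q0 by (simp add: eventually_at_topological) blast
      have ev2: "\<forall>\<^sub>F q in at q0. K * \<delta> q \<le> 1/2"
      proof -
        have "\<forall>\<^sub>F q in at q0. \<delta> q < 1 / (2 * K)"
          using \<delta>0 K(1) by (intro order_tendstoD) auto
        then show ?thesis
          by eventually_elim (use K(1) in \<open>simp add: field_simps\<close>)
      qed
      show "\<forall>\<^sub>F q in at q0. norm (B q v - B q0 v) \<le> 2 * K * (\<delta> q * norm (B q0 v))"
        using ev1 ev2
      proof eventually_elim
        case (elim q)
        have "A q (B q v - B q0 v) = A q0 (B q0 v) - A q (B q0 v)"
          using elim q0 by (simp add: linear_diff[OF linA] AB)
        then have "norm (A q (B q v - B q0 v)) \<le> \<delta> q * norm (B q0 v)"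
          using dif[OF elim(1), of "B q0 v"] by (simp add: norm_minus_commute)
        then show ?case
          using order_trans[OF lower[OF elim, of "B q v - B q0 v"] mult_left_mono] K(1) by simp
      qed
      have "((\<lambda>q. 2 * K * (\<delta> q * norm (B q0 v))) \<longlongrightarrow> 2 * K * (0 * norm (B q0 v))) (at q0)"
        by (intro tendsto_intros \<delta>0)
      then show "((\<lambda>q. 2 * K * (\<delta> q * norm (B q0 v))) \<longlongrightarrow> 0) (at q0)" by simp
    qed
    then show ?thesis
      unfolding isCont_def by (rule LIM_zero_cancel)
  qed
  then show ?thesis
    using assms(1) by (simp add: continuous_on_eq_continuous_at)
qed

text \<open>The derivative of an inverse is - B (dA) B, an expression in B and first derivatives of
  A only. Both are C^k if A is C^(k+1), for B by the induction hypothesis, so B gains one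
  order.\<close>

lemma Ck_on_inverse_family:
  fixes A B :: "'a::euclidean_space \<Rightarrow> 'b::euclidean_space \<Rightarrow> 'b"
  assumes "open W" and linA: "\<And>q. q \<in> W \<Longrightarrow> linear (A q)"
    and AB: "\<And>q v. q \<in> W \<Longrightarrow> A q (B q v) = v"
    and BA: "\<And>q v. q \<in> W \<Longrightarrow> B q (A q v) = v"
    and CkA: "\<And>v. Ck_on k (\<lambda>q. A q v) W"
  shows "Ck_on k (\<lambda>q. B q v) W"
  using CkA
proof (induction k arbitrary: v)
  case 0
  then show ?case
    using continuous_on_inverse_family[OF assms(1) linA AB BA] by simp
next
  case (Suc k)
  have linB: "linear (B q)" if "q \<in> W" for q
    using linear_two_sided_inverse[of "A q" "B q"] linA AB BA that by blast
  have A': "Ck_on k (\<lambda>q. A q v) W" for v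
    using Suc.prems Ck_on_SucD by blast
  have IH: "Ck_on k (\<lambda>q. B q v) W" for v
    using Suc.IH A' by blast
  have contB: "isCont (\<lambda>q. B q v) q" if "q \<in> W" for q v
  proof -
    have "continuous_on W (\<lambda>q. A q v)" for v
      using Suc.prems[of v] by (auto intro!: continuous_at_imp_continuous_on
          differentiable_imp_continuous_within)
    then have "continuous_on W (\<lambda>q. B q v)"
      by (intro continuous_on_inverse_family[where A = A and B = B, OF assms(1) linA AB BA])
    then show ?thesis using assms(1) that by (simp add: continuous_on_eq_continuous_at)
  qed
  \<comment> \<open>With \<open>x = B q0 v\<close>, the identity
    \<open>B q v = x - B q (A q x - A q0 x)\<close> contains a factor that vanishes at
    \<open>q0\<close>, so continuity of B is enough to differentiate it.\<close>
  have der: "((\<lambda>q. B q v) has_derivative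
      (\<lambda>e. - (\<Sum>b\<in>Basis. (FD (\<lambda>q. A q (B q0 v)) q0 e \<bullet> b) *\<^sub>R B q0 b))) (at q0)"
    if q0: "q0 \<in> W" for q0 v
  proof -
    define x where "x = B q0 v"
    have dA: "((\<lambda>q. A q x) has_derivative FD (\<lambda>q. A q x) q0) (at q0)"
      using Suc.prems[of x] q0 by (intro has_derivative_FD) auto
    have "((\<lambda>q. \<Sum>b\<in>Basis. ((A q x - A q0 x) \<bullet> b) *\<^sub>R B q b) has_derivative
        (\<lambda>e. \<Sum>b\<in>Basis. (FD (\<lambda>q. A q x) q0 e \<bullet> b) *\<^sub>R B q0 b)) (at q0)"
    proof (intro has_derivative_sum has_derivative_scaleR_vanishing contB[OF q0])
      fix b :: 'b
      show "((\<lambda>q. (A q x - A q0 x) \<bullet> b) has_derivative (\<lambda>e. FD (\<lambda>q. A q x) q0 e \<bullet> b)) (at q0)"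
        by (rule has_derivative_inner_left) (use has_derivative_diff[OF dA has_derivative_const] in simp)
    qed simp
    then have d: "((\<lambda>q. x - (\<Sum>b\<in>Basis. ((A q x - A q0 x) \<bullet> b) *\<^sub>R B q b)) has_derivative
        (\<lambda>e. 0 - (\<Sum>b\<in>Basis. (FD (\<lambda>q. A q x) q0 e \<bullet> b) *\<^sub>R B q0 b))) (at q0)"
      by (intro has_derivative_diff has_derivative_const)
    have e: "x - (\<Sum>b\<in>Basis. ((A q x - A q0 x) \<bullet> b) *\<^sub>R B q b) = B q v" if "q \<in> W" for q
    proof -
      have "(\<Sum>b\<in>Basis. ((A q x - A q0 x) \<bullet> b) *\<^sub>R B q b) = B q (A q x - A q0 x)"
        using linear_basis_expansion[OF linB[OF that], of "A q x - A q0 x"] by simp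
      also have "\<dots> = x - B q v"
        using that q0 by (simp add: linear_diff[OF linB] BA AB x_def)
      finally show ?thesis by simp
    qed
    show ?thesis
      using has_derivative_transform_within_open[OF d assms(1) q0 e] by (simp add: x_def)
  qed
  \<comment> \<open>The argument \<open>B q0 v\<close> of A varies with \<open>q0\<close>. Expanding
    it as well leaves A at fixed vectors only, where the regularity assumption applies.\<close>
  have fd: "FD (\<lambda>q. B q v) q0 e =
      - (\<Sum>b\<in>Basis. (\<Sum>c\<in>Basis. (B q0 v \<bullet> c) * (FD (\<lambda>q. A q c) q0 e \<bullet> b)) *\<^sub>R B q0 b)"
    if q0: "q0 \<in> W" for q0 v e
  proof -
    have "FD (\<lambda>q. A q x) q0 e = (\<Sum>c\<in>Basis. (x \<bullet> c) *\<^sub>R FD (\<lambda>q. A q c) q0 e)" for x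
    proof -
      have "((\<lambda>q. \<Sum>c\<in>Basis. (x \<bullet> c) *\<^sub>R A q c) has_derivative
          (\<lambda>e. \<Sum>c\<in>Basis. (x \<bullet> c) *\<^sub>R FD (\<lambda>q. A q c) q0 e)) (at q0)"
        using Suc.prems q0
        by (intro has_derivative_sum has_derivative_scaleR_right has_derivative_FD) auto
      then have "((\<lambda>q. A q x) has_derivative
          (\<lambda>e. \<Sum>c\<in>Basis. (x \<bullet> c) *\<^sub>R FD (\<lambda>q. A q c) q0 e)) (at q0)"
        by (rule has_derivative_transform_within_open[OF _ assms(1) q0])
           (use linear_basis_expansion[OF linA] in simp)
      from FD_eqI[OF this] show ?thesis by simp
    qed
    from this[of "B q0 v"] show ?thesis
      unfolding FD_eqI[OF der[OF q0]] by (simp only: inner_sum_left inner_scaleR_left)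
  qed
  have "Ck_on k (\<lambda>q. FD (\<lambda>q. B q v) q e) W" for e
  proof -
    have "Ck_on k (\<lambda>q. 0 - (\<Sum>b\<in>Basis. (\<Sum>c\<in>Basis. (B q v \<bullet> c) * (FD (\<lambda>q. A q c) q e \<bullet> b)) *\<^sub>R B q b)) W"
      using Suc.prems
      by (intro Ck_on_diff Ck_on_const Ck_on_sum Ck_on_scaleR Ck_on_mult Ck_on_inner IH assms(1)) auto
    then show ?thesis
      by (rule Ck_on_cong[OF assms(1), rotated]) (simp add: fd)
  qed
  then show ?case
    using der by (auto simp: differentiable_def)
qed

lemma continuous_on_Blinfun_FD:
  fixes F :: "'a::euclidean_space \<Rightarrow> 'b::euclidean_space"
  assumes "smooth_on F W"
  shows "continuous_on W (\<lambda>q. Blinfun (FD F q))"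
proof (rule continuous_on_blinfun_componentwise)
  fix i :: 'a
  have "continuous_on W (\<lambda>q. FD F q i)"
    using smooth_on_FD[OF assms] smooth_on_continuous_on by blast
  then show "continuous_on W (\<lambda>q. blinfun_apply (Blinfun (FD F q)) i)"
    by (rule continuous_on_eq)
       (metis assms bounded_linear_Blinfun_apply has_derivative_bounded_linear smooth_on_has_derivative)
qed

text \<open>The C^1 theorem provides G whose derivative at y is the inverse of
  \<open>FD F (G y)\<close>. If G is C^k, so is \<open>FD F (G y)\<close> in each direction, hence
  so is the inverse by \<open>Ck_on_inverse_family\<close>, and G gains one order.\<close>

lemma smooth_inverse_function_same:
  fixes F :: "'a::euclidean_space \<Rightarrow> 'a"
  assumes "open W" "smooth_on F W" "p \<in> W" "FD F p = id"
  obtains U V G where "open U" "U \<subseteq> W" "p \<in> U" "open V" "F p \<in> V"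
    "homeomorphism U V F G" "smooth_on G V"
proof -
  define F' where "F' q = Blinfun (FD F q)" for q
  have F': "blinfun_apply (F' q) = FD F q" if "q \<in> W" for q
    unfolding F'_def using assms(2) that
    by (metis bounded_linear_Blinfun_apply has_derivative_bounded_linear smooth_on_has_derivative)
  have der: "(F has_derivative blinfun_apply (F' q)) (at q)" if "q \<in> W" for q
    using F'[OF that] smooth_on_has_derivative[OF assms(2) that] by simp
  have contF: "continuous_on W F'"
    unfolding F'_def by (rule continuous_on_Blinfun_FD[OF assms(2)])
  have "id_blinfun o\<^sub>L F' p = id_blinfun"
    using F'[OF assms(3)] assms(4) by (intro blinfun_eqI) simp
  from inverse_function_theorem[OF assms(1) der contF assms(3) this]
  obtain U V G G' where UV: "open U" "U \<subseteq> W" "p \<in> U" "open V" "F p \<in> V" "homeomorphism U V F G"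
    and G': "\<And>y. y \<in> V \<Longrightarrow> (G has_derivative (G' y)) (at y)"
    "\<And>y. y \<in> V \<Longrightarrow> G' y = inv (blinfun_apply (F'(G y)))"
    "\<And>y. y \<in> V \<Longrightarrow> bij (blinfun_apply (F'(G y)))" by metis
  have GU: "G y \<in> U" if "y \<in> V" for y
    using UV(6) that by (auto simp: homeomorphism_def)
  then have GW: "G y \<in> W" if "y \<in> V" for y
    using UV(2) that by blast
  have A: "blinfun_apply (F' (G y)) = FD F (G y)" if "y \<in> V" for y
    using F' GW that by blast
  have "Ck_on k G V" for k
  proof (induction k)
    case 0
    show ?case using UV(6) by (simp add: homeomorphism_def)
  next
    case (Suc k)
    have Ck: "Ck_on k (\<lambda>y. FD F (G y) v) V" for v
      using smooth_on_FD[OF assms(2), of v] GW Suc.IH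
      by (intro Ck_on_compose[OF UV(4), of k "\<lambda>q. FD F q v" W]) auto
    have lin: "linear (FD F (G y))" if "y \<in> V" for y
      using smooth_on_differentiable[OF assms(2) GW[OF that]] by (rule linear_FD)
    have AB: "FD F (G y) (G' y v) = v" "G' y (FD F (G y) v) = v" if "y \<in> V" for y v
      using G'(2,3)[OF that] A[OF that] by (simp_all add: bij_is_surj surj_f_inv_f bij_is_inj)
    have "Ck_on k (\<lambda>y. G' y v) V" for v
      by (rule Ck_on_inverse_family[OF UV(4) lin AB Ck])
    then have "Ck_on k (\<lambda>y. FD G y v) V" for v
      by (rule Ck_on_cong[OF UV(4), rotated]) (simp add: FD_eqI[OF G'(1)])
    then show ?case using G'(1) by (auto simp: differentiable_def)
  qed
  then show ?thesis using that UV by blast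
qed

text \<open>Composing with a linear left inverse L of \<open>FD F p\<close> reduces to the case of
  derivative \<open>id\<close>. Equal dimensions make L a two-sided inverse, so the target
  neighbourhood can be taken as the preimage of V under L.\<close>

theorem smooth_inverse_function:
  fixes F :: "'a::euclidean_space \<Rightarrow> 'b::euclidean_space"
  assumes "open W" "smooth_on F W" "p \<in> W" "inj (FD F p)" "DIM('a) = DIM('b)"
  obtains U V G where "open U" "U \<subseteq> W" "p \<in> U" "open V" "F p \<in> V"
    "homeomorphism U V F G" "smooth_on G V"
proof -
  have lin: "linear (FD F p)"
    using assms(2,3) smooth_on_differentiable linear_FD by blast
  obtain L where L: "linear L" "\<And>x. L (FD F p x) = x"
    using linear_injective_left_inverse[OF lin assms(4)] by (auto simp: fun_eq_iff)
  have surj: "surj (FD F p)"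
    using linear_injective_imp_surjective[OF lin assms(4)] assms(5) by simp
  then have L2: "FD F p (L y) = y" for y
    by (metis L(2) surjD)
  have der: "((\<lambda>q. L (F q)) has_derivative (\<lambda>v. L (FD F p v))) (at p)"
    using L(1) smooth_on_has_derivative[OF assms(2,3)]
    by (intro bounded_linear.has_derivative[of L]) (auto simp: linear_linear)
  have "FD (\<lambda>q. L (F q)) p = id"
    using FD_eqI[OF der] by (simp add: L(2) fun_eq_iff)
  moreover have "smooth_on (\<lambda>q. L (F q)) W"
    using Ck_on_linear_compose[OF assms(1) L(1)] assms(2) by blast
  ultimately obtain U V G where UV: "open U" "U \<subseteq> W" "p \<in> U" "open V" "L (F p) \<in> V"
    and hom: "homeomorphism U V (\<lambda>q. L (F q)) G" and G: "smooth_on G V"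
    using smooth_inverse_function_same[OF assms(1) _ assms(3)] by blast
  have oV: "open (L -` V)"
    using L(1) UV(4) by (simp add: continuous_open_vimage linear_continuous_at linear_linear)
  show ?thesis
  proof (rule that[OF UV(1-3) oV])
    show "F p \<in> L -` V" using UV(5) by simp
    show "homeomorphism U (L -` V) F (\<lambda>y. G (L y))"
    proof (rule homeomorphismI)
      show "continuous_on U F"
        using smooth_on_continuous_on[OF assms(2)] UV(2) continuous_on_subset by blast
      show "continuous_on (L -` V) (\<lambda>y. G (L y))"
      proof (rule continuous_on_compose2[of V G])
        show "continuous_on V G" using hom by (simp add: homeomorphism_def)
        show "continuous_on (L -` V) L"
          using L(1) by (simp add: linear_continuous_on linear_linear)
      qed auto
      show "F ` U \<subseteq> L -` V" using hom by (auto simp: homeomorphism_def)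
      show "(\<lambda>y. G (L y)) ` (L -` V) \<subseteq> U" using hom by (auto simp: homeomorphism_def)
      show "G (L (F x)) = x" if "x \<in> U" for x
        using hom that by (auto simp: homeomorphism_def)
      show "F (G (L y)) = y" if "y \<in> L -` V" for y
      proof -
        have "L (F (G (L y))) = L y"
          using hom that by (auto simp: homeomorphism_def)
        then show ?thesis by (metis L2)
      qed
    qed
    show "smooth_on (\<lambda>y. G (L y)) (L -` V)"
      using G Ck_on_compose[OF oV, of _ G V L] Ck_on_linear[OF L(1), of _ "L -` V"] by blast
  qed
qed

section \<open>Second derivatives\<close>

lemma has_real_derivative_along_line:
  fixes F :: "'a::euclidean_space \<Rightarrow> real"
  assumes "smooth_on F W" "a + t *\<^sub>R v \<in> W"
  shows "((\<lambda>t. F (a + t *\<^sub>R v)) has_real_derivative FD F (a + t *\<^sub>R v) v) (at t)"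
proof -
  have "((\<lambda>t. a + t *\<^sub>R v) has_derivative (\<lambda>h. h *\<^sub>R v)) (at t)"
    by (auto intro!: derivative_eq_intros)
  from has_derivative_compose[OF this smooth_on_has_derivative[OF assms]]
  have "((\<lambda>t. F (a + t *\<^sub>R v)) has_derivative (\<lambda>h. FD F (a + t *\<^sub>R v) (h *\<^sub>R v))) (at t)" .
  moreover have "linear (FD F (a + t *\<^sub>R v))"
    using smooth_on_differentiable[OF assms] by (rule linear_FD)
  ultimately show ?thesis
    by (simp add: has_field_derivative_def linear_scale mult_commute_abs)
qed

text \<open>The mean value theorem is applied to the v-difference along u, and then along v. The
  second difference is symmetric in u and v while the right-hand side differentiates along u first;
  reading it in both orders yields the symmetry of second derivatives.\<close>

lemma second_difference_mean_value:
  fixes F :: "'a::euclidean_space \<Rightarrow> real"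
  assumes "smooth_on F (ball p e)" "0 < h" "h * (norm u + norm v) < e"
  obtains \<xi> where "dist \<xi> p \<le> h * (norm u + norm v)"
    "F (p + h *\<^sub>R u + h *\<^sub>R v) - F (p + h *\<^sub>R u) - F (p + h *\<^sub>R v) + F p =
      h\<^sup>2 * FD (\<lambda>q. FD F q u) \<xi> v"
proof -
  have le: "norm (s *\<^sub>R u + t *\<^sub>R v) \<le> h * (norm u + norm v)"
    if "0 \<le> s" "s \<le> h" "0 \<le> t" "t \<le> h" for s t
  proof -
    have "norm (s *\<^sub>R u + t *\<^sub>R v) \<le> s * norm u + t * norm v"
      using norm_triangle_ineq[of "s *\<^sub>R u" "t *\<^sub>R v"] that by simp
    also have "\<dots> \<le> h * norm u + h * norm v"
      using that by (intro add_mono mult_right_mono) auto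
    finally show ?thesis by (simp add: algebra_simps)
  qed
  have dist: "dist (p + s *\<^sub>R u + t *\<^sub>R v) p \<le> h * (norm u + norm v)"
    if "0 \<le> s" "s \<le> h" "0 \<le> t" "t \<le> h" for s t
    using le[OF that] by (simp add: dist_norm add.assoc)
  have inb: "p + s *\<^sub>R u + t *\<^sub>R v \<in> ball p e"
    if "0 \<le> s" "s \<le> h" "0 \<le> t" "t \<le> h" for s t
    using dist[OF that] assms(3) by (simp add: dist_commute)
  define k where "k s = F (p + h *\<^sub>R v + s *\<^sub>R u) - F (p + s *\<^sub>R u)" for s
  have "\<exists>s. 0 < s \<and> s < h \<and>
      k h - k 0 = (h - 0) * (FD F (p + h *\<^sub>R v + s *\<^sub>R u) u - FD F (p + s *\<^sub>R u) u)"
  proof (rule MVT2[OF assms(2)])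
    fix s assume s: "0 \<le> s" "s \<le> h"
    show "(k has_real_derivative FD F (p + h *\<^sub>R v + s *\<^sub>R u) u - FD F (p + s *\<^sub>R u) u) (at s)"
      unfolding k_def
      by (intro DERIV_diff has_real_derivative_along_line[OF assms(1)])
         (use inb[of s h] inb[of s 0] s assms(2) in \<open>simp_all add: algebra_simps\<close>)
  qed
  then obtain s where s: "0 < s" "s < h"
    "k h - k 0 = h * (FD F (p + h *\<^sub>R v + s *\<^sub>R u) u - FD F (p + s *\<^sub>R u) u)" by auto
  have "\<exists>t. 0 < t \<and> t < h \<and>
      FD F (p + s *\<^sub>R u + h *\<^sub>R v) u - FD F (p + s *\<^sub>R u + 0 *\<^sub>R v) u =
      (h - 0) * FD (\<lambda>q. FD F q u) (p + s *\<^sub>R u + t *\<^sub>R v) v"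
    by (rule MVT2[OF assms(2)], rule has_real_derivative_along_line[OF smooth_on_FD[OF assms(1)]])
       (use inb s in auto)
  then obtain t where t: "0 < t" "t < h"
    "FD F (p + s *\<^sub>R u + h *\<^sub>R v) u - FD F (p + s *\<^sub>R u) u =
      h * FD (\<lambda>q. FD F q u) (p + s *\<^sub>R u + t *\<^sub>R v) v" by auto
  show ?thesis
  proof
    show "dist (p + s *\<^sub>R u + t *\<^sub>R v) p \<le> h * (norm u + norm v)"
      using dist s t by simp
    have "k h - k 0 = h * (h * FD (\<lambda>q. FD F q u) (p + s *\<^sub>R u + t *\<^sub>R v) v)"
      using s(3) t(3) by (simp add: algebra_simps)
    then show "F (p + h *\<^sub>R u + h *\<^sub>R v) - F (p + h *\<^sub>R u) - F (p + h *\<^sub>R v) + F p =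
        h\<^sup>2 * FD (\<lambda>q. FD F q u) (p + s *\<^sub>R u + t *\<^sub>R v) v"
      by (simp add: k_def algebra_simps power2_eq_square)
  qed
qed

lemma second_derivative_symmetric_real:
  fixes F :: "'a::euclidean_space \<Rightarrow> real"
  assumes "open W" "smooth_on F W" "p \<in> W"
  shows "FD (\<lambda>q. FD F q u) p v = FD (\<lambda>q. FD F q v) p u"
proof (rule ccontr)
  let ?D = "\<lambda>u v q. FD (\<lambda>q. FD F q u) q v"
  define \<eta> where "\<eta> = \<bar>?D u v p - ?D v u p\<bar> / 2"
  assume "?D u v p \<noteq> ?D v u p"
  then have \<eta>: "\<eta> > 0" by (simp add: \<eta>_def)
  have cont: "isCont (?D u v) p" for u v
    using assms smooth_on_continuous_on[OF smooth_on_FD[OF smooth_on_FD[OF assms(2)]]]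
    by (simp add: continuous_on_eq_continuous_at)
  obtain d1 where d1: "d1 > 0" "\<And>q. dist q p < d1 \<Longrightarrow> dist (?D u v q) (?D u v p) < \<eta>"
    using cont[of u v] \<eta> unfolding continuous_at_eps_delta by blast
  obtain d2 where d2: "d2 > 0" "\<And>q. dist q p < d2 \<Longrightarrow> dist (?D v u q) (?D v u p) < \<eta>"
    using cont[of v u] \<eta> unfolding continuous_at_eps_delta by blast
  obtain e where e: "e > 0" "ball p e \<subseteq> W"
    using assms open_contains_ball by blast
  have sm: "smooth_on F (ball p e)"
    using assms(2) e(2) Ck_on_subset by blast
  define d where "d = min e (min d1 d2)"
  \<comment> \<open>The summand 1 keeps N positive even if u and v both vanish;
    \<open>h = d / (2 * N)\<close> then puts both mean value points within d of p.\<close>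
  define N where "N = norm u + norm v + 1"
  define h where "h = d / (2 * N)"
  have n: "N > 0" by (simp add: N_def add_nonneg_pos)
  have d: "d > 0" using e d1 d2 by (simp add: d_def)
  have h: "h > 0" "h * (norm u + norm v) < d"
  proof -
    show "h > 0" using d n by (simp add: h_def)
    then have "h * (norm u + norm v) < h * (2 * N)"
      by (intro mult_strict_left_mono) (auto simp: N_def add_strict_increasing2 add_nonneg_pos)
    also have "\<dots> = d" using n by (simp add: h_def)
    finally show "h * (norm u + norm v) < d" .
  qed
  obtain \<xi> where \<xi>: "dist \<xi> p \<le> h * (norm u + norm v)"
    "F (p + h *\<^sub>R u + h *\<^sub>R v) - F (p + h *\<^sub>R u) - F (p + h *\<^sub>R v) + F p = h\<^sup>2 * ?D u v \<xi>"
    by (rule second_difference_mean_value[OF sm h(1), of u v]) (use h d_def in auto)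
  obtain \<xi>' where \<xi>': "dist \<xi>' p \<le> h * (norm v + norm u)"
    "F (p + h *\<^sub>R v + h *\<^sub>R u) - F (p + h *\<^sub>R v) - F (p + h *\<^sub>R u) + F p = h\<^sup>2 * ?D v u \<xi>'"
    by (rule second_difference_mean_value[OF sm h(1), of v u]) (use h d_def in \<open>auto simp: add.commute\<close>)
  have "h\<^sup>2 * ?D u v \<xi> = h\<^sup>2 * ?D v u \<xi>'"
    using \<xi>(2) \<xi>'(2) by (simp add: algebra_simps)
  then have "?D u v \<xi> = ?D v u \<xi>'" using h by simp
  moreover have "dist (?D u v \<xi>) (?D u v p) < \<eta>"
    using d1(2)[of \<xi>] \<xi>(1) h(2) by (simp add: d_def)
  moreover have "dist (?D v u \<xi>') (?D v u p) < \<eta>"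
    using d2(2)[of \<xi>'] \<xi>'(1) h(2) by (simp add: d_def add.commute)
  ultimately have "dist (?D u v p) (?D v u p) < \<eta> + \<eta>"
    using dist_triangle_half_l[of "?D u v p" "?D u v \<xi>" "\<eta> + \<eta>" "?D v u p"] by (simp add: dist_commute)
  then show False
    by (simp add: \<eta>_def dist_real_def)
qed

lemma FD_inner:
  assumes "F differentiable (at q)"
  shows "FD (\<lambda>q. F q \<bullet> b) q v = FD F q v \<bullet> b"
  by (rule FD_eqI[THEN fun_cong, OF has_derivative_inner_left[OF has_derivative_FD[OF assms]]])

lemma second_derivative_symmetric:
  fixes F :: "'a::euclidean_space \<Rightarrow> 'b::euclidean_space"
  assumes "open W" "smooth_on F W" "p \<in> W"
  shows "FD (\<lambda>q. FD F q u) p v = FD (\<lambda>q. FD F q v) p u"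
proof (rule euclidean_eqI)
  fix b :: 'b
  have sm: "smooth_on (\<lambda>q. F q \<bullet> b) W"
    using assms(2) by (auto intro!: Ck_on_inner Ck_on_const assms(1))
  have *: "FD (\<lambda>q. FD F q u) p v \<bullet> b = FD (\<lambda>q. FD (\<lambda>q. F q \<bullet> b) q u) p v" for u v
  proof -
    have "FD (\<lambda>q. FD F q u) p v \<bullet> b = FD (\<lambda>q. FD F q u \<bullet> b) p v"
      using smooth_on_differentiable[OF smooth_on_FD[OF assms(2)] assms(3)] by (simp add: FD_inner)
    also have "\<dots> = FD (\<lambda>q. FD (\<lambda>q. F q \<bullet> b) q u) p v"
      by (rule fun_cong[OF FD_cong[OF assms(1,3)]])
         (simp add: FD_inner smooth_on_differentiable[OF assms(2)])
    finally show ?thesis .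
  qed
  show "FD (\<lambda>q. FD F q u) p v \<bullet> b = FD (\<lambda>q. FD F q v) p u \<bullet> b"
    unfolding * by (rule second_derivative_symmetric_real[OF assms(1) sm assms(3)])
qed

section \<open>Taylor's formula with a smoothly varying quadratic form\<close>

text \<open>Differentiation under the integral sign turns the weight \<open>c t\<close> into
  \<open>c t * t\<close> and \<psi> into a directional derivative. With an arbitrary weight the
  result is an integral of the same kind, as the induction for smoothness requires.\<close>

lemma has_derivative_radial_integral:
  fixes \<psi> :: "'a::euclidean_space \<Rightarrow> real" and c :: "real \<Rightarrow> real"
  assumes \<psi>: "smooth_on \<psi> (ball 0 R)" and c: "continuous_on {0..1} c" and u: "u \<in> ball 0 R"
  shows "((\<lambda>u. integral {0..1} (\<lambda>t. c t * \<psi> (t *\<^sub>R u))) has_derivative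
    (\<lambda>v. integral {0..1} (\<lambda>t. (c t * t) * FD \<psi> (t *\<^sub>R u) v))) (at u)"
proof -
  have in_ball: "t *\<^sub>R x \<in> ball 0 R" if "x \<in> ball 0 R" "t \<in> {0..1}" for t and x :: 'a
    using that mult_left_le_one_le[of "norm x" t] by auto
  define fx where "fx x t = Blinfun (\<lambda>v. (c t * t) * FD \<psi> (t *\<^sub>R x) v)" for x t
  have bl: "bounded_linear (\<lambda>v. (c t * t) * FD \<psi> (t *\<^sub>R x) v)" if "x \<in> ball 0 R" "t \<in> {0..1}" for x t
    using smooth_on_has_derivative[OF \<psi> in_ball[OF that]]
    by (intro bounded_linear_const_mult has_derivative_bounded_linear)
  have fx: "blinfun_apply (fx x t) v = (c t * t) * FD \<psi> (t *\<^sub>R x) v"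
    if "x \<in> ball 0 R" "t \<in> {0..1}" for x t v
    unfolding fx_def using bounded_linear_Blinfun_apply[OF bl[OF that]] by simp
  have cont_comp: "continuous_on (ball 0 R \<times> {0..1}) (\<lambda>z. c (snd z) * G (snd z *\<^sub>R fst z))"
    if "continuous_on (ball 0 R) G" "continuous_on {0..1} c" for G :: "'a \<Rightarrow> real" and c :: "real \<Rightarrow> real"
    by (intro continuous_intros continuous_on_compose2[OF that(1)] continuous_on_compose2[OF that(2)])
       (use in_ball in auto)
  have "((\<lambda>u. integral (cbox 0 1) (\<lambda>t. c t * \<psi> (t *\<^sub>R u))) has_derivative
      integral (cbox 0 1) (fx u)) (at u within ball 0 R)"
  proof (rule leibniz_rule)
    fix x :: 'a and t :: real assume x: "x \<in> ball 0 R" and t: "t \<in> cbox 0 1"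
    have 1: "((\<lambda>x. t *\<^sub>R x) has_derivative (\<lambda>v. t *\<^sub>R v)) (at x)"
      by (intro has_derivative_scaleR_right has_derivative_ident)
    have "linear (FD \<psi> (t *\<^sub>R x))"
      using smooth_on_differentiable[OF \<psi> in_ball[OF x]] t by (auto intro: linear_FD)
    moreover have "((\<lambda>x. c t * \<psi> (t *\<^sub>R x)) has_derivative (\<lambda>v. c t * FD \<psi> (t *\<^sub>R x) (t *\<^sub>R v))) (at x)"
      using t by (intro has_derivative_mult_right has_derivative_compose[OF 1]
          smooth_on_has_derivative[OF \<psi>] in_ball x) auto
    moreover have "blinfun_apply (fx x t) = (\<lambda>v. (c t * t) * FD \<psi> (t *\<^sub>R x) v)"
      using fx[OF x] t by auto
    ultimately show "((\<lambda>x. c t * \<psi> (t *\<^sub>R x)) has_derivative blinfun_apply (fx x t)) (at x within ball 0 R)"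
      by (simp add: linear_scale mult.assoc has_derivative_at_withinI)
  next
    fix x :: 'a assume x: "x \<in> ball 0 R"
    have "continuous_on {0..1} (\<lambda>t. c t * \<psi> (t *\<^sub>R x))"
      by (intro continuous_intros c continuous_on_compose2[OF smooth_on_continuous_on[OF \<psi>]])
         (use in_ball x in auto)
    then show "(\<lambda>t. c t * \<psi> (t *\<^sub>R x)) integrable_on cbox 0 1"
      by (intro integrable_continuous) simp
  next
    show "continuous_on (ball 0 R \<times> cbox 0 1) (\<lambda>(x, t). fx x t)"
      unfolding case_prod_unfold
    proof (rule continuous_on_blinfun_componentwise)
      fix i :: 'a
      have "continuous_on (ball 0 R \<times> {0..1})
          (\<lambda>z. (c (snd z) * snd z) * FD \<psi> (snd z *\<^sub>R fst z) i)"
        using smooth_on_continuous_on[OF smooth_on_FD[OF \<psi>]]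
        by (rule cont_comp) (intro continuous_intros c)
      then show "continuous_on (ball 0 R \<times> cbox 0 1) (\<lambda>z. blinfun_apply (fx (fst z) (snd z)) i)"
        by (rule continuous_on_cong[THEN iffD1, rotated 2]) (auto simp: fx)
    qed
  qed (use u in auto)
  moreover have "blinfun_apply (integral (cbox 0 1) (fx u)) v = integral {0..1} (\<lambda>t. (c t * t) * FD \<psi> (t *\<^sub>R u) v)" for v
  proof -
    have "continuous_on {0..1} (fx u)"
    proof (rule continuous_on_blinfun_componentwise)
      fix i :: 'a
      have "continuous_on {0..1} (\<lambda>t. (c t * t) * FD \<psi> (t *\<^sub>R u) i)"
        by (intro continuous_intros c continuous_on_compose2[OF smooth_on_continuous_on[OF smooth_on_FD[OF \<psi>]]])
           (use in_ball u in auto)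
      then show "continuous_on {0..1} (\<lambda>t. blinfun_apply (fx u t) i)"
        by (rule continuous_on_cong[THEN iffD1, rotated 2]) (use u in \<open>auto simp: fx\<close>)
    qed
    then have "fx u integrable_on cbox 0 1"
      by (intro integrable_continuous) simp
    then have "blinfun_apply (integral (cbox 0 1) (fx u)) v = integral (cbox 0 1) (\<lambda>t. blinfun_apply (fx u t) v)"
      by (rule blinfun_apply_integral)
    also have "\<dots> = integral {0..1} (\<lambda>t. (c t * t) * FD \<psi> (t *\<^sub>R u) v)"
      by (simp, rule Henstock_Kurzweil_Integration.integral_cong) (use u fx in auto)
    finally show ?thesis .
  qed
  then have "blinfun_apply (integral (cbox 0 1) (fx u)) =
      (\<lambda>v. integral {0..1} (\<lambda>t. (c t * t) * FD \<psi> (t *\<^sub>R u) v))"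
    by (rule ext)
  ultimately show ?thesis
    using at_within_open[OF u open_ball] by (simp only: cbox_interval)
qed

lemma smooth_on_radial_integral:
  fixes \<psi> :: "'a::euclidean_space \<Rightarrow> real" and c :: "real \<Rightarrow> real"
  assumes "smooth_on \<psi> (ball 0 R)" "continuous_on {0..1} c"
  shows "smooth_on (\<lambda>u. integral {0..1} (\<lambda>t. c t * \<psi> (t *\<^sub>R u))) (ball 0 R)"
proof
  fix k
  show "Ck_on k (\<lambda>u. integral {0..1} (\<lambda>t. c t * \<psi> (t *\<^sub>R u))) (ball 0 R)"
    using assms
  proof (induction k arbitrary: c \<psi>)
    case 0
    then show ?case
      using has_derivative_continuous[OF has_derivative_radial_integral[OF 0]]
      by (auto intro: continuous_at_imp_continuous_on)
  next
    case (Suc k)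
    note d = has_derivative_radial_integral[OF Suc.prems]
    have "Ck_on k (\<lambda>u. integral {0..1} (\<lambda>t. (c t * t) * FD \<psi> (t *\<^sub>R u) v)) (ball 0 R)" for v
      by (rule Suc.IH[OF smooth_on_FD[OF Suc.prems(1)]]) (intro continuous_intros Suc.prems)
    then have "Ck_on k (\<lambda>u. FD (\<lambda>u. integral {0..1} (\<lambda>t. c t * \<psi> (t *\<^sub>R u))) u v) (ball 0 R)" for v
      by (rule Ck_on_cong[OF open_ball, rotated]) (simp add: FD_eqI[OF d])
    then show ?case
      unfolding Ck_on.simps using d differentiable_def by blast
  qed
qed

text \<open>Taylor's formula with integral remainder along the ray from 0 to u: the terms of order 0
  and 1 vanish, and S is the integral of 1 - t times the Hessian at t u. At u = 0 the weight
  integrates to 1/2.\<close>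

lemma second_order_Hadamard:
  fixes G :: "real^'k \<Rightarrow> real"
  assumes "0 < R" "smooth_on G (ball 0 R)" "G 0 = 0" "\<And>v. FD G 0 v = 0"
  obtains S :: "real^'k \<Rightarrow> real^'k^'k" where "smooth_on S (ball 0 R)"
    "\<And>u. u \<in> ball 0 R \<Longrightarrow> transpose (S u) = S u"
    "\<And>u. u \<in> ball 0 R \<Longrightarrow> G u = u \<bullet> (S u *v u)"
    "S 0 = (1/2) *\<^sub>R (\<chi> i j. FD (\<lambda>q. FD G q (axis i 1)) 0 (axis j 1))"
proof
  define h where "h i j q = FD (\<lambda>q. FD G q (axis i 1)) q (axis j 1)" for i j :: 'k and q
  define S :: "real^'k \<Rightarrow> real^'k^'k"
    where "S u = (\<chi> i j. integral {0..1} (\<lambda>t. (1 - t) * h i j (t *\<^sub>R u)))" for u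
  have smh: "smooth_on (h i j) (ball 0 R)" for i j
    unfolding h_def by (intro smooth_on_FD assms(2))
  have c: "continuous_on {0..1} (\<lambda>t::real. 1 - t)" by (intro continuous_intros)
  have in_ball: "t *\<^sub>R x \<in> ball 0 R" if "x \<in> ball 0 R" "t \<in> {0..1}" for t and x :: "real^'k"
    using that mult_left_le_one_le[of "norm x" t] by auto
  show "smooth_on S (ball 0 R)"
  proof
    fix k
    show "Ck_on k S (ball 0 R)"
      using smooth_on_radial_integral[OF smh c]
      by (intro Ck_on_vec_lambda[OF open_ball]) (simp add: S_def)
  qed
  show "transpose (S u) = S u" if "u \<in> ball 0 R" for u
  proof -
    have "h i j (t *\<^sub>R u) = h j i (t *\<^sub>R u)" if "t \<in> {0..1}" for i j t
      unfolding h_def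
      by (rule second_derivative_symmetric[OF open_ball assms(2) in_ball[OF \<open>u \<in> ball 0 R\<close> that]])
    then show ?thesis
      unfolding S_def transpose_def vec_eq_iff
      by (auto intro!: Henstock_Kurzweil_Integration.integral_cong)
  qed
  show "S 0 = (1/2) *\<^sub>R (\<chi> i j. FD (\<lambda>q. FD G q (axis i 1)) 0 (axis j 1))"
  proof -
    have "((\<lambda>t. 1 - t) has_integral (1 - 1^2/2) - (0 - 0^2/2)) {0..1::real}"
      by (rule fundamental_theorem_of_calculus)
         (auto intro!: derivative_eq_intros simp: has_real_derivative_iff_has_vector_derivative[symmetric])
    from has_integral_mult_left[OF this]
    have "integral {0..1} (\<lambda>t. (1 - t) * a) = 1/2 * a" for a :: real
      by (intro integral_unique) simp
    then show ?thesis
      by (simp only: S_def vec_eq_iff vec_lambda_beta scaleR_zero_right vector_scaleR_component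
          real_scaleR_def h_def) simp
  qed
  show "G u = u \<bullet> (S u *v u)" if u: "u \<in> ball 0 R" for u
  proof -
    have lin: "linear (FD G q)" if "q \<in> ball 0 R" for q
      using smooth_on_differentiable[OF assms(2) that] by (rule linear_FD)
    have ax: "u = (\<Sum>i\<in>UNIV. (u $ i) *\<^sub>R axis i 1)"
      using basis_expansion[of u] by (simp add: scalar_mult_eq_scaleR)
    have exp1: "L u = (\<Sum>i\<in>UNIV. u $ i * L (axis i 1))" if "linear L" for L :: "real^'k \<Rightarrow> real"
      by (subst ax) (simp add: linear_sum[OF that] linear_scale[OF that])
    have second: "FD (\<lambda>q. FD G q u) q u = (\<Sum>i\<in>UNIV. \<Sum>j\<in>UNIV. u $ i * u $ j * h i j q)"
      if q: "q \<in> ball 0 R" for q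
    proof -
      have "((\<lambda>q. \<Sum>i\<in>UNIV. u $ i * FD G q (axis i 1)) has_derivative
          (\<lambda>v. \<Sum>i\<in>UNIV. u $ i * FD (\<lambda>q. FD G q (axis i 1)) q v)) (at q)"
        by (intro has_derivative_sum has_derivative_mult_right
            smooth_on_has_derivative[OF smooth_on_FD[OF assms(2)] q])
      then have "((\<lambda>q. FD G q u) has_derivative
          (\<lambda>v. \<Sum>i\<in>UNIV. u $ i * FD (\<lambda>q. FD G q (axis i 1)) q v)) (at q)"
        by (rule has_derivative_transform_within_open[OF _ open_ball q]) (rule exp1[OF lin, symmetric])
      from fun_cong[OF FD_eqI[OF this], of u]
      have "FD (\<lambda>q. FD G q u) q u = (\<Sum>i\<in>UNIV. u $ i * FD (\<lambda>q. FD G q (axis i 1)) q u)" .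
      also have "\<dots> = (\<Sum>i\<in>UNIV. u $ i * (\<Sum>j\<in>UNIV. u $ j * h i j q))"
        unfolding h_def
        using exp1[OF linear_FD[OF smooth_on_differentiable[OF smooth_on_FD[OF assms(2)] q]]] by simp
      finally show ?thesis by (simp add: sum_distrib_left mult.assoc)
    qed
    have d1: "((\<lambda>t. G (t *\<^sub>R u)) has_real_derivative FD G (t *\<^sub>R u) u) (at t)" if "t \<in> {0..1}" for t
      using has_real_derivative_along_line[OF assms(2), of 0 t u] in_ball[OF u that] by simp
    have d2: "((\<lambda>t. FD G (t *\<^sub>R u) u) has_real_derivative FD (\<lambda>q. FD G q u) (t *\<^sub>R u) u) (at t)"
      if "t \<in> {0..1}" for t
      using has_real_derivative_along_line[OF smooth_on_FD[OF assms(2)], of 0 t u u] in_ball[OF u that] by simp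
    \<comment> \<open>The antiderivative is
      \<open>(1 - t) * FD G (t *\<^sub>R u) u + G (t *\<^sub>R u)\<close>: the first derivatives
      arising from its two summands cancel.\<close>
    have "((\<lambda>t. (1 - t) * FD (\<lambda>q. FD G q u) (t *\<^sub>R u) u) has_integral
        ((1 - 1) * FD G (1 *\<^sub>R u) u + G (1 *\<^sub>R u)) - ((1 - 0) * FD G (0 *\<^sub>R u) u + G (0 *\<^sub>R u))) {0..1::real}"
    proof (rule fundamental_theorem_of_calculus)
      fix t :: real assume t: "t \<in> {0..1}"
      have "((\<lambda>t. (1 - t) * FD G (t *\<^sub>R u) u + G (t *\<^sub>R u)) has_real_derivative
          (1 - t) * FD (\<lambda>q. FD G q u) (t *\<^sub>R u) u) (at t within {0..1})"
        by (rule has_field_derivative_at_within)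
           (auto intro!: derivative_eq_intros d1[OF t] d2[OF t])
      then show "((\<lambda>t. (1 - t) * FD G (t *\<^sub>R u) u + G (t *\<^sub>R u)) has_vector_derivative
          (1 - t) * FD (\<lambda>q. FD G q u) (t *\<^sub>R u) u) (at t within {0..1})"
        by (simp add: has_real_derivative_iff_has_vector_derivative)
    qed simp
    then have "G u = integral {0..1} (\<lambda>t. (1 - t) * FD (\<lambda>q. FD G q u) (t *\<^sub>R u) u)"
      using assms(3,4) by (simp add: integral_unique)
    also have "\<dots> = integral {0..1} (\<lambda>t. \<Sum>i\<in>UNIV. \<Sum>j\<in>UNIV. (u $ i * u $ j) * ((1 - t) * h i j (t *\<^sub>R u)))"
      by (intro Henstock_Kurzweil_Integration.integral_cong)
         (simp add: second[OF in_ball[OF u]] sum_distrib_left mult_ac)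
    also have "\<dots> = (\<Sum>i\<in>UNIV. \<Sum>j\<in>UNIV. (u $ i * u $ j) * integral {0..1} (\<lambda>t. (1 - t) * h i j (t *\<^sub>R u)))"
    proof -
      have "(\<lambda>t. (u $ i * u $ j) * ((1 - t) * h i j (t *\<^sub>R u))) integrable_on {0..1}" for i j
        by (intro integrable_continuous_real continuous_intros
            continuous_on_compose2[OF smooth_on_continuous_on[OF smh]]) (use in_ball u in auto)
      then show ?thesis
        by (simp add: integral_sum integrable_sum)
    qed
    also have "\<dots> = u \<bullet> (S u *v u)"
      by (simp add: S_def inner_vec_def matrix_vector_mult_def sum_distrib_left mult_ac)
    finally show ?thesis .
  qed
qed

section \<open>The Morse lemma\<close>

lemma bounded_bilinear_matrix_mult:
  "bounded_bilinear ((**) :: real^'m::finite^'n::finite \<Rightarrow> real^'p::finite^'m \<Rightarrow> real^'p^'n)"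
  unfolding bilinear_conv_bounded_bilinear[symmetric] bilinear_def
  by (auto intro!: linearI simp: vec_eq_iff matrix_matrix_mult_def algebra_simps
      sum.distrib sum_distrib_left)

lemma bounded_bilinear_matrix_vector_mult:
  "bounded_bilinear ((*v) :: real^'m::finite^'n::finite \<Rightarrow> real^'m \<Rightarrow> real^'n)"
  unfolding bilinear_conv_bounded_bilinear[symmetric] bilinear_def
  by (auto intro!: linearI simp: matrix_vector_right_distrib matrix_vector_mult_add_rdistrib
      matrix_vector_mult_scaleR scaleR_matrix_vector_assoc)

text \<open>Squaring has derivative X + X at the identity, so it is a local diffeomorphism there.
  The last conclusion, uniqueness of roots inside U, is what later forces a root to be
  self-adjoint.\<close>

lemma smooth_matrix_square_root:
  obtains U V :: "(real^'k^'k) set" and R where "open U" "mat 1 \<in> U" "open V" "mat 1 \<in> V"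
    "smooth_on R V" "R (mat 1) = mat 1" "\<And>X. X \<in> V \<Longrightarrow> R X \<in> U" "\<And>X. X \<in> V \<Longrightarrow> R X ** R X = X"
    "\<And>X. X \<in> U \<Longrightarrow> X ** X \<in> V \<and> R (X ** X) = X"
proof -
  define sq where "sq X = X ** X" for X :: "real^'k^'k"
  have sm: "smooth_on sq UNIV"
    unfolding sq_def
    using Ck_on_bilinear[OF open_UNIV bounded_bilinear_matrix_mult Ck_on_linear[OF linear_id] Ck_on_linear[OF linear_id]]
    unfolding id_def by blast
  have "(sq has_derivative (\<lambda>X. mat 1 ** X + X ** mat 1)) (at (mat 1))"
    unfolding sq_def
    by (intro bounded_bilinear.FDERIV[OF bounded_bilinear_matrix_mult] has_derivative_ident)
  then have "FD sq (mat 1) = (\<lambda>X. X + X)"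
    by (simp add: FD_eqI)
  then have "inj (FD sq (mat 1))"
    by (simp add: inj_def scaleR_2[symmetric])
  then obtain U V R where UV: "open U" "mat 1 \<in> U" "open V" "sq (mat 1) \<in> V"
    "homeomorphism U V sq R" "smooth_on R V"
    using smooth_inverse_function[OF open_UNIV sm, of "mat 1"] by auto
  show ?thesis
  proof (rule that[OF UV(1-3) _ UV(6)])
    show "mat 1 \<in> V" using UV(4) by (simp add: sq_def)
    show *: "X ** X \<in> V \<and> R (X ** X) = X" if "X \<in> U" for X
      using UV(5) that by (auto simp: homeomorphism_def sq_def)
    show "R (mat 1) = mat 1" using *[OF UV(2)] by simp
    show "R X \<in> U" "R X ** R X = X" if "X \<in> V" for X
      using UV(5) that by (auto simp: homeomorphism_def sq_def)
  qed
qed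

text \<open>The form may be indefinite, hence a case split: if every vector of V is isotropic,
  polarisation makes B vanish on V and any basis works; otherwise a non-isotropic v splits off and
  the induction passes to its B-orthogonal complement in V.\<close>

lemma exists_orthogonal_basis_bilinear:
  fixes B :: "'a::euclidean_space \<Rightarrow> 'a \<Rightarrow> real"
  assumes bil: "bilinear B" and sym: "\<And>x y. B x y = B y x" and V: "subspace V"
  obtains E where "E \<subseteq> V" "independent E" "V \<subseteq> span E" "pairwise (\<lambda>x y. B x y = 0) E"
proof -
  note add = bilinear_ladd[OF bil] bilinear_radd[OF bil] bilinear_lmul[OF bil] bilinear_rmul[OF bil]
    bilinear_lsub[OF bil] bilinear_rsub[OF bil]
  have lin: "linear (B x)" for x using bil by (simp add: bilinear_def)
  have "\<exists>E. E \<subseteq> V \<and> independent E \<and> V \<subseteq> span E \<and> pairwise (\<lambda>x y. B x y = 0) E"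
    using V
  proof (induction "dim V" arbitrary: V rule: less_induct)
    case less
    show ?case
    proof (cases "\<forall>v\<in>V. B v v = 0")
      case True
      have "B x y = 0" if "x \<in> V" "y \<in> V" for x y
      proof -
        have "B (x + y) (x + y) = 0" using True that less.prems by (simp add: subspace_add)
        then show ?thesis using True that sym[of y x] by (simp add: add)
      qed
      note zero = this
      obtain E where E: "E \<subseteq> V" "independent E" "V \<subseteq> span E"
        using basis_exists[of V] by metis
      moreover have "pairwise (\<lambda>x y. B x y = 0) E"
        unfolding pairwise_def using E(1) zero by (meson subsetD)
      ultimately show ?thesis by blast
    next
      case False
      then obtain v where v: "v \<in> V" "B v v \<noteq> 0" by blast
      define V' where "V' = {w \<in> V. B v w = 0}"
      have V': "subspace V'"
        using less.prems unfolding V'_def subspace_def by (auto simp: add bilinear_rzero[OF bil])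
      have "V' \<noteq> V" using v by (auto simp: V'_def)
      moreover have "V' \<subseteq> V" by (auto simp: V'_def)
      ultimately have "dim V' < dim V"
        using subspace_dim_equal[OF V' less.prems] by (metis dim_subset le_neq_implies_less order_refl)
      then obtain E where E: "E \<subseteq> V'" "independent E" "V' \<subseteq> span E" "pairwise (\<lambda>x y. B x y = 0) E"
        using less.hyps V' by blast
      have "span E \<subseteq> V'" using E(1) V' by (simp add: span_minimal)
      then have "v \<notin> span E" using v by (auto simp: V'_def)
      moreover have "V \<subseteq> span (insert v E)"
      proof
        fix w assume w: "w \<in> V"
        define w' where "w' = w - (B v w / B v v) *\<^sub>R v"
        have "w' \<in> V'"
          using w v less.prems by (auto simp: w'_def V'_def add subspace_diff subspace_scale)
        then have "w' \<in> span (insert v E)" using E(3) span_mono[of E "insert v E"] by blast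
        moreover have "w = w' + (B v w / B v v) *\<^sub>R v" by (simp add: w'_def)
        ultimately show "w \<in> span (insert v E)"
          by (metis insertI1 span_add span_base span_scale)
      qed
      moreover have "pairwise (\<lambda>x y. B x y = 0) (insert v E)"
        using E(1,4) sym unfolding pairwise_insert V'_def by auto
      ultimately show ?thesis
        using E v by (intro exI[of _ "insert v E"]) (auto simp: independent_insert V'_def)
    qed
  qed
  then show ?thesis using that by blast
qed

text \<open>In an orthogonal basis of a nondegenerate form no vector is isotropic, for it would be
  orthogonal to the whole basis. Dividing by \<open>sqrt \<bar>d j\<bar>\<close> normalises the form
  to signs, and \<Lambda> collects the negative ones.\<close>

lemma diagonalize_quadratic_form:
  fixes S :: "real^'k^'k"
  assumes "transpose S = S" "det S \<noteq> 0"
  obtains P :: "real^'k \<Rightarrow> real^'k" and \<Lambda> :: "'k set" where "linear P" "inj P"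
    "\<And>x. x \<bullet> (S *v x) = - (\<Sum>j\<in>\<Lambda>. (P x $ j)\<^sup>2) + (\<Sum>j\<in>-\<Lambda>. (P x $ j)\<^sup>2)"
proof -
  define B where "B x y = x \<bullet> (S *v y)" for x y
  have bil: "bilinear B"
    unfolding bilinear_def B_def
    by (auto intro!: linearI simp: inner_left_distrib inner_right_distrib matrix_vector_right_distrib
        matrix_vector_mult_scaleR)
  have sym: "B x y = B y x" for x y
    by (metis B_def assms(1) dot_lmul_matrix inner_commute transpose_matrix_vector vector_transpose_matrix)
  have lin: "linear (B x)" for x using bil by (simp add: bilinear_def)
  have linl: "linear (\<lambda>x. B x y)" for y using bil by (simp add: bilinear_def)
  have nondeg: "y = 0" if "\<And>x. B x y = 0" for y
  proof -
    have "S *v y = 0" using that[of "S *v y"] by (simp add: B_def)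
    then show ?thesis
      using assms(2) by (metis invertible_det_nz invertible_def matrix_left_invertible_ker)
  qed
  obtain E where E: "independent E" "UNIV \<subseteq> span E" "pairwise (\<lambda>x y. B x y = 0) E"
    using exists_orthogonal_basis_bilinear[OF bil sym subspace_UNIV] by metis
  have nondegE: "y = 0" if "\<And>x. x \<in> E \<Longrightarrow> B x y = 0" for y
  proof (rule nondeg)
    fix x
    have "x \<in> span E" using E(2) by blast
    then show "B x y = 0"
      by (induction rule: span_induct_alt)
         (use that in \<open>auto simp: linear_0[OF linl] linear_add[OF linl] linear_scale[OF linl]\<close>)
  qed
  have "card E = CARD('k)"
    using E(1,2) by (metis DIM_cart DIM_real basis_card_eq_dim dim_UNIV nat_mult_1_right subset_UNIV)
  moreover have "finite E" using E(1) independent_imp_finite by blast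
  ultimately obtain e :: "'k \<Rightarrow> real^'k" where e: "bij_betw e UNIV E"
    by (metis finite_same_card_bij finite_class.finite_UNIV)
  have eE: "e j \<in> E" for j using e by (auto simp: bij_betw_def)
  have orth: "B (e i) (e j) = 0" if "i \<noteq> j" for i j
    using E(3) eE that e unfolding pairwise_def bij_betw_def inj_on_def by (metis UNIV_I)
  define d where "d j = B (e j) (e j)" for j
  have d: "d j \<noteq> 0" for j
  proof
    assume "d j = 0"
    then have "B x (e j) = 0" if "x \<in> E" for x
      using E(3) eE that unfolding d_def pairwise_def by metis
    then have "e j = 0" by (rule nondegE)
    then show False using E(1) eE[of j] dependent_zero by metis
  qed
  define P :: "real^'k \<Rightarrow> real^'k" where "P x = (\<chi> j. B (e j) x / sqrt \<bar>d j\<bar>)" for x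
  have rep: "x = (\<Sum>j\<in>UNIV. (B (e j) x / d j) *\<^sub>R e j)" for x
  proof -
    have "x - (\<Sum>j\<in>UNIV. (B (e j) x / d j) *\<^sub>R e j) = 0"
    proof (rule nondegE)
      fix y assume "y \<in> E"
      then obtain i where i: "y = e i" using e by (auto simp: bij_betw_def)
      have "B (e i) (\<Sum>j\<in>UNIV. (B (e j) x / d j) *\<^sub>R e j) = (\<Sum>j\<in>UNIV. (B (e j) x / d j) * B (e i) (e j))"
        by (simp add: linear_sum[OF lin] linear_scale[OF lin])
      also have "\<dots> = (\<Sum>j\<in>UNIV. if j = i then B (e i) x else 0)"
        by (rule sum.cong) (use d in \<open>auto simp: orth d_def\<close>)
      finally show "B y (x - (\<Sum>j\<in>UNIV. (B (e j) x / d j) *\<^sub>R e j)) = 0"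
        by (simp add: i linear_diff[OF lin])
    qed
    then show ?thesis by simp
  qed
  show ?thesis
  proof
    show linP: "linear P"
      by (rule linearI) (auto simp: P_def vec_eq_iff linear_add[OF lin] linear_scale[OF lin] add_divide_distrib)
    show "inj P"
      unfolding linear_injective_0[OF linP]
    proof (intro allI impI)
      fix x assume "P x = 0"
      then have "B (e j) x = 0" for j using d by (simp add: P_def vec_eq_iff)
      then show "x = 0" using rep[of x] by simp
    qed
    fix x
    have "x \<bullet> (S *v x) = B x x" by (simp add: B_def)
    also have "\<dots> = (\<Sum>j\<in>UNIV. (B (e j) x / d j) * B x (e j))"
      by (subst (2) rep) (simp add: linear_sum[OF lin] linear_scale[OF lin])
    also have "\<dots> = (\<Sum>j\<in>UNIV. if j \<in> {j. d j < 0} then - (P x $ j)\<^sup>2 else (P x $ j)\<^sup>2)"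
      using d by (intro sum.cong)
         (auto simp: P_def power_divide sym[of x] power2_eq_square abs_if)
    also have "\<dots> = (\<Sum>j\<in>{j. d j < 0}. - (P x $ j)\<^sup>2) + (\<Sum>j\<in>-{j. d j < 0}. (P x $ j)\<^sup>2)"
      by (simp add: sum.If_cases)
    finally show "x \<bullet> (S *v x) = - (\<Sum>j\<in>{j. d j < 0}. (P x $ j)\<^sup>2) + (\<Sum>j\<in>-{j. d j < 0}. (P x $ j)\<^sup>2)"
      by (simp add: sum_negf)
  qed
qed

text \<open>Write G u = u . S(u) u by Taylor's formula and let C(u) be the square root of S(0)^{-1}
  S(u) near 1. Self-adjointness of C(u) gives S(u) = C(u)^T S(0) C(u), so u \<mapsto> C(u) u turns G
  into the constant form S(0), which is then diagonalised by P. As C(0) = 1, the derivative of m at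
  0 is P.\<close>

theorem Morse_lemma:
  fixes G :: "real^'k \<Rightarrow> real"
  assumes "0 < r" "smooth_on G (ball 0 r)" "G 0 = 0" "\<And>v. FD G 0 v = 0"
    and "det (\<chi> i j. FD (\<lambda>q. FD G q (axis i 1)) 0 (axis j 1)) \<noteq> 0"
  obtains N and m :: "real^'k \<Rightarrow> real^'k" and \<Lambda> :: "'k set" where "open N" "0 \<in> N" "smooth_on m N"
    "m 0 = 0" "inj (FD m 0)"
    "\<And>u. u \<in> N \<Longrightarrow> G u = - (\<Sum>j\<in>\<Lambda>. (m u $ j)\<^sup>2) + (\<Sum>j\<in>-\<Lambda>. (m u $ j)\<^sup>2)"
proof -
  obtain S :: "real^'k \<Rightarrow> real^'k^'k" where S: "smooth_on S (ball 0 r)"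
    "\<And>u. u \<in> ball 0 r \<Longrightarrow> transpose (S u) = S u"
    "\<And>u. u \<in> ball 0 r \<Longrightarrow> G u = u \<bullet> (S u *v u)"
    "S 0 = (1/2) *\<^sub>R (\<chi> i j. FD (\<lambda>q. FD G q (axis i 1)) 0 (axis j 1))"
    using second_order_Hadamard[OF assms(1-4)] by blast
  have det: "det (S 0) \<noteq> 0"
  proof -
    let ?H = "\<chi> i j. FD (\<lambda>q. FD G q (axis i 1)) 0 (axis j 1)"
    obtain T where "?H ** T = mat 1"
      using assms(5) invertible_det_nz[of ?H] unfolding invertible_def by blast
    then have "S 0 ** (2 *\<^sub>R T) = mat 1"
      unfolding S(4) by (simp add: matrix_scalar_ac scalar_matrix_assoc[symmetric])
    from arg_cong[OF this, of det] show ?thesis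
      by (auto simp: det_mul)
  qed
  have S0: "transpose (S 0) = S 0" using S(2) assms(1) by simp
  obtain T where T: "S 0 ** T = mat 1" "T ** S 0 = mat 1"
    using det invertible_det_nz[of "S 0"] unfolding invertible_def by blast
  have T': "transpose T = T"
  proof -
    have "transpose T = transpose T ** (S 0 ** T)" using T by simp
    also have "\<dots> = transpose (S 0 ** T) ** T"
      by (simp add: matrix_transpose_mul S0 matrix_mul_assoc)
    finally show ?thesis using T by (simp add: transpose_mat)
  qed
  obtain U V :: "(real^'k^'k) set" and R where R: "open U" "mat 1 \<in> U" "open V" "mat 1 \<in> V"
    "smooth_on R V" "R (mat 1) = mat 1" "\<And>X. X \<in> V \<Longrightarrow> R X \<in> U" "\<And>X. X \<in> V \<Longrightarrow> R X ** R X = X"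
    "\<And>X. X \<in> U \<Longrightarrow> X ** X \<in> V \<and> R (X ** X) = X"
    by (rule smooth_matrix_square_root) blast
  txt \<open>The adjoint with respect to the form \<open>S 0\<close>. As \<open>(S 0)\<inverse> S u\<close> is self-adjoint, so is its square
    root, because square roots near the identity are unique.\<close>
  define star where "star X = T ** transpose X ** S 0" for X
  have lin_star: "linear star"
    unfolding star_def
    by (rule linearI) (auto simp: transpose_def matrix_matrix_mult_def vec_eq_iff algebra_simps
        sum.distrib sum_distrib_left)
  have star_mult: "star (X ** Y) = star Y ** star X" for X Y
  proof -
    have "star Y ** star X = T ** transpose Y ** (S 0 ** T) ** transpose X ** S 0"
      by (simp add: star_def matrix_mul_assoc)
    then show ?thesis
      by (simp add: T star_def matrix_transpose_mul matrix_mul_assoc)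
  qed
  have star_one: "star (mat 1) = mat 1" by (simp add: star_def T transpose_mat)
  define Q where "Q u = T ** S u" for u
  have Q0: "Q 0 = mat 1" by (simp add: Q_def T)
  have smQ: "smooth_on Q (ball 0 r)"
    unfolding Q_def using S(1)
    by (auto intro!: Ck_on_bilinear[OF open_ball bounded_bilinear_matrix_mult] Ck_on_const)
  have starQ: "star (Q u) = Q u" if "u \<in> ball 0 r" for u
    using that by (simp add: star_def Q_def matrix_transpose_mul S(2) T' T matrix_mul_assoc[symmetric])
  define N1 where "N1 = ball 0 r \<inter> Q -` V"
  have N1: "open N1" unfolding N1_def
    using continuous_open_preimage[OF smooth_on_continuous_on[OF smQ] open_ball R(3)] by simp
  define C where "C u = R (Q u)" for u
  have smC: "smooth_on C N1"
  proof
    fix k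
    have "Ck_on k Q N1"
      by (rule Ck_on_subset[OF smQ[rule_format]]) (auto simp: N1_def)
    then show "Ck_on k C N1"
      unfolding C_def by (rule Ck_on_compose[OF N1 R(5)[rule_format]]) (auto simp: N1_def)
  qed
  \<comment> \<open>Requiring \<open>star (C u)\<close> to lie in U as well brings both roots
    \<open>C u\<close> and \<open>star (C u)\<close> of \<open>Q u\<close> into the range of
    uniqueness.\<close>
  define N where "N = N1 \<inter> (\<lambda>u. star (C u)) -` U"
  have "continuous_on N1 (\<lambda>u. star (C u))"
    by (rule continuous_on_compose2[OF _ smooth_on_continuous_on[OF smC] subset_UNIV])
       (simp add: linear_continuous_on linear_linear lin_star)
  then have N: "open N" unfolding N_def
    using continuous_open_preimage[OF _ N1 R(1)] by simp
  have N0: "0 \<in> N" using assms(1) by (simp add: N_def N1_def Q0 C_def R star_one)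
  have CC: "C u ** C u = Q u" if "u \<in> N" for u
    using that by (simp add: C_def N_def N1_def R(8))
  have starC: "star (C u) = C u" if u: "u \<in> N" for u
  proof -
    have "star (C u) ** star (C u) = Q u"
      using u starQ[of u] CC[OF u] by (simp add: star_mult[symmetric] N_def N1_def)
    then show ?thesis
      using R(9)[of "star (C u)"] u by (simp add: N_def C_def)
  qed
  have GC: "G u = (C u *v u) \<bullet> (S 0 *v (C u *v u))" if u: "u \<in> N" for u
  proof -
    have "S u = (S 0 ** T) ** S u" by (simp add: T)
    also have "\<dots> = S 0 ** (C u ** C u)"
      by (simp add: CC[OF u] Q_def matrix_mul_assoc)
    also have "\<dots> = (S 0 ** star (C u)) ** C u"
      by (simp add: starC[OF u] matrix_mul_assoc)
    also have "S 0 ** star (C u) = transpose (C u) ** S 0"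
      by (simp add: star_def matrix_mul_assoc T)
    finally have "S u *v u = transpose (C u) *v (S 0 *v (C u *v u))"
      by (simp add: matrix_vector_mul_assoc matrix_mul_assoc)
    moreover have "G u = u \<bullet> (S u *v u)"
      using S(3) u by (simp add: N_def N1_def)
    moreover have "u \<bullet> (transpose (C u) *v y) = (C u *v u) \<bullet> y" for y
      unfolding transpose_matrix_vector inner_commute[of u] dot_lmul_matrix by (rule inner_commute)
    ultimately show ?thesis by simp
  qed
  obtain P :: "real^'k \<Rightarrow> real^'k" and \<Lambda> :: "'k set" where P: "linear P" "inj P"
    "\<And>x. x \<bullet> (S 0 *v x) = - (\<Sum>j\<in>\<Lambda>. (P x $ j)\<^sup>2) + (\<Sum>j\<in>-\<Lambda>. (P x $ j)\<^sup>2)"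
    using diagonalize_quadratic_form[OF S0 det] by blast
  define m where "m u = P (C u *v u)" for u
  have smC': "smooth_on C N" using smC Ck_on_subset unfolding N_def by blast
  have id: "Ck_on k (\<lambda>u::real^'k. u) N" for k
    using Ck_on_linear[OF linear_id] by (simp add: id_def)
  show ?thesis
  proof (rule that[OF N N0])
    show "smooth_on m N"
      unfolding m_def using smC' id
      by (auto intro!: Ck_on_linear_compose[OF N P(1)] Ck_on_bilinear[OF N bounded_bilinear_matrix_vector_mult])
    show "m 0 = 0" by (simp add: m_def linear_0[OF P(1)])
    have "((\<lambda>u. C u *v u) has_derivative (\<lambda>v. C 0 *v v + FD C 0 v *v 0)) (at 0)"
      by (intro bounded_bilinear.FDERIV[OF bounded_bilinear_matrix_vector_mult]
          smooth_on_has_derivative[OF smC' N0] has_derivative_ident)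
    then have "((\<lambda>u. C u *v u) has_derivative (\<lambda>v. v)) (at 0)"
      by (simp add: C_def Q0 R)
    then have "(m has_derivative P) (at 0)"
      unfolding m_def using P(1) by (auto intro: bounded_linear.has_derivative simp: linear_linear)
    then show "inj (FD m 0)" using P(2) FD_eqI by metis
    show "G u = - (\<Sum>j\<in>\<Lambda>. (m u $ j)\<^sup>2) + (\<Sum>j\<in>-\<Lambda>. (m u $ j)\<^sup>2)" if "u \<in> N" for u
      using GC[OF that] P(3) by (simp add: m_def)
  qed
qed

section \<open>Holomorphic functions and charts\<close>

lemma has_derivative_vec_componentwise:
  fixes F :: "'a::real_normed_vector \<Rightarrow> 'b::euclidean_space^'m"
  assumes "\<And>j. ((\<lambda>x. F x $ j) has_derivative (\<lambda>v. F' v $ j)) (at x)"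
  shows "(F has_derivative F') (at x)"
proof (subst has_derivative_componentwise_within, intro ballI)
  fix b :: "'b^'m" assume "b \<in> Basis"
  then obtain i c where b: "b = axis i c" by (auto simp: Basis_vec_def)
  show "((\<lambda>x. F x \<bullet> b) has_derivative (\<lambda>v. F' v \<bullet> b)) (at x)"
    unfolding b inner_axis by (rule has_derivative_inner_left[OF assms])
qed

text \<open>Here v sits in the inner derivative, whose linearity holds at each z separately;
  symmetry moves it to the outer slot, where the linearity is that of a single differential.\<close>

lemma second_FD_basis_expansion:
  fixes F :: "'a::euclidean_space \<Rightarrow> 'b::euclidean_space"
  assumes "open W" "smooth_on F W" "q \<in> W"
  shows "FD (\<lambda>z. FD F z v) q \<beta> = (\<Sum>b\<in>Basis. (v \<bullet> b) *\<^sub>R FD (\<lambda>z. FD F z b) q \<beta>)"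
proof -
  have "linear (FD (\<lambda>z. FD F z \<beta>) q)"
    by (rule linear_FD[OF smooth_on_differentiable[OF smooth_on_FD[OF assms(2)] assms(3)]])
  from linear_basis_expansion[OF this, of v] show ?thesis
    by (simp only: second_derivative_symmetric[OF assms, of \<beta>])
qed

lemma FD_compose:
  assumes "F differentiable (at (\<psi> c))" "\<psi> differentiable (at c)"
  shows "FD (\<lambda>c. F (\<psi> c)) c v = FD F (\<psi> c) (FD \<psi> c v)"
  using FD_eqI[OF has_derivative_compose[OF has_derivative_FD[OF assms(2)] has_derivative_FD[OF assms(1)]]]
  by simp

text \<open>The chain rule would add dF applied to the second derivative of \<psi>, and this term
  drops out at a critical point. So the Hessian there is a quadratic form independent of
  coordinates, which connects C^n with the slice and with a fold chart.\<close>

lemma second_derivative_chain_critical: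
  fixes F :: "'b::euclidean_space \<Rightarrow> real" and \<psi> :: "'a::euclidean_space \<Rightarrow> 'b"
  assumes "open V" "smooth_on \<psi> V" "c0 \<in> V" "open W" "smooth_on F W" "\<psi> ` V \<subseteq> W"
    and crit: "\<And>v. FD F (\<psi> c0) v = 0"
  shows "FD (\<lambda>c. FD (\<lambda>c. F (\<psi> c)) c \<alpha>) c0 \<beta> = FD (\<lambda>z. FD F z (FD \<psi> c0 \<alpha>)) (\<psi> c0) (FD \<psi> c0 \<beta>)"
proof -
  have inW: "\<psi> c \<in> W" if "c \<in> V" for c using assms(6) that by blast
  note dF = smooth_on_differentiable[OF assms(5) inW] and d\<psi> = smooth_on_differentiable[OF assms(2)]
  have "((\<lambda>c. \<Sum>b\<in>Basis. FD F (\<psi> c) b *\<^sub>R (FD \<psi> c \<alpha> \<bullet> b)) has_derivative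
      (\<lambda>\<beta>. \<Sum>b\<in>Basis. FD (\<lambda>z. FD F z b) (\<psi> c0) (FD \<psi> c0 \<beta>) *\<^sub>R (FD \<psi> c0 \<alpha> \<bullet> b))) (at c0)"
  proof (intro has_derivative_sum has_derivative_scaleR_vanishing)
    fix b :: 'b
    show "((\<lambda>c. FD F (\<psi> c) b) has_derivative (\<lambda>\<beta>. FD (\<lambda>z. FD F z b) (\<psi> c0) (FD \<psi> c0 \<beta>))) (at c0)"
      by (rule has_derivative_compose[OF smooth_on_has_derivative[OF assms(2,3)]
            smooth_on_has_derivative[OF smooth_on_FD[OF assms(5)] inW[OF assms(3)]]])
    show "FD F (\<psi> c0) b = 0" by (rule crit)
    show "isCont (\<lambda>c. FD \<psi> c \<alpha> \<bullet> b) c0"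
      using smooth_on_continuous_on[OF smooth_on_FD[OF assms(2)]] assms(1,3)
      by (intro continuous_intros) (simp add: continuous_on_eq_continuous_at)
  qed
  moreover have "(\<Sum>b\<in>Basis. FD F (\<psi> c) b *\<^sub>R (FD \<psi> c \<alpha> \<bullet> b)) = FD (\<lambda>c. F (\<psi> c)) c \<alpha>" if "c \<in> V" for c
    using linear_basis_expansion[OF linear_FD[OF dF[OF that]], of "FD \<psi> c \<alpha>"] FD_compose[OF dF[OF that] d\<psi>[OF that]]
    by (simp add: mult.commute)
  ultimately have "((\<lambda>c. FD (\<lambda>c. F (\<psi> c)) c \<alpha>) has_derivative
      (\<lambda>\<beta>. \<Sum>b\<in>Basis. FD (\<lambda>z. FD F z b) (\<psi> c0) (FD \<psi> c0 \<beta>) *\<^sub>R (FD \<psi> c0 \<alpha> \<bullet> b))) (at c0)"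
    using has_derivative_transform_within_open[OF _ assms(1,3)] by fastforce
  from FD_eqI[OF this] show ?thesis
    using second_FD_basis_expansion[OF assms(4,5) inW[OF assms(3)], of "FD \<psi> c0 \<alpha>" "FD \<psi> c0 \<beta>"]
    by (simp add: mult.commute)
qed

section \<open>Holomorphic functions of several variables through real differentials\<close>

text \<open>The Cauchy-Riemann equations at a point, phrased as complex linearity of the real
  differential so that the symmetry of real second derivatives remains applicable.\<close>

definition complex_linear_FD :: "(complex^'n::finite \<Rightarrow> complex) \<Rightarrow> complex^'n \<Rightarrow> bool" where
  "complex_linear_FD F z \<longleftrightarrow> F differentiable (at z) \<and> (\<forall>c v. FD F z (c *s v) = c * FD F z v)"

lemma complex_linear_FDI:
  assumes "(F has_derivative F') (at z)" "\<And>c v. F' (c *s v) = c * F' v"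
  shows "complex_linear_FD F z"
  unfolding complex_linear_FD_def using assms FD_eqI[OF assms(1)] by (auto simp: differentiable_def)

lemma complex_linear_FD_has_derivative:
  "complex_linear_FD F z \<Longrightarrow> (F has_derivative FD F z) (at z)"
  by (simp add: complex_linear_FD_def has_derivative_FD)

lemma complex_linear_FD_const: "complex_linear_FD (\<lambda>z. c) z"
  by (rule complex_linear_FDI[OF has_derivative_const]) simp

lemma complex_linear_FD_nth: "complex_linear_FD (\<lambda>z. z $ j) z"
  by (rule complex_linear_FDI[OF bounded_linear_imp_has_derivative[OF bounded_linear_vec_nth]]) simp

lemma complex_linear_FD_mult:
  assumes "complex_linear_FD F z" "complex_linear_FD G z"
  shows "complex_linear_FD (\<lambda>z. F z * G z) z"
  by (rule complex_linear_FDI[OF has_derivative_mult[OF assms[THEN complex_linear_FD_has_derivative]]])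
     (use assms in \<open>simp add: complex_linear_FD_def algebra_simps\<close>)

lemma complex_linear_FD_sum:
  assumes "\<And>i. i \<in> I \<Longrightarrow> complex_linear_FD (F i) z"
  shows "complex_linear_FD (\<lambda>z. \<Sum>i\<in>I. F i z) z"
  by (rule complex_linear_FDI[OF has_derivative_sum[OF complex_linear_FD_has_derivative[OF assms]]])
     (use assms in \<open>simp_all add: complex_linear_FD_def sum_distrib_left\<close>)

lemma complex_linear_FD_power:
  assumes "complex_linear_FD F z"
  shows "complex_linear_FD (\<lambda>z. F z ^ m) z"
  by (induction m) (auto intro: complex_linear_FD_const complex_linear_FD_mult assms)

lemma complex_linear_FD_prod:
  assumes "\<And>i. i \<in> I \<Longrightarrow> complex_linear_FD (F i) z"
  shows "complex_linear_FD (\<lambda>z. \<Prod>i\<in>I. F i z) z"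
  using assms
  by (induction I rule: infinite_finite_induct)
     (auto intro: complex_linear_FD_const complex_linear_FD_mult)

text \<open>Dividing by c moves the branch cut: with \<open>c = F p\<close> the principal logarithm
  is smooth near p whatever the argument of \<open>F p\<close>, and c cancels from the logarithmic
  derivative.\<close>

lemma has_derivative_Ln_quotient:
  assumes "(F has_derivative F') (at z)" "c \<noteq> 0" "F z / c \<notin> \<real>\<^sub>\<le>\<^sub>0"
  shows "((\<lambda>z. Ln (F z / c)) has_derivative (\<lambda>v. F' v / F z)) (at z)"
proof -
  have "((\<lambda>z. F z / c) has_derivative (\<lambda>v. F' v / c)) (at z)"
    using has_derivative_mult_left[OF assms(1), of "inverse c"] unfolding divide_inverse .
  from has_derivative_compose[OF this
      has_field_derivative_imp_has_derivative[OF has_field_derivative_Ln[OF assms(3)]]]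
  show ?thesis using assms(2) by (simp add: field_simps)
qed

lemma complex_linear_expansion:
  fixes L :: "complex^'n::finite \<Rightarrow> complex"
  assumes "linear L" "\<And>c v. L (c *s v) = c * L v"
  shows "L v = (\<Sum>j\<in>UNIV. v $ j * L (axis j 1))"
proof -
  have "L v = L (\<Sum>j\<in>UNIV. v $ j *s axis j 1)" by (simp add: basis_expansion)
  then show ?thesis by (simp add: linear_sum[OF assms(1)] assms(2))
qed

lemma complex_linear_FD_expansion:
  assumes "complex_linear_FD F z"
  shows "FD F z v = (\<Sum>j\<in>UNIV. v $ j * FD F z (axis j 1))"
  using assms by (intro complex_linear_expansion linear_FD) (auto simp: complex_linear_FD_def)

lemma partial_deriv_eq_FD:
  assumes "complex_linear_FD F z"
  shows "partial_deriv j F z = FD F z (axis j 1)"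
proof -
  have "((\<lambda>t. z + axis j t) has_derivative axis j) (at (0::complex))"
  proof (rule has_derivative_vec_componentwise)
    fix i show "((\<lambda>t. (z + axis j t) $ i) has_derivative (\<lambda>v. axis j v $ i)) (at (0::complex))"
      by (cases "i = j") (auto simp: axis_def intro!: derivative_eq_intros)
  qed
  then have "((\<lambda>t. F (z + axis j t)) has_derivative (\<lambda>t. FD F z (axis j t))) (at 0)"
    by (rule has_derivative_compose)
       (simp add: complex_linear_FD_has_derivative[OF assms] axis_def vec_eq_iff flip: zero_vec_def)
  moreover have "(\<lambda>t. FD F z (axis j t)) = (*) (FD F z (axis j 1))"
  proof
    fix t
    have "axis j t = t *s axis j (1::complex)" by (simp add: vec_eq_iff axis_def)
    then show "FD F z (axis j t) = FD F z (axis j 1) * t"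
      using assms by (simp only: complex_linear_FD_def mult.commute)
  qed
  ultimately have "((\<lambda>t. F (z + axis j t)) has_field_derivative FD F z (axis j 1)) (at 0)"
    by (simp only: has_field_derivative_def)
  then show ?thesis
    unfolding partial_deriv_def by (rule DERIV_imp_deriv)
qed

text \<open>The constant c accounts for a change of branch of a logarithm. No differentiability
  enters, since \<open>deriv\<close> chooses from the same set of derivatives on both sides.\<close>

lemma partial_deriv_cong:
  assumes "open W" "z \<in> W" "\<And>x. x \<in> W \<Longrightarrow> F x = G x + c"
  shows "partial_deriv j F z = partial_deriv j G z"
proof -
  have "((\<lambda>t. z + axis j t) \<longlongrightarrow> z + axis j 0) (nhds (0::complex))"
  proof (rule vec_tendstoI)
    fix i show "((\<lambda>t. (z + axis j t) $ i) \<longlongrightarrow> (z + axis j 0) $ i) (nhds (0::complex))"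
      using tendsto_add[OF tendsto_const filterlim_ident, of "z $ i" "0::complex"]
      by (cases "i = j") (auto simp: axis_def)
  qed
  moreover have "z + axis j 0 = z" by (simp add: vec_eq_iff axis_def)
  ultimately have "\<forall>\<^sub>F t in nhds 0. z + axis j t \<in> W"
    using assms(1,2) by (simp add: topological_tendstoD)
  then have "\<forall>\<^sub>F t in nhds 0. F (z + axis j t) = G (z + axis j t) + c"
    by eventually_elim (rule assms(3))
  then have "deriv (\<lambda>t. F (z + axis j t)) 0 = deriv (\<lambda>t. G (z + axis j t) + c) 0"
    by (intro deriv_cong_ev) auto
  also have "\<dots> = deriv (\<lambda>t. G (z + axis j t)) 0"
  proof -
    have "((\<lambda>t. G (z + axis j t) + c) has_field_derivative D) (at 0) \<longleftrightarrow>
        ((\<lambda>t. G (z + axis j t)) has_field_derivative D) (at 0)" for D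
      using DERIV_add[OF _ DERIV_const[of c], of "\<lambda>t. G (z + axis j t)" D 0]
        DERIV_diff[OF _ DERIV_const[of c], of "\<lambda>t. G (z + axis j t) + c" D 0] by auto
    then show ?thesis unfolding deriv_def by simp
  qed
  finally show ?thesis by (simp add: partial_deriv_def)
qed

text \<open>The outer derivative can be exchanged with the inner one, which is complex linear at
  every point of W.\<close>

lemma complex_linear_second_FD:
  assumes "open W" "smooth_on F W" "\<And>z. z \<in> W \<Longrightarrow> complex_linear_FD F z" "p \<in> W"
  shows "complex_linear_FD (\<lambda>z. FD F z v) p"
proof -
  have "FD (\<lambda>z. FD F z v) p (c *s u) = c * FD (\<lambda>z. FD F z v) p u" for c u
  proof -
    have "FD (\<lambda>z. FD F z v) p (c *s u) = FD (\<lambda>z. FD F z (c *s u)) p v"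
      by (rule second_derivative_symmetric[OF assms(1,2,4)])
    also have "\<dots> = FD (\<lambda>z. c * FD F z u) p v"
      by (rule fun_cong[OF FD_cong[OF assms(1,4)]]) (use assms(3) in \<open>simp add: complex_linear_FD_def\<close>)
    also have "\<dots> = c * FD (\<lambda>z. FD F z u) p v"
      using FD_eqI[OF has_derivative_mult_right[OF
            smooth_on_has_derivative[OF smooth_on_FD[OF assms(2)] assms(4)]]] by simp
    also have "FD (\<lambda>z. FD F z u) p v = FD (\<lambda>z. FD F z v) p u"
      by (rule second_derivative_symmetric[OF assms(1,2,4)])
    finally show ?thesis .
  qed
  then show ?thesis
    using smooth_on_differentiable[OF smooth_on_FD[OF assms(2)] assms(4)]
    by (simp add: complex_linear_FD_def)
qed

lemma hessian_eq_second_FD: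
  assumes "open W" "smooth_on F W" "\<And>z. z \<in> W \<Longrightarrow> complex_linear_FD F z" "p \<in> W"
  shows "hessian F p $ a $ b = FD (\<lambda>z. FD F z (axis b 1)) p (axis a 1)"
proof -
  have "partial_deriv a (partial_deriv b F) p = partial_deriv a (\<lambda>z. FD F z (axis b 1)) p"
    by (rule partial_deriv_cong[OF assms(1,4), of _ _ 0]) (use assms(3) in \<open>simp add: partial_deriv_eq_FD\<close>)
  then show ?thesis
    using partial_deriv_eq_FD[OF complex_linear_second_FD[OF assms]] by (simp add: hessian_def)
qed

lemma hessian_quadratic_form:
  assumes "open W" "smooth_on F W" "\<And>z. z \<in> W \<Longrightarrow> complex_linear_FD F z" "p \<in> W"
  shows "(\<Sum>a\<in>UNIV. \<Sum>b\<in>UNIV. u $ a * hessian F p $ a $ b * v $ b) = FD (\<lambda>z. FD F z v) p u"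
proof -
  have "FD (\<lambda>z. FD F z v) p u = (\<Sum>a\<in>UNIV. u $ a * FD (\<lambda>z. FD F z v) p (axis a 1))"
    by (rule complex_linear_FD_expansion[OF complex_linear_second_FD[OF assms]])
  also have "\<dots> = (\<Sum>a\<in>UNIV. u $ a * FD (\<lambda>z. FD F z (axis a 1)) p v)"
    by (simp only: second_derivative_symmetric[OF assms(1,2,4), of v])
  also have "\<dots> = (\<Sum>a\<in>UNIV. u $ a * (\<Sum>b\<in>UNIV. v $ b * FD (\<lambda>z. FD F z (axis a 1)) p (axis b 1)))"
    by (simp only: complex_linear_FD_expansion[OF complex_linear_second_FD[OF assms], of _ v])
  also have "\<dots> = (\<Sum>a\<in>UNIV. u $ a * (\<Sum>b\<in>UNIV. v $ b * hessian F p $ a $ b))"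
    using second_derivative_symmetric[OF assms(1,2,4)] hessian_eq_second_FD[OF assms] by simp
  finally show ?thesis by (simp add: sum_distrib_left mult_ac)
qed

section \<open>Charts on level sets\<close>

text \<open>D straightens M near p to the hyperplane where the last coordinate vanishes. The chart
  consists of the other coordinates of D, and its inverse is that of D restricted to points
  \<open>(y, 0)\<close>.\<close>

lemma local_coordinates_level_set:
  fixes D :: "'a::euclidean_space \<Rightarrow> 'b::euclidean_space \<times> real"
  assumes "open W" "smooth_on D W" "p \<in> W" "D p = 0" "inj (FD D p)" "DIM('a) = DIM('b) + 1"
    and M: "\<And>z. z \<in> W \<Longrightarrow> z \<in> M \<longleftrightarrow> snd (D z) = 0"
  obtains U where "local_coordinates M p U (\<lambda>z. fst (D z))" "U \<subseteq> M \<inter> W"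
proof -
  obtain U V G where UV: "open U" "U \<subseteq> W" "p \<in> U" "open V" "D p \<in> V" "homeomorphism U V D G" "smooth_on G V"
    by (rule smooth_inverse_function[OF assms(1-3,5)]) (use assms(6) in auto)
  have DU: "D z \<in> V" "G (D z) = z" if "z \<in> U" for z
    using UV(6) that by (auto simp: homeomorphism_def)
  have GV: "G y \<in> U" "D (G y) = y" if "y \<in> V" for y
    using UV(6) that by (auto simp: homeomorphism_def)
  define X where "X = (\<lambda>y. (y, 0::real)) -` V"
  have oX: "open X" unfolding X_def
    by (intro continuous_open_vimage UV(4)) (intro continuous_intros)
  have DX: "D z = (fst (D z), 0)" if "z \<in> M \<inter> U" for z
    using M[of z] UV(2) that by (auto simp: prod_eq_iff)
  have GX: "G (y, 0) \<in> M \<inter> U" "D (G (y, 0)) = (y, 0)" if "y \<in> X" for y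
    using GV[of "(y, 0)"] M[of "G (y, 0)"] UV(2) that by (auto simp: X_def)
  have img: "(\<lambda>z. fst (D z)) ` (M \<inter> U) = X"
  proof (intro equalityI subsetI)
    fix y assume "y \<in> (\<lambda>z. fst (D z)) ` (M \<inter> U)"
    then show "y \<in> X" using DX DU(1) unfolding X_def by fastforce
  next
    fix y assume "y \<in> X"
    then show "y \<in> (\<lambda>z. fst (D z)) ` (M \<inter> U)"
      using GX[of y] by (intro image_eqI[of _ _ "G (y, 0)"]) auto
  qed
  have smx: "smooth_on (\<lambda>z. fst (D z)) W"
    using assms(2) by (simp add: Ck_on_fst[OF assms(1)])
  have smG: "smooth_on (\<lambda>y. G (y, 0)) X"
  proof
    fix k
    have "Ck_on k (\<lambda>y::'b. (y, 0::real)) X"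
      by (rule Ck_on_linear) (auto intro!: linearI)
    then show "Ck_on k (\<lambda>y. G (y, 0)) X"
      by (rule Ck_on_compose[OF oX UV(7)[rule_format]]) (auto simp: X_def)
  qed
  have "homeomorphism (M \<inter> U) X (\<lambda>z. fst (D z)) (\<lambda>y. G (y, 0))"
  proof (rule homeomorphismI)
    show "continuous_on (M \<inter> U) (\<lambda>z. fst (D z))"
      using smooth_on_continuous_on[OF smx] UV(2) by (auto intro: continuous_on_subset)
    show "continuous_on X (\<lambda>y. G (y, 0))"
      using smooth_on_continuous_on[OF smG] .
    show "(\<lambda>z. fst (D z)) ` (M \<inter> U) \<subseteq> X" using img by simp
    show "(\<lambda>y. G (y, 0)) ` X \<subseteq> M \<inter> U" using GX by auto
    show "G (fst (D z), 0) = z" if "z \<in> M \<inter> U" for z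
      using DU(2)[of z] DX[OF that] that by simp
    show "fst (D (G (y, 0))) = y" if "y \<in> X" for y using GX that by simp
  qed
  moreover have "smooth_map_on (M \<inter> U) (\<lambda>z. fst (D z))"
    by (rule smooth_on_imp_smooth_map_on[OF assms(1) smx]) (use UV(2) in auto)
  moreover have "smooth_map_on X (\<lambda>y. G (y, 0))"
    by (rule smooth_on_imp_smooth_map_on[OF oX smG]) auto
  moreover have "p \<in> M" using M[OF assms(3)] assms(4) by simp
  ultimately have "local_coordinates M p (M \<inter> U) (\<lambda>z. fst (D z))"
    unfolding local_coordinates_def img
    using oX UV(1,3) assms(4) by (auto simp: openin_open)
  then show ?thesis using that UV(2) by blast
qed

section \<open>Angular coordinates on the torus\<close>

definition torus_chart_domain :: "complex \<Rightarrow> complex \<Rightarrow> (complex \<times> complex) set" where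
  "torus_chart_domain a b = {c. fst c / a \<notin> \<real>\<^sub>\<le>\<^sub>0 \<and> snd c / b \<notin> \<real>\<^sub>\<le>\<^sub>0}"

text \<open>Angles relative to the base point (a, b), sheared by s. Along \<Phi>, with base point
  \<Phi> p, the second coordinate becomes arg g - s arg f up to a constant, which is the function
  T.\<close>

definition torus_angle :: "complex \<Rightarrow> complex \<Rightarrow> real \<Rightarrow> complex \<times> complex \<Rightarrow> real^2" where
  "torus_angle a b s c = vector [Im (Ln (fst c / a)), Im (Ln (snd c / b)) - s * Im (Ln (fst c / a))]"

definition torus_param :: "complex \<Rightarrow> complex \<Rightarrow> real \<Rightarrow> real^2 \<Rightarrow> complex \<times> complex" where
  "torus_param a b s e = (a * exp (\<i> * of_real (e $ 1)), b * exp (\<i> * of_real (e $ 2 + s * e $ 1)))"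

lemma open_torus_chart_domain: "open (torus_chart_domain a b)"
proof -
  have "torus_chart_domain a b = (\<lambda>c. fst c / a) -` (- \<real>\<^sub>\<le>\<^sub>0) \<inter> (\<lambda>c. snd c / b) -` (- \<real>\<^sub>\<le>\<^sub>0)"
    by (auto simp: torus_chart_domain_def)
  moreover have "continuous_on UNIV (\<lambda>c::complex \<times> complex. fst c / a)"
    "continuous_on UNIV (\<lambda>c::complex \<times> complex. snd c / b)"
    unfolding divide_inverse by (intro continuous_intros)+
  ultimately show ?thesis
    by (simp add: open_Int open_vimage open_Compl)
qed

lemma smooth_on_torus_angle: "smooth_on (torus_angle a b s) (torus_chart_domain a b)"
proof
  fix k
  note o = open_torus_chart_domain[of a b]
  have Im: "linear Im" by (auto intro: linearI)
  have id: "Ck_on k (\<lambda>c::complex \<times> complex. c) (torus_chart_domain a b)"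
    using Ck_on_linear[OF linear_id] by (simp add: id_def)
  have 1: "Ck_on k (\<lambda>c. Im (Ln (fst c / a))) (torus_chart_domain a b)"
    unfolding divide_inverse
    by (intro Ck_on_linear_compose[OF o Im] Ck_on_Ln[OF o] Ck_on_mult[OF o] Ck_on_const Ck_on_fst[OF o] id)
       (simp add: torus_chart_domain_def divide_inverse)
  have 2: "Ck_on k (\<lambda>c. Im (Ln (snd c / b))) (torus_chart_domain a b)"
    unfolding divide_inverse
    by (intro Ck_on_linear_compose[OF o Im] Ck_on_Ln[OF o] Ck_on_mult[OF o] Ck_on_const Ck_on_snd[OF o] id)
       (simp add: torus_chart_domain_def divide_inverse)
  show "Ck_on k (torus_angle a b s) (torus_chart_domain a b)"
  proof (rule Ck_on_vec_lambda[OF o])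
    fix i :: 2
    show "Ck_on k (\<lambda>c. torus_angle a b s c $ i) (torus_chart_domain a b)"
      using exhaust_2[of i] 1 Ck_on_diff[OF o 2 Ck_on_mult[OF o Ck_on_const 1]]
      by (auto simp: torus_angle_def)
  qed
qed

lemma smooth_on_torus_param: "smooth_on (torus_param a b s) UNIV"
proof
  fix k
  have id: "Ck_on k (\<lambda>c::real^2. c) UNIV"
    using Ck_on_linear[OF linear_id] by (simp add: id_def)
  have "linear (of_real :: real \<Rightarrow> complex)" by (auto intro: linearI simp: scaleR_conv_of_real)
  then show "Ck_on k (torus_param a b s) UNIV"
    unfolding torus_param_def
    by (intro Ck_on_Pair Ck_on_mult Ck_on_const Ck_on_exp Ck_on_linear_compose[of _ of_real] Ck_on_add
        Ck_on_vec_nth id open_UNIV)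
qed

lemma cmod_one_eq_exp_Im_Ln:
  assumes "cmod w = 1"
  shows "exp (\<i> * of_real (Im (Ln w))) = w"
proof -
  have w: "w \<noteq> 0" using assms by auto
  then have "Ln w = \<i> * of_real (Im (Ln w))"
    using assms by (intro complex_eqI) (auto simp: Re_Ln)
  then show ?thesis using exp_Ln[OF w] by simp
qed

lemma Im_Ln_exp: "\<bar>t\<bar> < pi \<Longrightarrow> Im (Ln (exp (\<i> * of_real t))) = t"
  by (subst Ln_exp) auto

lemma exp_i_not_nonpos: "\<bar>t\<bar> < pi \<Longrightarrow> exp (\<i> * of_real t) \<notin> \<real>\<^sub>\<le>\<^sub>0"
proof
  assume t: "\<bar>t\<bar> < pi" and n: "exp (\<i> * of_real t) \<in> \<real>\<^sub>\<le>\<^sub>0"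
  then have "Im (Ln (exp (\<i> * of_real t))) = pi"
    by (metis Im_Ln_eq_pi complex_nonpos_Reals_iff complex.expand exp_not_eq_zero le_less zero_complex.sel)
  then show False using Im_Ln_exp[OF t] t by simp
qed

lemma abs_Im_Ln_less_pi: "w \<notin> \<real>\<^sub>\<le>\<^sub>0 \<Longrightarrow> \<bar>Im (Ln w)\<bar> < pi"
  by (metis Im_Ln_less_pi abs_less_iff complex_nonpos_Reals_iff minus_less_iff mpi_less_Im_Ln
      order.refl zero_complex.sel)

lemma torus_param_angle:
  assumes "c \<in> torus" "cmod a = 1" "cmod b = 1"
  shows "torus_param a b s (torus_angle a b s c) = c"
proof -
  have "cmod (fst c / a) = 1" "cmod (snd c / b) = 1" "a \<noteq> 0" "b \<noteq> 0"
    using assms by (auto simp: torus_def norm_divide)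
  then show ?thesis
    by (simp add: torus_param_def torus_angle_def cmod_one_eq_exp_Im_Ln prod_eq_iff)
qed

lemma torus_angle_param:
  fixes e :: "real^2"
  assumes "a \<noteq> 0" "b \<noteq> 0" "\<bar>e $ 1\<bar> < pi" "\<bar>e $ 2 + s * e $ 1\<bar> < pi"
  shows "torus_angle a b s (torus_param a b s e) = e"
  using assms by (simp add: torus_angle_def torus_param_def Im_Ln_exp vec_eq_iff forall_2 del: of_real_add of_real_mult)

lemma local_coordinates_torus:
  assumes "cmod a = 1" "cmod b = 1"
  shows "local_coordinates torus (a, b) (torus \<inter> torus_chart_domain a b) (torus_angle a b s)"
proof -
  have ab: "a \<noteq> 0" "b \<noteq> 0" using assms by auto
  let ?W = "torus \<inter> torus_chart_domain a b"
  \<comment> \<open>The image is the square of pairs of angles in (-pi, pi), sheared to a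
    parallelogram.\<close>
  define Y where "Y = {e::real^2. \<bar>e $ 1\<bar> < pi \<and> \<bar>e $ 2 + s * e $ 1\<bar> < pi}"
  have param: "torus_param a b s e \<in> ?W" if "e \<in> Y" for e
    using that assms ab exp_i_not_nonpos[of "e $ 1"] exp_i_not_nonpos[of "e $ 2 + s * e $ 1"]
    by (auto simp: Y_def torus_def torus_param_def torus_chart_domain_def norm_mult simp del: of_real_add of_real_mult)
  have angle: "torus_angle a b s c \<in> Y" if "c \<in> ?W" for c
    using that abs_Im_Ln_less_pi[of "fst c / a"] abs_Im_Ln_less_pi[of "snd c / b"]
    by (simp add: Y_def torus_angle_def torus_chart_domain_def)
  have inv1: "torus_angle a b s (torus_param a b s e) = e" if "e \<in> Y" for e
    using that torus_angle_param[OF ab] by (simp add: Y_def)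
  have inv2: "torus_param a b s (torus_angle a b s c) = c" if "c \<in> ?W" for c
    using that torus_param_angle[OF _ assms] by blast
  have img: "torus_angle a b s ` ?W = Y"
    using param angle inv1 by (auto intro!: image_eqI[of _ _ "torus_param a b s _"])
  have "open Y" unfolding Y_def
    by (intro open_Collect_conj open_Collect_less continuous_intros)
  moreover have "homeomorphism ?W Y (torus_angle a b s) (torus_param a b s)"
  proof (rule homeomorphismI)
    show "continuous_on ?W (torus_angle a b s)"
      by (rule continuous_on_subset[OF smooth_on_continuous_on[OF smooth_on_torus_angle]]) auto
    show "continuous_on Y (torus_param a b s)"
      by (rule continuous_on_subset[OF smooth_on_continuous_on[OF smooth_on_torus_param]]) auto
  qed (use param angle inv1 inv2 in auto)
  moreover have "smooth_map_on ?W (torus_angle a b s)"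
    by (rule smooth_on_imp_smooth_map_on[OF open_torus_chart_domain smooth_on_torus_angle]) auto
  moreover have "smooth_map_on Y (torus_param a b s)"
    by (rule smooth_on_imp_smooth_map_on[OF open_UNIV smooth_on_torus_param]) auto
  moreover have "torus_angle a b s (a, b) = 0"
    using ab by (simp add: torus_angle_def vec_eq_iff forall_2)
  ultimately show ?thesis
    unfolding local_coordinates_def img
    using assms ab open_torus_chart_domain[of a b]
    by (auto simp: openin_open torus_def torus_chart_domain_def)
qed

section \<open>Milnor fibration product maps\<close>

lemma linear_Re: "linear Re" and linear_Im: "linear Im"
  by (auto intro: linearI)

lemma has_derivative_exp_compose:
  fixes F :: "'a::real_normed_vector \<Rightarrow> complex"
  assumes "(F has_derivative F') (at z)"
  shows "((\<lambda>z. exp (F z)) has_derivative (\<lambda>v. exp (F z) * F' v)) (at z)"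
  using has_derivative_compose[OF assms has_field_derivative_imp_has_derivative[OF DERIV_exp]] .

text \<open>The numbers \<open>a j\<close> stand for the reciprocals of the weights of f. As the
  weights of g are s times as large, its Euler identity reads E g = s g for the same field E.
  \<open>card_k\<close> avoids truncated subtraction, and \<open>r_span\<close> expresses the second
  slice equation by the differential of arg f.\<close>

locale milnor_pair =
  fixes f g :: "complex^'n::finite \<Rightarrow> complex" and a :: "'n \<Rightarrow> real" and s :: real
    and p :: "complex^'n" and r :: "'k::finite \<Rightarrow> complex^'n"
  assumes smooth_f: "smooth_on f UNIV" and smooth_g: "smooth_on g UNIV"
    and lin_f: "\<And>z. complex_linear_FD f z" and lin_g: "\<And>z. complex_linear_FD g z"
    and a_pos: "\<And>j. 0 < a j"
    and Euler_f: "\<And>z. FD f z (\<chi> j. of_real (a j) * z $ j) = f z"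
    and Euler_g: "\<And>z. FD g z (\<chi> j. of_real (a j) * z $ j) = of_real s * g z"
    and p_nz: "p \<noteq> 0" "f p \<noteq> 0" "g p \<noteq> 0"
    and card_k: "CARD('k) + 2 = 2 * CARD('n)"
    and r_inj: "inj r" and r_indep: "independent (range r)"
    and r_span: "span (range r) = {v. v \<bullet> p = 0 \<and> Im (FD f p v / f p) = 0}"
begin

definition E :: "complex^'n \<Rightarrow> complex^'n" where
  "E z = (\<chi> j. of_real (a j) * z $ j)"

definition W0 :: "(complex^'n) set" where
  "W0 = {z. f z / f p \<notin> \<real>\<^sub>\<le>\<^sub>0 \<and> g z / g p \<notin> \<real>\<^sub>\<le>\<^sub>0}"

text \<open>Dividing by the values at p selects branches that vanish at p; other local branches
  change h by a constant, which the Hessian does not see. The factor -i makes the real part of h an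
  angle instead of a logarithmic modulus.\<close>

definition h :: "complex^'n \<Rightarrow> complex" where
  "h z = - \<i> * (Ln (g z / g p) - of_real s * Ln (f z / f p))"

definition \<theta> :: "complex^'n \<Rightarrow> real" where
  "\<theta> z = Im (Ln (f z / f p))"

definition T :: "complex^'n \<Rightarrow> real" where
  "T z = Re (h z)"

definition M :: "(complex^'n) set" where
  "M = {z. norm z = norm p \<and> f z * g z \<noteq> 0}"

definition \<Phi> :: "complex^'n \<Rightarrow> complex \<times> complex" where
  "\<Phi> z = (f z / of_real (cmod (f z)), g z / of_real (cmod (g z)))"

lemma continuous_f: "continuous_on UNIV f" and continuous_g: "continuous_on UNIV g"
  using smooth_f smooth_g smooth_on_continuous_on by blast+

lemma open_W0: "open W0"
proof -
  have "W0 = (\<lambda>z. f z / f p) -` (- \<real>\<^sub>\<le>\<^sub>0) \<inter> (\<lambda>z. g z / g p) -` (- \<real>\<^sub>\<le>\<^sub>0)"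
    by (auto simp: W0_def)
  moreover have "continuous_on UNIV (\<lambda>z. f z / f p)" "continuous_on UNIV (\<lambda>z. g z / g p)"
    using p_nz by (auto intro!: continuous_intros continuous_f continuous_g)
  ultimately show ?thesis
    by (simp add: open_Int open_vimage open_Compl)
qed

lemma p_in_W0: "p \<in> W0"
  using p_nz by (simp add: W0_def complex_nonpos_Reals_iff)

lemma W0_nz: "z \<in> W0 \<Longrightarrow> f z \<noteq> 0" "z \<in> W0 \<Longrightarrow> g z \<noteq> 0"
  by (auto simp: W0_def)

lemma Ck_f: "Ck_on k f V" and Ck_g: "Ck_on k g V"
  using smooth_f smooth_g Ck_on_subset by blast+

lemma Ck_Ln: "Ck_on k (\<lambda>z. Ln (f z / f p)) W0" "Ck_on k (\<lambda>z. Ln (g z / g p)) W0"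
  unfolding divide_inverse
  by (intro Ck_on_Ln[OF open_W0] Ck_on_mult[OF open_W0] Ck_on_const Ck_f Ck_g;
      simp add: W0_def divide_inverse)+

lemma smooth_h: "smooth_on h W0"
  unfolding h_def by (intro allI Ck_on_mult[OF open_W0] Ck_on_diff[OF open_W0] Ck_on_const Ck_Ln)

lemma smooth_T: "smooth_on T W0"
  unfolding T_def
  by (intro allI Ck_on_linear_compose[OF open_W0 linear_Re] smooth_h[rule_format])

lemma smooth_\<theta>: "smooth_on \<theta> W0"
  unfolding \<theta>_def
  by (intro allI Ck_on_linear_compose[OF open_W0 linear_Im] Ck_Ln)

lemma has_derivative_Ln_f:
  assumes "z \<in> W0"
  shows "((\<lambda>z. Ln (f z / f p)) has_derivative (\<lambda>v. FD f z v / f z)) (at z)"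
  by (rule has_derivative_Ln_quotient[OF complex_linear_FD_has_derivative[OF lin_f]])
     (use assms p_nz in \<open>simp_all add: W0_def\<close>)

lemma has_derivative_Ln_g:
  assumes "z \<in> W0"
  shows "((\<lambda>z. Ln (g z / g p)) has_derivative (\<lambda>v. FD g z v / g z)) (at z)"
  by (rule has_derivative_Ln_quotient[OF complex_linear_FD_has_derivative[OF lin_g]])
     (use assms p_nz in \<open>simp_all add: W0_def\<close>)

lemma has_derivative_h:
  assumes "z \<in> W0"
  shows "(h has_derivative (\<lambda>v. - \<i> * (FD g z v / g z - of_real s * (FD f z v / f z)))) (at z)"
  unfolding h_def
  by (intro has_derivative_mult_right has_derivative_diff has_derivative_Ln_f has_derivative_Ln_g assms)

lemma FD_h: "z \<in> W0 \<Longrightarrow> FD h z v = - \<i> * (FD g z v / g z - of_real s * (FD f z v / f z))"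
  using FD_eqI[OF has_derivative_h] by simp

lemma lin_h: "z \<in> W0 \<Longrightarrow> complex_linear_FD h z"
  by (rule complex_linear_FDI[OF has_derivative_h])
     (use lin_f lin_g in \<open>simp_all add: complex_linear_FD_def algebra_simps\<close>)

lemma FD_T: "z \<in> W0 \<Longrightarrow> FD T z v = Re (FD h z v)"
  unfolding T_def
  using FD_eqI[OF bounded_linear.has_derivative[OF bounded_linear_Re smooth_on_has_derivative[OF smooth_h]]]
  by simp

lemma FD_\<theta>: "z \<in> W0 \<Longrightarrow> FD \<theta> z v = Im (FD f z v / f z)"
  unfolding \<theta>_def
  using FD_eqI[OF bounded_linear.has_derivative[OF bounded_linear_Im has_derivative_Ln_f]]
  by simp

lemma FD_h_E: "z \<in> W0 \<Longrightarrow> FD h z (c *s E z) = 0"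
  using lin_f[of z] lin_g[of z] Euler_f[of z] Euler_g[of z] W0_nz[of z]
  by (simp add: FD_h complex_linear_FD_def E_def)

lemma FD_\<theta>_E: "z \<in> W0 \<Longrightarrow> FD \<theta> z (c *s E z) = Im c"
  using lin_f[of z] Euler_f[of z] W0_nz[of z]
  by (simp add: FD_\<theta> complex_linear_FD_def E_def)

text \<open>Positive real multiples of E point out of the sphere because the weights are positive;
  imaginary multiples are tangent to it.\<close>

lemma E_inner_p: "(c *s E p) \<bullet> p = Re c * (\<Sum>j\<in>UNIV. a j * (cmod (p $ j))\<^sup>2)"
  unfolding inner_vec_def E_def cmod_power2 sum_distrib_left
  by (rule sum.cong) (simp_all add: inner_complex_def power2_eq_square algebra_simps)

lemma E_weight_pos: "0 < (\<Sum>j\<in>UNIV. a j * (cmod (p $ j))\<^sup>2)"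
proof -
  obtain j where "p $ j \<noteq> 0" using p_nz by (auto simp: vec_eq_iff)
  then show ?thesis
    using a_pos by (intro sum_pos2[of _ j]) (auto simp: less_imp_le)
qed

text \<open>The radial component of a multiple of E detects Re c, and d\<theta> detects Im c. So the
  complex line of E meets the slice directions only in 0.\<close>

lemma E_transverse:
  assumes "(c *s E p) \<bullet> p = 0" "FD \<theta> p (c *s E p) = 0"
  shows "c = 0"
  using assms E_weight_pos E_inner_p[of c] FD_\<theta>_E[OF p_in_W0, of c]
  by (simp add: complex_eq_iff)

lemma \<theta>_p: "\<theta> p = 0" and T_p: "T p = 0"
  using p_nz by (simp_all add: \<theta>_def T_def h_def)

lemma \<Phi>_p_norm: "cmod (fst (\<Phi> p)) = 1" "cmod (snd (\<Phi> p)) = 1"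
  using p_nz by (simp_all add: \<Phi>_def norm_divide)

lemma \<Phi>_p_nz: "fst (\<Phi> p) \<noteq> 0" "snd (\<Phi> p) \<noteq> 0"
  using \<Phi>_p_norm by auto

lemma unit_quotient:
  fixes u v :: complex
  assumes "u \<noteq> 0" "v \<noteq> 0"
  shows "u / of_real (cmod u) = v / of_real (cmod v) * exp (\<i> * of_real (Im (Ln (u / v))))"
proof -
  have nz: "u / v \<noteq> 0" using assms by simp
  have "u / v = exp (Ln (u / v))" using nz by simp
  also have "Ln (u / v) = of_real (ln (cmod (u / v))) + \<i> * of_real (Im (Ln (u / v)))"
    using nz by (intro complex_eqI) (auto simp: Re_Ln)
  also have "exp \<dots> = of_real (cmod (u / v)) * exp (\<i> * of_real (Im (Ln (u / v))))"
    using nz by (simp add: exp_add exp_of_real del: norm_divide)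
  finally show ?thesis
    using assms by (simp add: norm_divide field_simps)
qed

lemma \<Phi>_eq:
  assumes "z \<in> W0"
  shows "\<Phi> z = torus_param (fst (\<Phi> p)) (snd (\<Phi> p)) s (vector [\<theta> z, T z])"
proof -
  have "T z + s * \<theta> z = Im (Ln (g z / g p))"
    by (simp add: T_def h_def \<theta>_def)
  then show ?thesis
    using unit_quotient[OF W0_nz(1)[OF assms] p_nz(2)] unit_quotient[OF W0_nz(2)[OF assms] p_nz(3)]
    by (simp add: \<Phi>_def torus_param_def \<theta>_def)
qed

lemma angle_bounds:
  assumes "z \<in> W0"
  shows "\<bar>\<theta> z\<bar> < pi" "\<bar>T z + s * \<theta> z\<bar> < pi"
  using assms abs_Im_Ln_less_pi by (simp_all add: T_def h_def \<theta>_def W0_def)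

lemma torus_angle_\<Phi>:
  assumes "z \<in> W0"
  shows "torus_angle (fst (\<Phi> p)) (snd (\<Phi> p)) s (\<Phi> z) = vector [\<theta> z, T z]"
  unfolding \<Phi>_eq[OF assms]
  by (rule torus_angle_param[OF \<Phi>_p_nz]) (use angle_bounds[OF assms] in simp_all)

lemma \<Phi>_chart_domain:
  assumes "z \<in> W0"
  shows "\<Phi> z \<in> torus \<inter> torus_chart_domain (fst (\<Phi> p)) (snd (\<Phi> p))"
proof -
  have "\<Phi> z \<in> torus" using W0_nz[OF assms] by (simp add: \<Phi>_def torus_def norm_divide)
  moreover have "\<Phi> z \<in> torus_chart_domain (fst (\<Phi> p)) (snd (\<Phi> p))"
    unfolding \<Phi>_eq[OF assms]
    using \<Phi>_p_nz exp_i_not_nonpos angle_bounds[OF assms]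
    by (simp add: torus_chart_domain_def torus_param_def del: of_real_add of_real_mult)
  ultimately show ?thesis by blast
qed

section \<open>The transversal slice at p\<close>

definition L :: "real^'k \<Rightarrow> complex^'n" where
  "L u = (\<Sum>k\<in>UNIV. u $ k *\<^sub>R r k)"

lemma linear_L: "linear L"
  by (rule linearI) (simp_all add: L_def scaleR_left_distrib sum.distrib scaleR_sum_right)

lemma L_axis: "L (axis i 1) = r i"
proof -
  have "L (axis i 1) = (\<Sum>k\<in>UNIV. if k = i then r k else 0)"
    unfolding L_def by (rule sum.cong) (auto simp: axis_def)
  then show ?thesis by simp
qed

lemma L_in_slice: "L u \<bullet> p = 0" "FD \<theta> p (L u) = 0"
proof -
  have "L u \<in> span (range r)"
    unfolding L_def by (intro span_sum span_scale span_base) auto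
  then show "L u \<bullet> p = 0" "FD \<theta> p (L u) = 0"
    unfolding r_span by (simp_all add: FD_\<theta>[OF p_in_W0])
qed

lemma inj_L: "inj L"
  unfolding linear_injective_0[OF linear_L]
proof (intro allI impI)
  fix u assume "L u = 0"
  then have "(\<Sum>v\<in>range r. u $ (inv r v) *\<^sub>R v) = 0"
    using r_inj by (simp add: sum.reindex L_def)
  then have "u $ inv r v = 0" if "v \<in> range r" for v
    using r_indep[unfolded independent_explicit, THEN conjunct2, THEN spec[of _ "\<lambda>v. u $ inv r v"]] that
    by blast
  then show "u = 0" using r_inj by (metis inv_f_f rangeI vec_eq_iff zero_index)
qed

lemma slice_eq_range_L:
  assumes "v \<bullet> p = 0" "FD \<theta> p v = 0"
  obtains u where "v = L u"
proof -
  have "v \<in> span (range r)"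
    using assms unfolding r_span by (simp add: FD_\<theta>[OF p_in_W0])
  moreover have "span (range r) \<subseteq> range L"
  proof (rule span_minimal)
    show "range r \<subseteq> range L" using L_axis by (metis image_subsetI rangeI)
    show "subspace (range L)" by (simp add: linear_subspace_image linear_L)
  qed
  ultimately show ?thesis using that by blast
qed

text \<open>Great circles through \<open>p\<close> suffice as test curves for the image of the differential.\<close>

lemma great_circle_in_differential_image:
  assumes "v \<bullet> p = 0" "norm v = norm p"
  shows "(fst (\<Phi> p) * (\<i> * of_real (FD \<theta> p v)),
          snd (\<Phi> p) * (\<i> * of_real (FD T p v + s * FD \<theta> p v))) \<in> differential_image M \<Phi> p"
proof -
  define \<gamma> where "\<gamma> t = cos t *\<^sub>R p + sin t *\<^sub>R v" for t :: real
  have norm_\<gamma>: "norm (\<gamma> t) = norm p" for t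
  proof -
    have "v \<bullet> v = p \<bullet> p" "p \<bullet> v = 0"
      using assms by (simp_all add: dot_square_norm inner_commute)
    then have "\<gamma> t \<bullet> \<gamma> t = (cos t * cos t) * (p \<bullet> p) + (sin t * sin t) * (p \<bullet> p)"
      using assms(1) unfolding \<gamma>_def inner_add_left inner_add_right inner_scaleR_left inner_scaleR_right
      by simp
    also have "\<dots> = ((cos t)\<^sup>2 + (sin t)\<^sup>2) * (p \<bullet> p)"
      by (simp only: power2_eq_square distrib_right)
    finally show ?thesis by (simp add: norm_eq_sqrt_inner)
  qed
  \<comment> \<open>Smoothness of cos and sin is inherited from exp(i t) by taking real and
    imaginary parts.\<close>
  have cs: "Ck_on k (\<lambda>t::real. cos t) UNIV" "Ck_on k (\<lambda>t::real. sin t) UNIV" for k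
  proof -
    have "linear (\<lambda>t::real. \<i> * of_real t)" by (auto intro: linearI simp: algebra_simps scaleR_conv_of_real)
    then have e: "Ck_on k (\<lambda>t::real. exp (\<i> * of_real t)) UNIV"
      by (intro Ck_on_exp Ck_on_linear open_UNIV)
    from Ck_on_linear_compose[OF open_UNIV linear_Re e] Ck_on_linear_compose[OF open_UNIV linear_Im e]
    show "Ck_on k (\<lambda>t::real. cos t) UNIV" "Ck_on k (\<lambda>t::real. sin t) UNIV"
      by (simp_all add: Re_exp Im_exp)
  qed
  have smooth_\<gamma>: "smooth_on \<gamma> UNIV"
    unfolding \<gamma>_def by (intro allI Ck_on_add Ck_on_scaleR cs Ck_on_const open_UNIV)
  have \<gamma>0: "\<gamma> 0 = p" by (simp add: \<gamma>_def)
  have op: "open (\<gamma> -` W0)"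
    using open_vimage[OF open_W0 smooth_on_continuous_on[OF smooth_\<gamma>]] .
  obtain \<delta> where \<delta>: "\<delta> > 0" "ball 0 \<delta> \<subseteq> \<gamma> -` W0"
    using op p_in_W0 \<gamma>0 open_contains_ball[of "\<gamma> -` W0"] by (metis vimageI2)
  have d\<gamma>: "(\<gamma> has_derivative (\<lambda>t. t *\<^sub>R v)) (at 0)"
    unfolding \<gamma>_def by (auto intro!: derivative_eq_intros)
  have lin: "linear (FD \<theta> p)" "linear (FD T p)"
    using linear_FD smooth_on_differentiable[OF smooth_\<theta> p_in_W0] smooth_on_differentiable[OF smooth_T p_in_W0]
    by blast+
  have d\<theta>: "((\<lambda>t. \<theta> (\<gamma> t)) has_derivative (\<lambda>t. t * FD \<theta> p v)) (at 0)"
    using has_derivative_compose[OF d\<gamma>, of \<theta> "FD \<theta> p"] smooth_on_has_derivative[OF smooth_\<theta> p_in_W0] \<gamma>0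
    by (simp add: linear_scale[OF lin(1)])
  have dT: "((\<lambda>t. T (\<gamma> t)) has_derivative (\<lambda>t. t * FD T p v)) (at 0)"
    using has_derivative_compose[OF d\<gamma>, of T "FD T p"] smooth_on_has_derivative[OF smooth_T p_in_W0] \<gamma>0
    by (simp add: linear_scale[OF lin(2)])
  have aux: "((\<lambda>t. c * exp (\<i> * of_real (\<alpha> t))) has_vector_derivative c * (\<i> * of_real b)) (at 0)"
    if "(\<alpha> has_derivative (\<lambda>t. t * b)) (at 0)" "\<alpha> 0 = 0" for \<alpha> :: "real \<Rightarrow> real" and c b
  proof -
    have "((\<lambda>t. c * exp (\<i> * of_real (\<alpha> t))) has_derivative
        (\<lambda>t. c * (exp (\<i> * of_real (\<alpha> 0)) * (\<i> * of_real (t * b))))) (at 0)"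
      by (intro has_derivative_mult_right has_derivative_exp_compose has_derivative_of_real that(1))
    then show ?thesis
      unfolding has_vector_derivative_def using that(2) by (simp add: scaleR_conv_of_real mult_ac)
  qed
  have v1: "((\<lambda>t. fst (\<Phi> p) * exp (\<i> * of_real (\<theta> (\<gamma> t)))) has_vector_derivative
      fst (\<Phi> p) * (\<i> * of_real (FD \<theta> p v))) (at 0)"
    by (rule aux[OF d\<theta>]) (simp add: \<gamma>0 \<theta>_p)
  have "((\<lambda>t. T (\<gamma> t) + s * \<theta> (\<gamma> t)) has_derivative (\<lambda>t. t * FD T p v + s * (t * FD \<theta> p v))) (at 0)"
    by (intro has_derivative_add has_derivative_mult_right d\<theta> dT)
  then have "((\<lambda>t. T (\<gamma> t) + s * \<theta> (\<gamma> t)) has_derivative (\<lambda>t. t * (FD T p v + s * FD \<theta> p v))) (at 0)"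
    by (simp add: algebra_simps)
  from aux[OF this, of "snd (\<Phi> p)"]
  have v2: "((\<lambda>t. snd (\<Phi> p) * exp (\<i> * of_real (T (\<gamma> t) + s * \<theta> (\<gamma> t)))) has_vector_derivative
      snd (\<Phi> p) * (\<i> * of_real (FD T p v + s * FD \<theta> p v))) (at 0)"
    by (simp add: \<gamma>0 \<theta>_p T_p)
  have "((\<lambda>t. (fst (\<Phi> p) * exp (\<i> * of_real (\<theta> (\<gamma> t))),
        snd (\<Phi> p) * exp (\<i> * of_real (T (\<gamma> t) + s * \<theta> (\<gamma> t))))) has_vector_derivative
      (fst (\<Phi> p) * (\<i> * of_real (FD \<theta> p v)), snd (\<Phi> p) * (\<i> * of_real (FD T p v + s * FD \<theta> p v)))) (at 0)"
    by (rule has_vector_derivative_Pair[OF v1 v2])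
  note d = this
  have e: "(fst (\<Phi> p) * exp (\<i> * of_real (\<theta> (\<gamma> t))),
        snd (\<Phi> p) * exp (\<i> * of_real (T (\<gamma> t) + s * \<theta> (\<gamma> t)))) = (\<Phi> \<circ> \<gamma>) t" if "t \<in> \<gamma> -` W0" for t
    using \<Phi>_eq[of "\<gamma> t"] that by (simp add: torus_param_def)
  have "((\<Phi> \<circ> \<gamma>) has_vector_derivative
      (fst (\<Phi> p) * (\<i> * of_real (FD \<theta> p v)), snd (\<Phi> p) * (\<i> * of_real (FD T p v + s * FD \<theta> p v)))) (at 0)"
    by (rule has_vector_derivative_transform_within_open[OF d op _ e]) (use p_in_W0 \<gamma>0 in auto)
  moreover have "smooth_map_on {-\<delta><..<\<delta>} \<gamma>"
    by (rule smooth_on_imp_smooth_map_on[OF open_UNIV smooth_\<gamma>]) auto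
  moreover have "\<gamma> ` {-\<delta><..<\<delta>} \<subseteq> M"
  proof (intro image_subsetI)
    fix t assume "t \<in> {-\<delta><..<\<delta>}"
    then have "\<gamma> t \<in> W0" using \<delta>(2) by (auto simp: subset_iff dist_real_def abs_less_iff)
    then show "\<gamma> t \<in> M" using W0_nz[of "\<gamma> t"] norm_\<gamma> by (simp add: M_def)
  qed
  ultimately show ?thesis
    unfolding differential_image_def using \<delta>(1) \<gamma>0 by blast
qed

text \<open>A direction with dh \<noteq> 0 can be adjusted to a tangent one with dT \<noteq> 0.
  Together with i E, where dT = 0 but d\<theta> \<noteq> 0, it produces two independent vectors in
  the image of the differential. All v are covered, not just tangent ones, because dh vanishes on
  E.\<close>

lemma singular_imp_critical:
  assumes "singular_point M \<Phi> p"
  shows "FD h p v = 0"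
proof (rule ccontr)
  assume v: "FD h p v \<noteq> 0"
  have linh: "linear (FD h p)"
    using linear_FD smooth_on_differentiable[OF smooth_h p_in_W0] by blast
  define S where "S = (\<Sum>j\<in>UNIV. a j * (cmod (p $ j))\<^sup>2)"
  \<comment> \<open>Multiplying by the conjugate makes the value of dh real and positive, so dT is
    nonzero; subtracting a real multiple of E makes the vector tangent without changing dh;
    rescaling to length \<open>norm p\<close> fits the great circles.\<close>
  define v1 where "v1 = cnj (FD h p v) *s v"
  define v2 where "v2 = v1 - complex_of_real (v1 \<bullet> p / S) *s E p"
  define v3 where "v3 = (norm p / norm v2) *\<^sub>R v2"
  have hv2: "FD h p v2 = (cmod (FD h p v))\<^sup>2"
  proof -
    have "FD h p v2 = FD h p v1"
      by (simp only: v2_def linear_diff[OF linh] FD_h_E[OF p_in_W0] diff_zero)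
    also have "\<dots> = FD h p v * cnj (FD h p v)"
      using lin_h[OF p_in_W0] by (simp add: v1_def complex_linear_FD_def)
    finally show ?thesis by (simp only: complex_norm_square)
  qed
  then have v2: "v2 \<noteq> 0" using v linear_0[OF linh] by auto
  have "v2 \<bullet> p = 0"
    using E_weight_pos E_inner_p by (simp add: v2_def inner_diff_left S_def)
  then have v3: "v3 \<bullet> p = 0" "norm v3 = norm p"
    using v2 by (simp_all add: v3_def)
  have Tv3: "FD T p v3 \<noteq> 0"
    using v v2 p_nz hv2 by (simp add: v3_def FD_T[OF p_in_W0] linear_scale[OF linh])
  define e1 where "e1 = \<i> *s E p"
  define e where "e = (norm p / norm e1) *\<^sub>R e1"
  have e1: "e1 \<noteq> 0" "e1 \<bullet> p = 0" "FD \<theta> p e1 = 1" "FD h p e1 = 0"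
    using E_inner_p[of \<i>] FD_\<theta>_E[OF p_in_W0, of \<i>] FD_h_E[OF p_in_W0, of \<i>]
      linear_0[OF linear_FD[OF smooth_on_differentiable[OF smooth_\<theta> p_in_W0]]]
    by (auto simp: e1_def)
  have e: "e \<bullet> p = 0" "norm e = norm p" "FD \<theta> p e \<noteq> 0" "FD T p e = 0"
    using e1 p_nz linear_scale[OF linear_FD[OF smooth_on_differentiable[OF smooth_\<theta> p_in_W0]]]
    by (simp_all add: e_def FD_T[OF p_in_W0] linear_scale[OF linh])
  define w1 where "w1 = (fst (\<Phi> p) * (\<i> * of_real (FD \<theta> p v3)), snd (\<Phi> p) * (\<i> * of_real (FD T p v3 + s * FD \<theta> p v3)))"
  define w2 where "w2 = (fst (\<Phi> p) * (\<i> * of_real (FD \<theta> p e)), snd (\<Phi> p) * (\<i> * of_real (FD T p e + s * FD \<theta> p e)))"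
  have w: "{w1, w2} \<subseteq> differential_image M \<Phi> p"
    using great_circle_in_differential_image v3 e unfolding w1_def w2_def by blast
  have "w2 \<noteq> 0" using e(3) \<Phi>_p_nz by (simp add: w2_def prod_eq_iff)
  moreover have "w1 \<notin> span {w2}"
  proof
    assume "w1 \<in> span {w2}"
    then obtain c where "w1 = c *\<^sub>R w2" by (auto simp: span_singleton)
    then have "fst (\<Phi> p) * (\<i> * of_real (FD \<theta> p v3)) = c *\<^sub>R (fst (\<Phi> p) * (\<i> * of_real (FD \<theta> p e)))"
      "snd (\<Phi> p) * (\<i> * of_real (FD T p v3 + s * FD \<theta> p v3)) = c *\<^sub>R (snd (\<Phi> p) * (\<i> * of_real (FD T p e + s * FD \<theta> p e)))"
      by (simp_all add: w1_def w2_def)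
    then have "complex_of_real (FD \<theta> p v3) = of_real (c * FD \<theta> p e)"
      "complex_of_real (FD T p v3 + s * FD \<theta> p v3) = of_real (c * (FD T p e + s * FD \<theta> p e))"
      using \<Phi>_p_nz by (simp_all add: scaleR_conv_of_real)
    then have "FD \<theta> p v3 = c * FD \<theta> p e" "FD T p v3 + s * FD \<theta> p v3 = c * (FD T p e + s * FD \<theta> p e)"
      using of_real_eq_iff by blast+
    then show False using Tv3 e(4) by simp
  qed
  ultimately have ind: "independent {w1, w2}" "w1 \<noteq> w2"
    using span_base[of w2 "{w2}"] by (auto simp: independent_insert)
  have "card {w1, w2} \<le> dim (differential_image M \<Phi> p)"
    by (rule independent_card_le_dim[OF w ind(1)])
  then show False
    using ind(2) assms by (simp add: singular_point_def)
qed

section \<open>The Hessian of T along the slice\<close>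

definition A :: "real^'k^'k" where
  "A = (\<chi> j k. Re (FD (\<lambda>z. FD h z (r k)) p (r j)))"

lemma second_FD_T: "FD (\<lambda>z. FD T z v) p u = Re (FD (\<lambda>z. FD h z v) p u)"
proof -
  have "FD (\<lambda>z. FD T z v) p u = FD (\<lambda>z. Re (FD h z v)) p u"
    by (rule fun_cong[OF FD_cong[OF open_W0 p_in_W0]]) (rule FD_T)
  also have "\<dots> = Re (FD (\<lambda>z. FD h z v) p u)"
    using FD_eqI[OF bounded_linear.has_derivative[OF bounded_linear_Re
          smooth_on_has_derivative[OF smooth_on_FD[OF smooth_h] p_in_W0]]] by simp
  finally show ?thesis .
qed

lemma A_nth: "A $ j $ k = FD (\<lambda>z. FD T z (r k)) p (r j)"
  by (simp add: A_def second_FD_T)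

lemma second_FD_T_L: "FD (\<lambda>z. FD T z w) p (L u) = (\<Sum>k\<in>UNIV. u $ k * FD (\<lambda>z. FD T z w) p (r k))"
proof -
  have "linear (FD (\<lambda>z. FD T z w) p)"
    by (rule linear_FD[OF smooth_on_differentiable[OF smooth_on_FD[OF smooth_T] p_in_W0]])
  then show ?thesis by (simp add: L_def linear_sum linear_scale)
qed

lemma second_FD_T_symmetric: "FD (\<lambda>z. FD T z v) p u = FD (\<lambda>z. FD T z u) p v"
  by (rule second_derivative_symmetric[OF open_W0 smooth_T p_in_W0])

section \<open>The Euler flow in complex time\<close>

definition flow :: "complex \<Rightarrow> complex^'n \<Rightarrow> complex^'n" where
  "flow \<tau> z = (\<chi> j. exp (of_real (a j) * \<tau>) * z $ j)"

lemma flow_0: "flow 0 z = z"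
  by (simp add: flow_def vec_eq_iff)

lemma has_derivative_flow: "((\<lambda>\<tau>. flow \<tau> y) has_derivative (\<lambda>\<sigma>. \<sigma> *s E (flow \<tau> y))) (at \<tau>)"
proof (rule has_derivative_vec_componentwise)
  fix j
  have "((\<lambda>\<tau>. exp (of_real (a j) * \<tau>) * y $ j) has_derivative
      (\<lambda>\<sigma>. exp (of_real (a j) * \<tau>) * (of_real (a j) * \<sigma>) * y $ j)) (at \<tau>)"
    by (intro has_derivative_mult_left has_derivative_exp_compose has_derivative_mult_right has_derivative_ident)
  then show "((\<lambda>\<tau>. flow \<tau> y $ j) has_derivative (\<lambda>\<sigma>. (\<sigma> *s E (flow \<tau> y)) $ j)) (at \<tau>)"
    by (simp add: flow_def E_def mult_ac)
qed

text \<open>The derivative in \<tau> is dT on a complex multiple of E, hence 0, and a ball is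
  convex. The flow has to stay in \<open>W0\<close>, where the branches that define T are
  smooth.\<close>

lemma T_flow:
  assumes "\<And>\<tau>. \<tau> \<in> ball 0 \<delta> \<Longrightarrow> flow \<tau> y \<in> W0" "\<tau> \<in> ball 0 \<delta>"
  shows "T (flow \<tau> y) = T y"
proof -
  have d: "((\<lambda>\<tau>. T (flow \<tau> y)) has_derivative (\<lambda>\<sigma>. 0)) (at \<tau> within ball 0 \<delta>)" if "\<tau> \<in> ball 0 \<delta>" for \<tau>
  proof -
    have "((\<lambda>\<tau>. T (flow \<tau> y)) has_derivative (\<lambda>\<sigma>. FD T (flow \<tau> y) (\<sigma> *s E (flow \<tau> y)))) (at \<tau>)"
      by (rule has_derivative_compose[OF has_derivative_flow
            smooth_on_has_derivative[OF smooth_T assms(1)[OF that]]])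
    then show ?thesis
      using assms(1)[OF that] by (simp add: FD_T FD_h_E has_derivative_at_withinI)
  qed
  have "0 \<in> ball (0::complex) \<delta>" using assms(2) le_less_trans[OF norm_ge_zero] by auto
  from has_derivative_zero_unique[OF convex_ball d assms(2) this]
  have "T (flow \<tau> y) = T (flow 0 y)" .
  then show ?thesis by (simp add: flow_0)
qed

text \<open>A flow box: complex time contributes two real dimensions, the slice the other 2n - 2.
  Near 0, moving in the first factor does not change T, so T becomes a function of the slice
  coordinate alone.\<close>

definition \<Psi> :: "complex \<times> (real^'k) \<Rightarrow> complex^'n" where
  "\<Psi> x = flow (fst x) (p + L (snd x))"

lemma \<Psi>_0: "\<Psi> 0 = p"
  by (simp add: \<Psi>_def flow_def linear_0[OF linear_L])

lemma smooth_\<Psi>: "smooth_on \<Psi> UNIV"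
proof
  fix k
  show "Ck_on k \<Psi> UNIV"
  proof (rule Ck_on_vec_lambda[OF open_UNIV])
    fix i
    have 1: "Ck_on k (\<lambda>x::complex \<times> (real^'k). fst x) UNIV" "Ck_on k (\<lambda>x::complex \<times> (real^'k). L (snd x)) UNIV"
      by (intro Ck_on_linear linear_fst)
         (intro Ck_on_linear_compose[OF open_UNIV linear_L] Ck_on_linear linear_snd)
    show "Ck_on k (\<lambda>x. \<Psi> x $ i) UNIV"
      unfolding \<Psi>_def flow_def vec_lambda_beta
      by (intro Ck_on_mult Ck_on_exp Ck_on_const Ck_on_vec_nth Ck_on_add 1 open_UNIV)
  qed
qed

lemma FD_\<Psi>_0: "FD \<Psi> 0 x = fst x *s E p + L (snd x)"
proof -
  have "(\<Psi> has_derivative (\<lambda>x. fst x *s E p + L (snd x))) (at 0)"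
  proof (rule has_derivative_vec_componentwise)
    fix j
    have "linear (\<lambda>x::complex \<times> (real^'k). L (snd x) $ j)"
      by (rule linearI) (simp_all add: linear_add[OF linear_L] linear_scale[OF linear_L])
    then have Lj: "((\<lambda>x::complex \<times> (real^'k). p $ j + L (snd x) $ j) has_derivative (\<lambda>x. 0 + L (snd x) $ j)) (at 0)"
      by (intro has_derivative_add has_derivative_const bounded_linear_imp_has_derivative)
         (simp add: linear_linear)
    have "((\<lambda>x::complex \<times> (real^'k). exp (of_real (a j) * fst x)) has_derivative
        (\<lambda>x. exp (of_real (a j) * fst (0 :: complex \<times> (real^'k))) * (of_real (a j) * fst x))) (at 0)"
      by (intro has_derivative_exp_compose has_derivative_mult_right has_derivative_fst has_derivative_ident)
    from has_derivative_mult[OF this Lj]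
    show "((\<lambda>x. \<Psi> x $ j) has_derivative (\<lambda>x. (fst x *s E p + L (snd x)) $ j)) (at 0)"
      by (simp add: \<Psi>_def flow_def E_def linear_0[OF linear_L] algebra_simps)
  qed
  from FD_eqI[OF this] show ?thesis by simp
qed

lemma FD_\<theta>_add: "FD \<theta> p (u + v) = FD \<theta> p u + FD \<theta> p v"
  using linear_add[OF linear_FD[OF smooth_on_differentiable[OF smooth_\<theta> p_in_W0]]] .

lemma inj_FD_\<Psi>: "inj (FD \<Psi> 0)"
proof -
  have lin: "linear (FD \<Psi> 0)"
    using smooth_on_differentiable[OF smooth_\<Psi>] linear_FD by blast
  show ?thesis
    unfolding linear_injective_0[OF lin]
  proof (intro allI impI)
    fix x assume "FD \<Psi> 0 x = 0"
    then have eq: "fst x *s E p + L (snd x) = 0" by (simp add: FD_\<Psi>_0)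
    have "(fst x *s E p) \<bullet> p = (fst x *s E p + L (snd x)) \<bullet> p"
      using L_in_slice by (simp add: inner_add_left)
    moreover have "FD \<theta> p (fst x *s E p) = FD \<theta> p (fst x *s E p + L (snd x))"
      using L_in_slice by (simp add: FD_\<theta>_add)
    moreover have "FD \<theta> p 0 = 0"
      using linear_0[OF linear_FD[OF smooth_on_differentiable[OF smooth_\<theta> p_in_W0]]] .
    ultimately have "fst x = 0"
      using eq by (intro E_transverse) simp_all
    then have "L (snd x) = 0" using eq by simp
    then have "snd x = 0"
      using inj_L linear_injective_0[OF linear_L] by blast
    then show "x = 0" using \<open>fst x = 0\<close> by (simp add: prod_eq_iff)
  qed
qed

lemma smooth_affine: "smooth_on (\<lambda>u. p + L u) V" if "open V"
  by (intro allI Ck_on_add[OF that] Ck_on_const Ck_on_linear linear_L)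

lemma FD_affine: "FD (\<lambda>u. p + L u) u = L"
  by (rule FD_eqI)
     (use has_derivative_add[OF has_derivative_const[of p] bounded_linear_imp_has_derivative[of L "at u"]] linear_L
       in \<open>simp add: linear_linear\<close>)

text \<open>The invariance of \<open>T\<close> under the flow makes the transversal slice \<open>p + L u\<close> carry all the
  information: a Morse chart there, together with \<open>\<theta>\<close>, is a chart of \<open>M\<close> in which \<open>\<Phi>\<close> has the fold
  normal form.\<close>

lemma nondegenerate_imp_fold:
  assumes sing: "singular_point M \<Phi> p" and det: "det A \<noteq> 0"
  shows "fold_point TYPE('k) M torus \<Phi> p"
proof -
  have crit: "FD T p v = 0" for v
    using singular_imp_critical[OF sing] by (simp add: FD_T[OF p_in_W0])
  have "DIM(complex \<times> (real^'k)) = DIM(complex^'n)"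
    using card_k by simp
  then obtain U V Gi where UV: "open U" "0 \<in> U" "open V" "\<Psi> 0 \<in> V"
    "homeomorphism U V \<Psi> Gi" "smooth_on Gi V"
    by (rule smooth_inverse_function[OF open_UNIV smooth_\<Psi> UNIV_I inj_FD_\<Psi>])
  have Gi: "\<Psi> (Gi z) = z" if "z \<in> V" for z
    using UV(5) that by (auto simp: homeomorphism_def)
  have pV: "p \<in> V" using UV(4) \<Psi>_0 by simp
  have Gip: "Gi p = 0"
    using UV(2,5) \<Psi>_0 by (metis homeomorphism_apply1)
  have "open (\<Psi> -` W0)"
    by (rule open_vimage[OF open_W0 smooth_on_continuous_on[OF smooth_\<Psi>]])
  moreover have "(0, 0) \<in> \<Psi> -` W0"
    using \<Psi>_0 p_in_W0 by (simp add: zero_prod_def)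
  \<comment> \<open>With a product neighbourhood, the flow of every slice point near p stays in
    \<open>W0\<close> for a common ball of times, as \<open>T_flow\<close> requires.\<close>
  ultimately obtain A1 A2 where A12: "open A1" "open A2" "(0, 0) \<in> A1 \<times> A2" "A1 \<times> A2 \<subseteq> \<Psi> -` W0"
    by (rule open_prod_elim)
  obtain d1 where d1: "d1 > 0" "ball 0 d1 \<subseteq> A1" using A12 open_contains_ball by blast
  obtain d2 where d2: "d2 > 0" "ball 0 d2 \<subseteq> A2" using A12 open_contains_ball by blast
  have inW0: "flow \<tau> (p + L u) \<in> W0" if "\<tau> \<in> ball 0 d1" "u \<in> ball 0 d2" for \<tau> u
    using A12(4) d1(2) d2(2) that unfolding \<Psi>_def by fastforce
  have affW0: "p + L u \<in> W0" if "u \<in> ball 0 d2" for u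
    using inW0[of 0 u] d1(1) that by (simp add: flow_0)
  define G where "G u = T (p + L u)" for u
  have smG: "smooth_on G (ball 0 d2)"
    unfolding G_def
    by (intro allI Ck_on_compose[OF open_ball smooth_T[rule_format] smooth_affine[OF open_ball, rule_format]])
       (use affW0 in auto)
  have p0: "p + L 0 = p" by (simp add: linear_0[OF linear_L])
  have G0: "G 0 = 0" by (simp add: G_def p0 T_p)
  have dG: "FD G 0 v = 0" for v
    unfolding G_def
    using FD_compose[of T "\<lambda>u. p + L u" 0 v] smooth_on_differentiable[OF smooth_T p_in_W0]
      smooth_on_differentiable[OF smooth_affine[OF open_UNIV]] crit
    by (simp add: p0)
  \<comment> \<open>Inner and outer directions appear in the opposite order to that in A, whence the
    transpose; the determinant is the same.\<close>
  have hess: "FD (\<lambda>q. FD G q (axis i 1)) 0 (axis j 1) = transpose A $ i $ j" for i j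
  proof -
    have "FD (\<lambda>q. FD G q (axis i 1)) 0 (axis j 1) =
        FD (\<lambda>z. FD T z (FD (\<lambda>u. p + L u) 0 (axis i 1))) (p + L 0) (FD (\<lambda>u. p + L u) 0 (axis j 1))"
      unfolding G_def
      by (rule second_derivative_chain_critical[OF open_ball[of 0 d2] smooth_affine[OF open_ball] _ open_W0 smooth_T])
         (use d2(1) affW0 crit in \<open>auto simp: p0\<close>)
    then show ?thesis
      by (simp add: FD_affine L_axis p0 A_nth transpose_def)
  qed
  have "det (\<chi> i j. FD (\<lambda>q. FD G q (axis i 1)) 0 (axis j 1)) \<noteq> 0"
  proof -
    have "(\<chi> i j. FD (\<lambda>q. FD G q (axis i 1)) 0 (axis j 1)) = transpose A"
      by (simp add: vec_eq_iff hess)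
    then show ?thesis using det by simp
  qed
  then obtain N and m :: "real^'k \<Rightarrow> real^'k" and \<Lambda> where N: "open N" "0 \<in> N" "smooth_on m N"
    "m 0 = 0" "inj (FD m 0)"
    "\<And>u. u \<in> N \<Longrightarrow> G u = - (\<Sum>j\<in>\<Lambda>. (m u $ j)\<^sup>2) + (\<Sum>j\<in>-\<Lambda>. (m u $ j)\<^sup>2)"
    by (rule Morse_lemma[OF d2(1) smG G0 dG]) blast
  define W1 where "W1 = V \<inter> Gi -` (ball 0 d1 \<times> (ball 0 d2 \<inter> N)) \<inter> W0"
  have "open (V \<inter> Gi -` (ball 0 d1 \<times> (ball 0 d2 \<inter> N)))"
    using UV(3) N(1) by (intro continuous_open_preimage[OF smooth_on_continuous_on[OF UV(6)]] open_Times open_Int open_ball)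
  then have oW1: "open W1" unfolding W1_def using open_W0 by blast
  have pW1: "p \<in> W1"
    using pV p_in_W0 N(2) d1(1) d2(1) by (simp add: W1_def Gip zero_prod_def)
  have TG: "T z = G (snd (Gi z))" if "z \<in> W1" for z
  proof -
    have z: "fst (Gi z) \<in> ball 0 d1" "snd (Gi z) \<in> ball 0 d2" "z \<in> V"
      using that by (auto simp: W1_def)
    have "T (flow (fst (Gi z)) (p + L (snd (Gi z)))) = T (p + L (snd (Gi z)))"
      by (rule T_flow[OF inW0[OF _ z(2)] z(1)])
    then show ?thesis using Gi[OF z(3)] by (simp add: G_def \<Psi>_def)
  qed
  \<comment> \<open>The last component, the equation of the sphere, cuts out M. What remains, Morse
    coordinates paired with \<theta>, has the shape (fold variables, last variable) of the normal
    form.\<close>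
  define D where "D z = ((m (snd (Gi z)), \<theta> z), z \<bullet> z - p \<bullet> p)" for z
  have smGi1: "smooth_on (\<lambda>z. snd (Gi z)) W1"
    by (intro allI Ck_on_snd[OF oW1] Ck_on_subset[OF UV(6)[rule_format]]) (auto simp: W1_def)
  have smmG: "smooth_on (\<lambda>z. m (snd (Gi z))) W1"
    by (intro allI Ck_on_compose[OF oW1 N(3)[rule_format] smGi1[rule_format]]) (auto simp: W1_def)
  have sm\<theta>1: "smooth_on \<theta> W1"
    by (intro allI Ck_on_subset[OF smooth_\<theta>[rule_format]]) (auto simp: W1_def)
  have smid: "Ck_on k (\<lambda>z. z) W1" for k
    using Ck_on_linear[OF linear_id] by (simp add: id_def)
  have smD: "smooth_on D W1"
    unfolding D_def
    by (intro allI Ck_on_Pair[OF oW1] smmG[rule_format] sm\<theta>1[rule_format] Ck_on_diff[OF oW1]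
        Ck_on_inner[OF oW1] smid Ck_on_const)
  have dGi: "(Gi has_derivative FD Gi p) (at p)"
    by (rule smooth_on_has_derivative[OF UV(6) pV])
  have dmG: "((\<lambda>z. m (snd (Gi z))) has_derivative (\<lambda>v. FD m 0 (snd (FD Gi p v)))) (at p)"
    using has_derivative_compose[OF has_derivative_snd[OF dGi], of m "FD m 0"]
      smooth_on_has_derivative[OF N(3,2)] by (simp add: Gip)
  have "((\<lambda>z. z \<bullet> z - p \<bullet> p) has_derivative (\<lambda>v. (p \<bullet> v + v \<bullet> p) - 0)) (at p)"
    by (intro has_derivative_diff has_derivative_inner has_derivative_ident has_derivative_const)
  then have dD: "(D has_derivative (\<lambda>v. ((FD m 0 (snd (FD Gi p v)), FD \<theta> p v), (p \<bullet> v + v \<bullet> p) - 0))) (at p)"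
    unfolding D_def
    by (intro has_derivative_Pair dmG smooth_on_has_derivative[OF smooth_\<theta> p_in_W0])
  have injD: "inj (FD D p)"
  proof -
    have lin: "linear (FD D p)"
      using smooth_on_differentiable[OF smD pW1] by (rule linear_FD)
    show ?thesis
      unfolding linear_injective_0[OF lin]
    proof (intro allI impI)
      \<comment> \<open>If the Morse part of the differential vanishes, v has no slice component in
        the flow box and is a complex multiple of E p; \<theta> and the sphere equation then force v
        = 0.\<close>
      fix v assume "FD D p v = 0"
      then have v: "FD m 0 (snd (FD Gi p v)) = 0" "FD \<theta> p v = 0" "v \<bullet> p = 0"
        unfolding FD_eqI[OF dD] by (simp_all add: zero_prod_def inner_commute)
      have "linear (FD m 0)"
        using smooth_on_differentiable[OF N(3,2)] by (rule linear_FD)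
      then have 0: "snd (FD Gi p v) = 0"
        using v(1) N(5) linear_injective_0 by blast
      have "FD (\<lambda>z. \<Psi> (Gi z)) p v = FD \<Psi> (Gi p) (FD Gi p v)"
        by (rule FD_compose)
           (use smooth_on_differentiable[OF smooth_\<Psi>] smooth_on_differentiable[OF UV(6) pV] in auto)
      moreover have "FD (\<lambda>z. \<Psi> (Gi z)) p v = FD (\<lambda>z. z) p v"
        by (rule fun_cong[OF FD_cong[OF UV(3) pV Gi]])
      moreover have "FD (\<lambda>z. z) p v = v"
        using FD_eqI[OF has_derivative_ident] by metis
      ultimately have "v = fst (FD Gi p v) *s E p"
        by (simp add: Gip FD_\<Psi>_0 0 linear_0[OF linear_L])
      then show "v = 0"
        using E_transverse[of "fst (FD Gi p v)"] v by auto
    qed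
  qed
  have Dp: "D p = 0" by (simp add: D_def Gip N(4) \<theta>_p zero_prod_def)
  have MD: "z \<in> M \<longleftrightarrow> snd (D z) = 0" if "z \<in> W1" for z
  proof -
    have "f z \<noteq> 0" "g z \<noteq> 0" using W0_nz[of z] that by (auto simp: W1_def)
    then show ?thesis by (simp add: M_def D_def norm_eq)
  qed
  have "DIM(complex^'n) = DIM((real^'k) \<times> real) + 1" using card_k by simp
  then obtain U' where U': "local_coordinates M p U' (\<lambda>z. fst (D z))" "U' \<subseteq> M \<inter> W1"
    using local_coordinates_level_set[OF oW1 smD pW1 Dp injD _ MD] by blast
  let ?y = "torus_angle (fst (\<Phi> p)) (snd (\<Phi> p)) s"
  let ?W = "torus \<inter> torus_chart_domain (fst (\<Phi> p)) (snd (\<Phi> p))"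
  have U'W0: "q \<in> W0" if "q \<in> U'" for q using that U'(2) by (auto simp: W1_def)
  have "local_coordinates torus (\<Phi> p) ?W ?y"
    using local_coordinates_torus[OF \<Phi>_p_norm] by simp
  moreover have "\<Phi> ` U' \<subseteq> ?W" using \<Phi>_chart_domain U'W0 by blast
  moreover have "?y (\<Phi> q) $ 1 = snd (fst (D q)) \<and> ?y (\<Phi> q) $ 2 =
      - (\<Sum>j\<in>\<Lambda>. (fst (fst (D q)) $ j)\<^sup>2) + (\<Sum>j\<in>-\<Lambda>. (fst (fst (D q)) $ j)\<^sup>2)" if "q \<in> U'" for q
  proof -
    have q: "q \<in> W1" using U'(2) that by blast
    have "snd (Gi q) \<in> N" using q by (auto simp: W1_def)
    then show ?thesis
      using N(6)[of "snd (Gi q)"] TG[OF q] torus_angle_\<Phi>[OF U'W0[OF that]] by (simp add: D_def)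
  qed
  ultimately show ?thesis
    unfolding fold_point_def using sing U'(1) by blast
qed

text \<open>A null vector of A corresponds in the fold chart to a vector \<open>a0\<close>
  orthogonal to everything for the form \<beta> of the normal form, which is nondegenerate; so
  \<open>a0\<close> would be 0. The chart of the torus is arbitrary, hence T has to be recovered
  from the normal form through a change of coordinates l.\<close>

lemma fold_imp_nondegenerate:
  assumes "fold_point TYPE('k) M torus \<Phi> p"
  shows "det A \<noteq> 0"
proof
  assume det: "det A = 0"
  have sing: "singular_point M \<Phi> p" using assms by (simp add: fold_point_def)
  have crit: "FD T p v = 0" for v
    using singular_imp_critical[OF sing] by (simp add: FD_T[OF p_in_W0])
  obtain U W \<Lambda> and x :: "complex^'n \<Rightarrow> (real^'k) \<times> real" and y :: "complex \<times> complex \<Rightarrow> real^2"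
    where x: "local_coordinates M p U x" and y: "local_coordinates torus (\<Phi> p) W y"
      and UW: "\<Phi> ` U \<subseteq> W"
      and nf: "\<forall>q\<in>U. y (\<Phi> q) $ 1 = snd (x q) \<and>
        y (\<Phi> q) $ 2 = - (\<Sum>j\<in>\<Lambda>. (fst (x q) $ j)\<^sup>2) + (\<Sum>j\<in>-\<Lambda>. (fst (x q) $ j)\<^sup>2)"
    using assms unfolding fold_point_def by (elim conjE exE) (rule that; assumption)
  define X where "X = x ` U"
  define Y where "Y = y ` W"
  have oX: "open X" and pU: "p \<in> U" "x p = 0" and UM: "U \<subseteq> M"
    using x openin_imp_subset[of euclidean M U] unfolding local_coordinates_def X_def by simp_all
  obtain \<psi> where \<psi>: "homeomorphism U X x \<psi>" "smooth_map_on U x" "smooth_map_on X \<psi>"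
    using x unfolding local_coordinates_def X_def[symmetric] by (elim conjE exE) (rule that; assumption)
  have oY: "open Y" and pW: "\<Phi> p \<in> W" "y (\<Phi> p) = 0" and WT: "W \<subseteq> torus"
    using y openin_imp_subset[of euclidean torus W] unfolding local_coordinates_def Y_def by simp_all
  obtain y' where y': "homeomorphism W Y y y'" "smooth_map_on W y" "smooth_map_on Y y'"
    using y unfolding local_coordinates_def Y_def[symmetric] by (elim conjE exE) (rule that; assumption)
  have sm\<psi>: "smooth_on \<psi> X" by (rule smooth_map_on_open_imp_smooth_on[OF oX \<psi>(3)])
  have smy': "smooth_on y' Y" by (rule smooth_map_on_open_imp_smooth_on[OF oY y'(3)])
  \<comment> \<open>A chart of M can be differentiated only through a local extension to C^n. The
    differential of \<open>xe\<close> at p is a left inverse of that of \<psi> at 0, which makes the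
    latter injective.\<close>
  obtain WX xe where xe: "open WX" "p \<in> WX" "smooth_on xe WX" "\<And>q. q \<in> U \<inter> WX \<Longrightarrow> xe q = x q"
    using \<psi>(2) pU(1) unfolding smooth_map_on_def by metis
  obtain WY ye where ye: "open WY" "\<Phi> p \<in> WY" "smooth_on ye WY" "\<And>q. q \<in> W \<inter> WY \<Longrightarrow> ye q = y q"
    using y'(2) pW(1) unfolding smooth_map_on_def by metis
  have \<psi>U: "\<psi> c \<in> U" "x (\<psi> c) = c" if "c \<in> X" for c
    using \<psi>(1) that by (auto simp: homeomorphism_def)
  have y'W: "y' e \<in> W" "y (y' e) = e" if "e \<in> Y" for e
    using y'(1) that by (auto simp: homeomorphism_def)
  have \<psi>0: "\<psi> 0 = p" using \<psi>(1) pU by (metis homeomorphism_apply1)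
  have y'0: "y' 0 = \<Phi> p" using y'(1) pW by (metis homeomorphism_apply1)
  have X0: "0 \<in> X" using pU unfolding X_def by (metis imageI)
  have Y0: "0 \<in> Y" using pW unfolding Y_def by (metis imageI)

  define V0 where "V0 = X \<inter> \<psi> -` (W0 \<inter> WX)"
  have oV0: "open V0" unfolding V0_def
    by (intro continuous_open_preimage[OF smooth_on_continuous_on[OF sm\<psi>] oX] open_Int open_W0 xe(1))
  have V0: "0 \<in> V0" using X0 \<psi>0 p_in_W0 xe(2) by (simp add: V0_def)
  have d\<psi>: "\<psi> differentiable (at 0)" by (rule smooth_on_differentiable[OF sm\<psi> X0])
  have lin\<psi>: "linear (FD \<psi> 0)" using d\<psi> by (rule linear_FD)
  have inj\<psi>: "FD xe p (FD \<psi> 0 v) = v" for v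
  proof -
    have "FD (\<lambda>c. xe (\<psi> c)) 0 v = FD xe p (FD \<psi> 0 v)"
      using FD_compose[of xe \<psi> 0 v] d\<psi> smooth_on_differentiable[OF xe(3,2)] \<psi>0 by simp
    moreover have "FD (\<lambda>c. xe (\<psi> c)) 0 v = FD (\<lambda>c. c) 0 v"
      by (rule fun_cong[OF FD_cong[OF oV0 V0]]) (use xe(4) \<psi>U in \<open>simp add: V0_def\<close>)
    moreover have "FD (\<lambda>c. c) 0 v = v" using FD_eqI[OF has_derivative_ident] by metis
    ultimately show ?thesis by simp
  qed

  let ?angle = "torus_angle (fst (\<Phi> p)) (snd (\<Phi> p)) s"
  let ?param = "torus_param (fst (\<Phi> p)) (snd (\<Phi> p)) s"
  let ?dom = "torus_chart_domain (fst (\<Phi> p)) (snd (\<Phi> p))"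
  \<comment> \<open>The transition on the torus from the fold coordinates to the angles (\<theta>,
    T).\<close>
  define l where "l e = ?angle (y' e)" for e
  define Y1 where "Y1 = Y \<inter> y' -` (?dom \<inter> WY)"
  have oY1: "open Y1" unfolding Y1_def
    by (intro continuous_open_preimage[OF smooth_on_continuous_on[OF smy'] oY] open_Int
        open_torus_chart_domain ye(1))
  have Y1: "0 \<in> Y1" using Y0 y'0 \<Phi>_chart_domain[OF p_in_W0] ye(2) by (simp add: Y1_def)
  have sml: "smooth_on l Y1"
  proof
    fix k
    have "Ck_on k y' Y1" by (rule Ck_on_subset[OF smy'[rule_format]]) (auto simp: Y1_def)
    then show "Ck_on k l Y1"
      unfolding l_def
      by (rule Ck_on_compose[OF oY1 smooth_on_torus_angle[rule_format]]) (auto simp: Y1_def)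
  qed
  have dl: "l differentiable (at 0)" by (rule smooth_on_differentiable[OF sml Y1])
  have linl: "linear (FD l 0)" using dl by (rule linear_FD)
  have param_l: "?param (l e) = y' e" if "e \<in> Y1" for e
    unfolding l_def using that WT y'W by (intro torus_param_angle[OF _ \<Phi>_p_norm]) (auto simp: Y1_def)
  have injl: "inj (FD l 0)"
  proof (rule inj_on_inverseI)
    fix v
    have 1: "(\<lambda>e. ?param (l e)) differentiable (at 0)"
      using differentiable_compose[OF _ dl] smooth_on_differentiable[OF smooth_on_torus_param] by blast
    have 2: "ye differentiable (at (?param (l 0)))"
      using smooth_on_differentiable[OF ye(3,2)] param_l[OF Y1] y'0 by simp
    have "FD (\<lambda>e. ye (?param (l e))) 0 v = FD ye (?param (l 0)) (FD ?param (l 0) (FD l 0 v))"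
      using FD_compose[OF 2 1] FD_compose[OF smooth_on_differentiable[OF smooth_on_torus_param UNIV_I] dl] by simp
    moreover have "FD (\<lambda>e. ye (?param (l e))) 0 v = FD (\<lambda>e. e) 0 v"
      by (rule fun_cong[OF FD_cong[OF oY1 Y1]]) (use ye(4) y'W param_l in \<open>simp add: Y1_def\<close>)
    moreover have "FD (\<lambda>e::real^2. e) 0 v = v" using FD_eqI[OF has_derivative_ident] by metis
    ultimately show "(\<lambda>w. FD ye (?param (l 0)) (FD ?param (l 0) w)) (FD l 0 v) = v" by simp
  qed

  define \<beta> where "\<beta> v w = - (\<Sum>j\<in>\<Lambda>. v $ j * w $ j) + (\<Sum>j\<in>-\<Lambda>. v $ j * w $ j)" for v w :: "real^'k"
  define \<eta> :: "(real^'k) \<times> real \<Rightarrow> real^2" where "\<eta> c = vector [snd c, \<beta> (fst c) (fst c)]" for c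
  have linr: "linear (\<beta> v)" and linL: "linear (\<lambda>v. \<beta> v w)" for v w
    unfolding \<beta>_def by (auto intro!: linearI simp: algebra_simps sum.distrib sum_distrib_left)
  have bil: "bounded_bilinear \<beta>"
    unfolding bilinear_conv_bounded_bilinear[symmetric] bilinear_def using linr linL by blast
  have \<beta>sym: "\<beta> v w = \<beta> w v" for v w by (simp add: \<beta>_def mult.commute)
  have d\<eta>: "(\<eta> has_derivative (\<lambda>v. vector [snd v, 2 * \<beta> (fst c) (fst v)])) (at c)" for c
  proof (rule has_derivative_vec_componentwise)
    fix i :: 2
    have 1: "((\<lambda>c. snd c) has_derivative snd) (at c)"
      by (intro has_derivative_snd has_derivative_ident)
    have "((\<lambda>c. \<beta> (fst c) (fst c)) has_derivative (\<lambda>v. \<beta> (fst c) (fst v) + \<beta> (fst v) (fst c))) (at c)"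
      by (intro bounded_bilinear.FDERIV[OF bil] has_derivative_fst has_derivative_ident)
    then have 2: "((\<lambda>c. \<beta> (fst c) (fst c)) has_derivative (\<lambda>v. 2 * \<beta> (fst c) (fst v))) (at c)"
      using \<beta>sym[of _ "fst c"] by simp
    show "((\<lambda>c. \<eta> c $ i) has_derivative (\<lambda>v. (vector [snd v, 2 * \<beta> (fst c) (fst v)] :: real^2) $ i)) (at c)"
      using exhaust_2[of i] 1 2 by (auto simp: \<eta>_def)
  qed
  have FD\<eta>: "FD \<eta> c v = vector [snd v, 2 * \<beta> (fst c) (fst v)]" for c v
    using FD_eqI[OF d\<eta>] by simp
  have cont\<eta>: "continuous_on UNIV \<eta>"
    using d\<eta> by (auto intro!: continuous_at_imp_continuous_on has_derivative_continuous)
  have \<beta>0: "\<beta> 0 w = 0" for w by (simp add: \<beta>_def)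
  have \<eta>0: "\<eta> 0 = 0" by (simp add: \<eta>_def \<beta>0 vec_eq_iff forall_2)
  have y\<eta>: "y (\<Phi> (\<psi> c)) = \<eta> c" if "c \<in> X" for c
    using nf[rule_format, OF \<psi>U(1)[OF that]] \<psi>U(2)[OF that]
    by (simp add: \<eta>_def \<beta>_def vec_eq_iff forall_2 power2_eq_square)
  have \<Phi>\<psi>: "\<Phi> (\<psi> c) = y' (\<eta> c)" if "c \<in> X" for c
    using y\<eta>[OF that] UW \<psi>U(1)[OF that] y'(1) by (metis homeomorphism_apply1 image_subset_iff)
  define V1 where "V1 = V0 \<inter> \<eta> -` Y1"
  have oV1: "open V1" unfolding V1_def using oV0 open_vimage[OF oY1 cont\<eta>] by blast
  have V1: "0 \<in> V1" using V0 Y1 \<eta>0 by (simp add: V1_def)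
  have l\<eta>: "l (\<eta> c) = vector [\<theta> (\<psi> c), T (\<psi> c)]" if "c \<in> V1" for c
    using torus_angle_\<Phi>[of "\<psi> c"] \<Phi>\<psi>[of c] that by (auto simp: l_def V1_def V0_def)
  have FDl\<eta>: "FD (\<lambda>c. l (\<eta> c) $ i) c v = FD l (\<eta> c) (FD \<eta> c v) $ i" if "c \<in> V1" for c v i
  proof -
    have d: "l differentiable (at (\<eta> c))"
      using that by (intro smooth_on_differentiable[OF sml]) (simp add: V1_def)
    have "(\<eta> has_derivative FD \<eta> c) (at c)"
      using d\<eta>[of c] FD_eqI[OF d\<eta>[of c]] by simp
    from has_derivative_compose[OF this has_derivative_FD[OF d]]
    have "((\<lambda>c. l (\<eta> c)) has_derivative (\<lambda>v. FD l (\<eta> c) (FD \<eta> c v))) (at c)" .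
    from FD_eqI[OF bounded_linear.has_derivative[OF bounded_linear_vec_nth this]] show ?thesis by simp
  qed
  have FD\<theta>\<psi>: "FD \<theta> p (FD \<psi> 0 v) = FD l 0 (vector [snd v, 0]) $ 1" for v
  proof -
    have "FD \<theta> p (FD \<psi> 0 v) = FD (\<lambda>c. \<theta> (\<psi> c)) 0 v"
      using FD_compose[of \<theta> \<psi> 0 v] d\<psi> smooth_on_differentiable[OF smooth_\<theta> p_in_W0] \<psi>0 by simp
    also have "\<dots> = FD (\<lambda>c. l (\<eta> c) $ 1) 0 v"
      by (rule fun_cong[OF FD_cong[OF oV1 V1]]) (simp add: l\<eta>)
    finally show ?thesis by (simp add: FDl\<eta>[OF V1] FD\<eta> \<eta>0 \<beta>0)
  qed
  have FDT\<psi>: "FD (\<lambda>c. T (\<psi> c)) c v = FD l (\<eta> c) (FD \<eta> c v) $ 2" if "c \<in> V1" for c v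
  proof -
    have "FD (\<lambda>c. T (\<psi> c)) c v = FD (\<lambda>c. l (\<eta> c) $ 2) c v"
      by (rule fun_cong[OF FD_cong[OF oV1 that]]) (simp add: l\<eta>)
    then show ?thesis by (simp add: FDl\<eta>[OF that])
  qed
  \<comment> \<open>T is critical at p, so the torus direction belonging to the last fold coordinate
    has no T component at 0.\<close>
  have FDT\<psi>0: "FD l 0 (vector [t, 0]) $ 2 = 0" for t
  proof -
    have "FD (\<lambda>c. T (\<psi> c)) 0 (0, t) = FD T p (FD \<psi> 0 (0, t))"
      using FD_compose[of T \<psi> 0 "(0, t)"] d\<psi> smooth_on_differentiable[OF smooth_T p_in_W0] \<psi>0 by simp
    then show ?thesis using FDT\<psi>[OF V1, of "(0, t)"] crit by (simp add: FD\<eta> \<eta>0 \<beta>0)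
  qed
  \<comment> \<open>\<open>FD l 0\<close> is invertible and maps the first axis into the \<theta>
    axis, so the T component of the image of the second axis cannot vanish. Up to the factor 2,
    \<kappa> is the ratio between the Hessian of T and \<beta>.\<close>
  define \<kappa> where "\<kappa> = FD l 0 (vector [0, 1]) $ 2"
  have \<kappa>: "\<kappa> \<noteq> 0"
  proof
    assume 0: "\<kappa> = 0"
    have "surj (FD l 0)" using linear_injective_imp_surjective[OF linl injl] by simp
    then obtain c where c: "FD l 0 c = vector [0, 1]" by (metis surjD)
    have "c = vector [c $ 1, 0] + (c $ 2) *\<^sub>R vector [0, 1]" by (simp add: vec_eq_iff forall_2)
    then have "FD l 0 c = FD l 0 (vector [c $ 1, 0]) + (c $ 2) *\<^sub>R FD l 0 (vector [0, 1])"
      by (metis linear_add[OF linl] linear_scale[OF linl])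
    then have "FD l 0 c $ 2 = 0" using FDT\<psi>0 0 by (simp add: \<kappa>_def)
    then show False using c by simp
  qed

  \<comment> \<open>The fold directions are tangent to the sphere and have d\<theta> = 0, since the
    normal form has no linear term in them. By dimension they fill the slice directions, so the
    Hessian on the slice can be evaluated in the chart.\<close>
  define J where "J w = FD \<psi> 0 (w, 0)" for w
  have linJ: "linear J"
  proof (rule linearI)
    fix u v :: "real^'k" and c
    show "J (u + v) = J u + J v" unfolding J_def using linear_add[OF lin\<psi>, of "(u, 0)" "(v, 0)"] by simp
    show "J (c *\<^sub>R u) = c *\<^sub>R J u" unfolding J_def using linear_scale[OF lin\<psi>, of c "(u, 0)"] by simp
  qed
  have injJ: "inj J"
    by (rule inj_on_inverseI[of _ "\<lambda>v. fst (FD xe p v)"]) (simp add: J_def inj\<psi>)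
  have J_slice: "J w \<in> range L" for w
  proof -
    have zero: "vector [0, 0] = (0 :: real^2)" by (simp add: vec_eq_iff forall_2)
    have "FD \<theta> p (J w) = 0"
      using linear_0[OF linl] by (simp add: J_def FD\<theta>\<psi> zero)
    moreover have "J w \<bullet> p = 0"
    proof -
      have d: "((\<lambda>c. \<psi> c \<bullet> \<psi> c) has_derivative (\<lambda>v. \<psi> 0 \<bullet> FD \<psi> 0 v + FD \<psi> 0 v \<bullet> \<psi> 0)) (at 0)"
        by (intro has_derivative_inner has_derivative_FD d\<psi>)
      have "\<psi> c \<bullet> \<psi> c = p \<bullet> p" if "c \<in> X" for c
        using \<psi>U(1)[OF that] UM by (auto simp: M_def norm_eq)
      then have "FD (\<lambda>c. \<psi> c \<bullet> \<psi> c) 0 = FD (\<lambda>c. p \<bullet> p) 0"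
        by (rule FD_cong[OF oX X0])
      also have "FD (\<lambda>c. p \<bullet> p) 0 = (\<lambda>v. 0)" by (rule FD_eqI) simp
      finally show ?thesis using FD_eqI[OF d] \<psi>0 by (simp add: J_def inner_commute fun_eq_iff)
    qed
    ultimately show ?thesis using slice_eq_range_L by (metis rangeI)
  qed
  have "range J = range L"
  proof (rule subspace_dim_equal)
    show "subspace (range J)" "subspace (range L)"
      using linJ linear_L by (auto intro: linear_subspace_image)
    show "range J \<subseteq> range L" using J_slice by blast
    have "dim (range J) = DIM(real^'k)" "dim (range L) = DIM(real^'k)"
      using dim_image_eq[OF linJ, of UNIV] dim_image_eq[OF linear_L, of UNIV] injJ inj_L by simp_all
    then show "dim (range L) \<le> dim (range J)" by simp
  qed

  obtain v where v: "v \<noteq> 0" "A *v v = 0"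
    using det invertible_det_nz[of A] unfolding invertible_left_inverse matrix_left_invertible_ker by blast
  obtain a0 where a0: "L v = J a0" using \<open>range J = range L\<close> by (metis rangeE rangeI)
  have "L v \<noteq> 0" using v(1) inj_L linear_injective_0[OF linear_L] by blast
  then have a0_nz: "a0 \<noteq> 0" using a0 linear_0[OF linJ] by auto
  \<comment> \<open>The entries of A are Hessian values on the basis, so the null vector pairs to 0
    with each \<open>r i\<close>, and by linearity with the whole slice.\<close>
  have radical: "FD (\<lambda>z. FD T z (L u)) p (L v) = 0" for u
  proof -
    have zero: "FD (\<lambda>z. FD T z (r i)) p (L v) = 0" for i
    proof -
      have "FD (\<lambda>z. FD T z (r i)) p (L v) = (\<Sum>k\<in>UNIV. v $ k * FD (\<lambda>z. FD T z (r k)) p (r i))"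
        unfolding second_FD_T_L by (simp only: second_FD_T_symmetric[of "r i"])
      also have "\<dots> = (A *v v) $ i"
        by (simp add: matrix_vector_mult_def A_nth mult.commute)
      finally show ?thesis using v(2) by simp
    qed
    have "FD (\<lambda>z. FD T z (L u)) p (L v) = FD (\<lambda>z. FD T z (L v)) p (L u)"
      by (rule second_FD_T_symmetric)
    also have "\<dots> = (\<Sum>k\<in>UNIV. u $ k * FD (\<lambda>z. FD T z (L v)) p (r k))"
      by (rule second_FD_T_L)
    also have "\<dots> = (\<Sum>k\<in>UNIV. u $ k * FD (\<lambda>z. FD T z (r k)) p (L v))"
      by (simp only: second_FD_T_symmetric[of "L v"])
    finally show ?thesis by (simp only: zero mult_zero_right sum.neutral_const)
  qed
  have "\<beta> a0 w = 0" for w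
  proof -
    have sm\<psi>0: "smooth_on \<psi> V0"
      by (intro allI Ck_on_subset[OF sm\<psi>[rule_format]]) (auto simp: V0_def)
    have "FD (\<lambda>c. FD (\<lambda>c. T (\<psi> c)) c (w, 0)) 0 (a0, 0) =
        FD (\<lambda>z. FD T z (FD \<psi> 0 (w, 0))) (\<psi> 0) (FD \<psi> 0 (a0, 0))"
      by (rule second_derivative_chain_critical[OF oV0 sm\<psi>0 V0 open_W0 smooth_T])
         (use crit \<psi>0 in \<open>auto simp: V0_def\<close>)
    also have "\<dots> = FD (\<lambda>z. FD T z (J w)) p (J a0)" by (simp add: J_def \<psi>0)
    also have "\<dots> = 0" using J_slice[of w] radical a0 by (metis rangeE)
    finally have zero: "FD (\<lambda>c. FD (\<lambda>c. T (\<psi> c)) c (w, 0)) 0 (a0, 0) = 0" .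
    \<comment> \<open>The formula holds near 0 and not only at 0, so it can be differentiated once
      more. Its factor \<beta> vanishes at 0, hence continuity of the varying differential of l
      suffices.\<close>
    have eq: "FD (\<lambda>c. T (\<psi> c)) c (w, 0) = (2 * \<beta> (fst c) w) *\<^sub>R (FD l (\<eta> c) (vector [0, 1]) $ 2)"
      if "c \<in> V1" for c
    proof -
      have lin: "linear (FD l (\<eta> c))"
        using that by (intro linear_FD smooth_on_differentiable[OF sml]) (simp add: V1_def)
      have "vector [0, 2 * \<beta> (fst c) w] = (2 * \<beta> (fst c) w) *\<^sub>R (vector [0, 1] :: real^2)"
        by (simp add: vec_eq_iff forall_2)
      then show ?thesis
        by (simp add: FDT\<psi>[OF that] FD\<eta> linear_scale[OF lin])
    qed
    have "((\<lambda>c. (2 * \<beta> (fst c) w) *\<^sub>R (FD l (\<eta> c) (vector [0, 1]) $ 2)) has_derivative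
        (\<lambda>v. (2 * \<beta> (fst v) w) *\<^sub>R (FD l (\<eta> 0) (vector [0, 1]) $ 2))) (at (0 :: (real^'k) \<times> real))"
    proof (rule has_derivative_scaleR_vanishing)
      have "linear (\<lambda>c::(real^'k) \<times> real. \<beta> (fst c) w)"
        by (rule linearI) (simp_all add: linear_add[OF linL] linear_scale[OF linL])
      then show "((\<lambda>c. 2 * \<beta> (fst c) w) has_derivative (\<lambda>v. 2 * \<beta> (fst v) w)) (at (0 :: (real^'k) \<times> real))"
        by (intro has_derivative_mult_right bounded_linear_imp_has_derivative) (simp add: linear_linear)
      show "2 * \<beta> (fst (0 :: (real^'k) \<times> real)) w = 0" by (simp add: \<beta>0)
      have "isCont (\<lambda>e. FD l e (vector [0, 1])) 0"
        using smooth_on_continuous_on[OF smooth_on_FD[OF sml]] oY1 Y1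
        by (simp add: continuous_on_eq_continuous_at)
      moreover have "isCont \<eta> 0" using d\<eta> by (rule has_derivative_continuous)
      ultimately have "isCont (\<lambda>c. FD l (\<eta> c) (vector [0, 1])) 0"
        using isCont_o2[of 0 \<eta> "\<lambda>e. FD l e (vector [0, 1])"] \<eta>0 by simp
      then show "isCont (\<lambda>c. FD l (\<eta> c) (vector [0, 1]) $ 2) 0"
        by (rule isCont_vec_nth)
    qed
    then have "((\<lambda>c. FD (\<lambda>c. T (\<psi> c)) c (w, 0)) has_derivative
        (\<lambda>v. (2 * \<beta> (fst v) w) *\<^sub>R (FD l (\<eta> 0) (vector [0, 1]) $ 2))) (at 0)"
      by (rule has_derivative_transform_within_open[OF _ oV1 V1]) (simp only: eq)
    from FD_eqI[OF this] zero have "2 * \<beta> a0 w * \<kappa> = 0"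
      by (simp add: \<kappa>_def \<eta>0)
    then show ?thesis using \<kappa> by simp
  qed
  \<comment> \<open>Flipping the signs on \<Lambda> turns \<beta> into the sum of the squares of the
    entries of \<open>a0\<close>.\<close>
  from this[of "\<chi> j. if j \<in> \<Lambda> then - a0 $ j else a0 $ j"]
  have "(\<Sum>j\<in>\<Lambda>. (a0 $ j)\<^sup>2) + (\<Sum>j\<in>-\<Lambda>. (a0 $ j)\<^sup>2) = 0"
    by (simp add: \<beta>_def power2_eq_square sum_negf)
  moreover have "(\<Sum>j\<in>\<Lambda>. (a0 $ j)\<^sup>2) + (\<Sum>j\<in>-\<Lambda>. (a0 $ j)\<^sup>2) = (\<Sum>j\<in>UNIV. (a0 $ j)\<^sup>2)"
    by (rule sum.subset_diff[of \<Lambda> UNIV, unfolded Compl_eq_Diff_UNIV[symmetric], symmetric, simplified add.commute]; simp)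
  ultimately have "a0 = 0"
    by (simp add: sum_nonneg_eq_0_iff vec_eq_iff)
  then show False using a0_nz by simp
qed

theorem fold_iff_nondegenerate:
  "singular_point M \<Phi> p \<Longrightarrow> fold_point TYPE('k) M torus \<Phi> p \<longleftrightarrow> det A \<noteq> 0"
  using fold_imp_nondegenerate nondegenerate_imp_fold by blast

end

section \<open>Polynomials and branches of the logarithm\<close>

lemma smooth_on_cpoly_eval: "smooth_on (cpoly_eval P) UNIV"
proof
  fix k
  have "Ck_on k (\<lambda>z::complex^'a. z) UNIV"
    using Ck_on_linear[OF linear_id] by (simp add: id_def)
  then show "Ck_on k (cpoly_eval P) UNIV"
    unfolding cpoly_eval_def
    by (intro Ck_on_sum Ck_on_mult Ck_on_const Ck_on_prod Ck_on_power Ck_on_vec_nth open_UNIV)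
qed

lemma complex_linear_FD_cpoly_eval: "complex_linear_FD (cpoly_eval P) z"
  unfolding cpoly_eval_def
  by (intro complex_linear_FD_sum complex_linear_FD_mult complex_linear_FD_const
      complex_linear_FD_prod complex_linear_FD_power complex_linear_FD_nth)

lemma weighted_homogeneous_Euler:
  assumes "weighted_homogeneous P w"
  shows "FD (cpoly_eval P) z (\<chi> j. z $ j / of_rat (w j)) = cpoly_eval P z"
proof -
  have "FD (cpoly_eval P) z (\<chi> j. z $ j / of_rat (w j)) =
      (\<Sum>j\<in>UNIV. z $ j / of_rat (w j) * partial_deriv j (cpoly_eval P) z)"
    using complex_linear_FD_expansion[OF complex_linear_FD_cpoly_eval, of P z "\<chi> j. z $ j / of_rat (w j)"]
    by (simp add: partial_deriv_eq_FD[OF complex_linear_FD_cpoly_eval])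
  then show ?thesis using assms by (simp add: weighted_homogeneous_def)
qed

text \<open>Both sides have the same exponential. Where L stays within 1 < pi of its value at p, the
  principal logarithm undoes exp on \<open>L z - L p\<close>, which rules out jumps by multiples of
  2 pi i.\<close>

lemma local_log_eq_Ln:
  assumes "local_log F p L" "F p \<noteq> 0"
  obtains W where "open W" "p \<in> W" "\<And>z. z \<in> W \<Longrightarrow> L z = Ln (F z / F p) + L p"
proof -
  obtain W where W: "open W" "p \<in> W" "continuous_on W L" "\<And>z. z \<in> W \<Longrightarrow> exp (L z) = F z"
    using assms(1) unfolding local_log_def by blast
  define V where "V = W \<inter> L -` ball (L p) 1"
  have "open V" unfolding V_def
    by (rule continuous_open_preimage[OF W(3,1) open_ball])
  moreover have "p \<in> V" using W(2) by (simp add: V_def)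
  moreover have "L z = Ln (F z / F p) + L p" if "z \<in> V" for z
  proof -
    have "\<bar>Im (L z - L p)\<bar> < 1"
      using that abs_Im_le_cmod[of "L z - L p"] by (auto simp: V_def dist_norm norm_minus_commute)
    then have "\<bar>Im (L z - L p)\<bar> < pi" using pi_gt3 by linarith
    then have "Ln (exp (L z - L p)) = L z - L p" by (intro Ln_exp) auto
    moreover have "exp (L z - L p) = F z / F p"
      using W that by (simp add: exp_diff V_def)
    ultimately show ?thesis by simp
  qed
  ultimately show ?thesis using that by blast
qed

lemma hessian_cong:
  assumes "open W" "p \<in> W" "\<And>x. x \<in> W \<Longrightarrow> F x = G x + c"
  shows "hessian F p = hessian G p"
proof -
  have "partial_deriv j (partial_deriv k F) p = partial_deriv j (partial_deriv k G) p" for j k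
    by (rule partial_deriv_cong[OF assms(1,2), of _ _ 0]) (simp add: partial_deriv_cong[OF assms(1) _ assms(3)])
  then show ?thesis by (simp add: hessian_def)
qed

lemma Re_hermitian: "Re (hermitian u v) = u \<bullet> v"
  by (simp add: hermitian_def inner_vec_def inner_complex_def)

text \<open>The conjugations in \<open>hermitian\<close> and \<open>grad\<close> cancel, and the
  conjugate of i leaves Re(-i w) = Im w. For a branch of log f this is d\<theta>, the second
  equation of the slice.\<close>

lemma Re_hermitian_grad:
  assumes "complex_linear_FD F p"
  shows "Re (hermitian v (\<i> *s grad F p)) = Im (FD F p v)"
  using complex_linear_FD_expansion[OF assms, of v] partial_deriv_eq_FD[OF assms]
  by (simp add: hermitian_def grad_def algebra_simps sum_subtractf sum.distrib)

lemma of_real_of_rat: "of_real (of_rat q) = (of_rat q :: complex)"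
  by (cases q) (simp add: of_rat_rat)

theorem theorem3p7:
  fixes f g :: "'n::finite cpoly"
    and w\<^sub>f w\<^sub>g :: "'n \<Rightarrow> rat"
    and s :: rat
  assumes "2 \<le> CARD('n)"
    and "CARD('k::finite) = 2 * CARD('n) - 2"
    and "weighted_homogeneous f w\<^sub>f"
    and "weighted_homogeneous g w\<^sub>g"
    and "0 < s"
    and "\<forall>j. w\<^sub>g j = s * w\<^sub>f j"
  shows "\<exists>\<epsilon>\<^sub>0>0. \<forall>\<epsilon>. 0 < \<epsilon> \<and> \<epsilon> \<le> \<epsilon>\<^sub>0 \<longrightarrow>
    (\<forall>p \<in> sphere 0 \<epsilon> - link \<epsilon> f g.
       singular_point (sphere 0 \<epsilon> - link \<epsilon> f g) (milnor_product_map f g) p \<longrightarrow>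
       (\<forall>logf logg (r :: 'k \<Rightarrow> complex^'n).
          local_log (cpoly_eval f) p logf \<longrightarrow>
          local_log (cpoly_eval g) p logg \<longrightarrow>
          inj r \<and> independent (range r) \<and>
          span (range r) = {v. Re (hermitian v p) = 0 \<and> Re (hermitian v (\<i> *s grad logf p)) = 0} \<longrightarrow>
          (let V = (\<chi> a j. r j $ a) :: complex^'k^'n;
               H = hessian (\<lambda>z. - \<i> * (logg z - of_rat s * logf z)) p
           in fold_point TYPE('k) (sphere 0 \<epsilon> - link \<epsilon> f g) torus (milnor_product_map f g) p \<longleftrightarrow>
              det (map_matrix Re (transpose V ** H ** V)) \<noteq> 0)))"
proof (rule exI[of _ 1], intro conjI allI impI ballI)
  \<comment> \<open>The bound 1 is a free choice: positivity of the weights makes E transverse to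
    the sphere at every radius.\<close>
  fix \<epsilon> :: real and p and logf logg and r :: "'k \<Rightarrow> complex^'n"
  assume \<epsilon>: "0 < \<epsilon> \<and> \<epsilon> \<le> 1" and p: "p \<in> sphere 0 \<epsilon> - link \<epsilon> f g"
    and sing: "singular_point (sphere 0 \<epsilon> - link \<epsilon> f g) (milnor_product_map f g) p"
    and logf: "local_log (cpoly_eval f) p logf" and logg: "local_log (cpoly_eval g) p logg"
    and r: "inj r \<and> independent (range r) \<and>
      span (range r) = {v. Re (hermitian v p) = 0 \<and> Re (hermitian v (\<i> *s grad logf p)) = 0}"
  let ?f = "cpoly_eval f" and ?g = "cpoly_eval g"
  have p_nz: "p \<noteq> 0" "?f p \<noteq> 0" "?g p \<noteq> 0" and norm_p: "norm p = \<epsilon>"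
    using p \<epsilon> by (auto simp: link_def)
  obtain Wf where Wf: "open Wf" "p \<in> Wf" "\<And>z. z \<in> Wf \<Longrightarrow> logf z = Ln (?f z / ?f p) + logf p"
    using local_log_eq_Ln[OF logf p_nz(2)] by blast
  obtain Wg where Wg: "open Wg" "p \<in> Wg" "\<And>z. z \<in> Wg \<Longrightarrow> logg z = Ln (?g z / ?g p) + logg p"
    using local_log_eq_Ln[OF logg p_nz(3)] by blast
  have dLn: "((\<lambda>z. Ln (?f z / ?f p)) has_derivative (\<lambda>v. FD ?f p v / ?f p)) (at p)"
    by (rule has_derivative_Ln_quotient[OF complex_linear_FD_has_derivative[OF complex_linear_FD_cpoly_eval]])
       (use p_nz in simp_all)
  have grad: "Re (hermitian v (\<i> *s grad logf p)) = Im (FD ?f p v / ?f p)" for v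
  proof -
    have "grad logf p = grad (\<lambda>z. Ln (?f z / ?f p)) p"
      using partial_deriv_cong[OF Wf] by (simp add: grad_def)
    moreover have "complex_linear_FD (\<lambda>z. Ln (?f z / ?f p)) p"
      by (rule complex_linear_FDI[OF dLn])
         (use complex_linear_FD_cpoly_eval[of f p] in \<open>simp add: complex_linear_FD_def\<close>)
    ultimately show ?thesis using Re_hermitian_grad FD_eqI[OF dLn] by metis
  qed
  have w_pos: "0 < w\<^sub>f j" for j using assms(3) by (simp add: weighted_homogeneous_def)
  have inv_w: "of_real (1 / of_rat (w\<^sub>f j)) = 1 / (of_rat (w\<^sub>f j) :: complex)" for j
    by (simp add: of_real_of_rat)
  interpret milnor_pair ?f ?g "\<lambda>j. 1 / of_rat (w\<^sub>f j)" "of_rat s" p r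
  proof
    show "smooth_on ?f UNIV" "smooth_on ?g UNIV" by (rule smooth_on_cpoly_eval)+
    show "complex_linear_FD ?f z" "complex_linear_FD ?g z" for z by (rule complex_linear_FD_cpoly_eval)+
    show "0 < 1 / real_of_rat (w\<^sub>f j)" for j using w_pos by simp
    show "FD ?f z (\<chi> j. of_real (1 / of_rat (w\<^sub>f j)) * z $ j) = ?f z" for z
      using weighted_homogeneous_Euler[OF assms(3), of z] by (simp add: of_real_of_rat)
    show "FD ?g z (\<chi> j. of_real (1 / of_rat (w\<^sub>f j)) * z $ j) = of_real (of_rat s) * ?g z" for z
    proof -
      \<comment> \<open>The reciprocal weights of f are s times those of g, so the Euler field of f
        is s times that of g.\<close>
      have "(\<chi> j. of_real (1 / of_rat (w\<^sub>f j)) * z $ j) = of_rat s *s (\<chi> j. z $ j / of_rat (w\<^sub>g j))"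
        using assms(5,6) by (simp add: vec_eq_iff inv_w of_real_of_rat of_rat_mult)
      then show ?thesis
        using weighted_homogeneous_Euler[OF assms(4), of z] complex_linear_FD_cpoly_eval[of g z]
        by (simp add: complex_linear_FD_def of_real_of_rat)
    qed
    show "p \<noteq> 0" "?f p \<noteq> 0" "?g p \<noteq> 0" by (rule p_nz)+
    show "CARD('k) + 2 = 2 * CARD('n)" using assms(1,2) by simp
    show "inj r" "independent (range r)" using r by blast+
    show "span (range r) = {v. v \<bullet> p = 0 \<and> Im (FD ?f p v / ?f p) = 0}"
      using r unfolding grad unfolding Re_hermitian by blast
  qed
  have M: "sphere 0 \<epsilon> - link \<epsilon> f g = M"
    using norm_p by (auto simp: M_def link_def)
  have \<Phi>: "milnor_product_map f g = \<Phi>"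
    by (simp add: fun_eq_iff milnor_product_map_def \<Phi>_def)
  define H where "H = hessian (\<lambda>z. - \<i> * (logg z - of_rat s * logf z)) p"
  define V :: "complex^'k^'n" where "V = (\<chi> a j. r j $ a)"
  have H: "H = hessian h p"
    unfolding H_def
  proof (rule hessian_cong[of "Wf \<inter> Wg"])
    fix z assume "z \<in> Wf \<inter> Wg"
    then have "logf z = Ln (?f z / ?f p) + logf p" "logg z = Ln (?g z / ?g p) + logg p"
      using Wf(3) Wg(3) by blast+
    then show "- \<i> * (logg z - of_rat s * logf z) = h z + - \<i> * (logg p - of_rat s * logf p)"
      by (simp add: h_def of_real_of_rat algebra_simps)
  qed (use Wf(1,2) Wg(1,2) in auto)
  have "map_matrix Re (transpose V ** H ** V) = A"
  proof -
    have "(transpose V ** H ** V) $ j $ k = FD (\<lambda>z. FD h z (r k)) p (r j)" for j k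
    proof -
      have "(transpose V ** H ** V) $ j $ k = (\<Sum>b\<in>UNIV. \<Sum>a\<in>UNIV. r j $ a * H $ a $ b * r k $ b)"
        by (simp add: matrix_matrix_mult_def transpose_def V_def sum_distrib_right)
      also have "\<dots> = (\<Sum>a\<in>UNIV. \<Sum>b\<in>UNIV. r j $ a * H $ a $ b * r k $ b)"
        by (rule sum.swap)
      also have "\<dots> = FD (\<lambda>z. FD h z (r k)) p (r j)"
        unfolding H by (rule hessian_quadratic_form[OF open_W0 smooth_h lin_h p_in_W0])
      finally show ?thesis .
    qed
    then show ?thesis by (simp add: vec_eq_iff A_def map_matrix_def)
  qed
  then have "fold_point TYPE('k) (sphere 0 \<epsilon> - link \<epsilon> f g) torus (milnor_product_map f g) p \<longleftrightarrow>
      det (map_matrix Re (transpose V ** H ** V)) \<noteq> 0"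
    using fold_iff_nondegenerate sing unfolding M \<Phi> by simp
  then show "let V = (\<chi> a j. r j $ a) :: complex^'k^'n;
               H = hessian (\<lambda>z. - \<i> * (logg z - of_rat s * logf z)) p
           in fold_point TYPE('k) (sphere 0 \<epsilon> - link \<epsilon> f g) torus (milnor_product_map f g) p \<longleftrightarrow>
              det (map_matrix Re (transpose V ** H ** V)) \<noteq> 0"
    unfolding Let_def V_def H_def .
qed simp

end
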